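(* Let $d\ge 1$, $k\in\mathbb{N}_0$, let $\Omega\subseteq\mathbb{R}^d$ be compact, let $|\cdot|_*$ be an arbitrary norm on $\mathbb{R}^d$, and let $\{x_n\}_{n\in I}\subseteq\mathbb{R}^d$ be a set of sampling points ($I$ a countable index set) with Voronoi cells $V_n$. Suppose that the weights are $\mu_{n,\alpha}=\frac{1}{\alpha!}\int_{V_n}(x-x_n)^{2\alpha}\,\mathrm{d}x$ and let $\delta=\sup_{x\in\mathbb{R}^d}\inf_{n\in I}|x-x_n|_*$. If $$\delta<\frac{C(k,d)}{m_\Omega b},\qquad C(k,d)=\max\{H_k(1),G_{k,d}(1)\},$$ then $$A\|f\|^2\le\sum_{n\in I}\sum_{|\alpha|_1\le k}\mu_{n,\alpha}|D^\alpha f(x_n)|^2\le B\|f\|^2,\qquad\forall f\in \mathrm{B}(\Omega),$$ where $A,B>0$ satisfy $$A\ge e^{-d}\left(1-\min\{h_k(m_\Omega b\delta),g_{k,d}(m_\Omega b\delta)\}\right)^2,\qquad B\le\exp\left(2m_\Omega b\delta+(m_\Omega b\delta)^2\right).$$ Equivalently, the set $\{\sqrt{\mu_{n,\alpha}}\,D^\alpha\Phi_\Omega(\cdot-x_n): n\in I,\ |\alpha|_1\le k\}$ forms a frame for $\mathrm{B}(\Omega)$ with bounds $A$ and $B$.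
   Context: $\|\cdot\|$ is the norm of $L^2(\mathbb{R}^d)$. The Fourier transform is $\hat f(\omega)=\int_{\mathbb{R}^d}f(x)e^{-i\omega\cdot x}\,\mathrm{d}x$, and $\mathrm{B}(\Omega)=\{f\in L^2(\mathbb{R}^d):\operatorname{supp}(\hat f)\subseteq\Omega\}$ (each $f$ is identified with its smooth representative). For $\alpha\in\mathbb{N}_0^d$: $|\alpha|_1=\alpha_1+\dots+\alpha_d$, $\alpha!=\alpha_1!\cdots\alpha_d!$, $x^\alpha=\prod_j x_j^{\alpha_j}$, and $D^\alpha$ is the corresponding partial derivative. $|\cdot|_2$ is the Euclidean norm; $b>0$ is the smallest constant with $|x|_2\le b|x|_*$ for all $x\in\mathbb{R}^d$; $m_\Omega=\sup_{\omega\in\Omega}|\omega|_2$. Voronoi cells: $V_n=\{x\in\mathbb{R}^d:|x-x_n|_*\le|x-x_m|_*\ \forall m\in I,\ m\ne n\}$. $\Phi_\Omega(x)=\frac{1}{(2\pi)^d}\int_\Omega e^{i\omega\cdot x}\,\mathrm{d}\omega$. A family $\{\phi_j\}$ in a Hilbert space is a frame with bounds $A,B>0$ if $A\|f\|^2\le\sum_j|\langle f,\phi_j\rangle|^2\le B\|f\|^2$ for all $f$ in the space. For $z\in(0,\infty)$: $R_k(z)=e^z-\sum_{r=0}^k\frac{z^r}{r!}$, $\sigma_d^*(z)=\frac{z+\sqrt{z(d+z)}}{d}$, $h_k(z)=e^zR_k(z)$, $g_{k,d}(z)=(1+2\sigma_d^*(z))^{d/2}\exp(z/\sigma_d^*(z))R_k(z)$.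 Both $h_k$ and $g_{k,d}$ increase monotonically from limit $0$ at $0^+$ to $\infty$; $H_k$ and $G_{k,d}$ denote their respective inverse functions on $(0,\infty)$.
   Formalization: The Voronoi cells are additionally assumed to partition space up to a null set (almost every point lies in exactly one V_n), since for arbitrary norms or accumulating points the cells may overlap or fail to cover and the bounds then fail. *)

theory Defs
  imports "HOL-Analysis.Analysis"
begin

section \<open>Multi-indices and partial derivatives\<close>

definition mi_size :: "('n::finite \<Rightarrow> nat) \<Rightarrow> nat" where
  "mi_size \<alpha> = (\<Sum>i\<in>UNIV. \<alpha> i)"

definition mi_fact :: "('n::finite \<Rightarrow> nat) \<Rightarrow> real" where
  "mi_fact \<alpha> = (\<Prod>i\<in>UNIV. fact (\<alpha> i))"

definition mi_pow :: "real^'n \<Rightarrow> ('n::finite \<Rightarrow> nat) \<Rightarrow> real" where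
  "mi_pow x \<alpha> = (\<Prod>i\<in>UNIV. (x $ i) ^ \<alpha> i)"

definition partial :: "'n::finite \<Rightarrow> (real^'n \<Rightarrow> complex) \<Rightarrow> real^'n \<Rightarrow> complex" where
  "partial i f x = vector_derivative (\<lambda>t. f (x + t *\<^sub>R axis i 1)) (at 0)"

(* All iterated partial derivatives are differentiable everywhere, hence continuous: f is C^infinity. *)
definition smooth :: "(real^'n::finite \<Rightarrow> complex) \<Rightarrow> bool" where
  "smooth f \<longleftrightarrow> (\<forall>is x. foldr partial is f differentiable (at x))"

(* Apply partial i exactly \<alpha> i times for every i.  The index type carries no order; for smooth f the
   order of differentiation is immaterial. *)
definition mi_deriv :: "('n::finite \<Rightarrow> nat) \<Rightarrow> (real^'n \<Rightarrow> complex) \<Rightarrow> real^'n \<Rightarrow> complex" where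
  "mi_deriv \<alpha> f = foldr partial (SOME is. \<forall>i. count_list is i = \<alpha> i) f"

section \<open>Square-integrable functions, Fourier transform, bandlimited functions\<close>

(* Representatives, not classes: no quotient by almost-everywhere equality is taken. *)
definition L2 :: "(real^'n::finite \<Rightarrow> complex) set" where
  "L2 = {f. f \<in> borel_measurable lborel \<and> integrable lborel (\<lambda>x. (cmod (f x))\<^sup>2)}"

definition L2_inner :: "(real^'n::finite \<Rightarrow> complex) \<Rightarrow> (real^'n \<Rightarrow> complex) \<Rightarrow> complex" where
  "L2_inner f g = (LINT x|lborel. f x * cnj (g x))"

definition L2_norm :: "(real^'n::finite \<Rightarrow> complex) \<Rightarrow> real" where
  "L2_norm f = sqrt (LINT x|lborel. (cmod (f x))\<^sup>2)"

definition fourier :: "(real^'n::finite \<Rightarrow> complex) \<Rightarrow> real^'n \<Rightarrow> complex" where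
  "fourier f \<omega> = (LINT x|lborel. f x * exp (- \<i> * of_real (\<omega> \<bullet> x)))"

(* F is (a representative of) the Fourier transform of the square-integrable function f: the L^2 limit,
   as R tends to infinity, of the integrals over the balls of radius R (Plancherel).  The integral over
   the whole space need not converge absolutely. *)
definition has_fourier_L2 :: "(real^'n::finite \<Rightarrow> complex) \<Rightarrow> (real^'n \<Rightarrow> complex) \<Rightarrow> bool" where
  "has_fourier_L2 f F \<longleftrightarrow> F \<in> L2 \<and>
     ((\<lambda>R. \<integral>\<^sup>+\<omega>. ennreal ((cmod (F \<omega> - fourier (\<lambda>x. indicator (cball 0 R) x * f x) \<omega>))\<^sup>2) \<partial>lborel)
        \<longlongrightarrow> 0) (at_top :: real filter)"

(* Support of an almost-everywhere class: complement of the largest open set on which F vanishes a.e. *)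
definition ess_support :: "(real^'n::finite \<Rightarrow> complex) \<Rightarrow> (real^'n) set" where
  "ess_support F = - \<Union>{U. open U \<and> (AE \<omega> in lborel. \<omega> \<in> U \<longrightarrow> F \<omega> = 0)}"

definition bandlimited :: "(real^'n::finite) set \<Rightarrow> (real^'n \<Rightarrow> complex) set" where
  "bandlimited \<Omega> = {f \<in> L2. \<exists>F. has_fourier_L2 f F \<and> ess_support F \<subseteq> \<Omega>}"

(* Unique when it exists, since continuous functions that agree almost everywhere are equal. *)
definition smooth_rep :: "(real^'n::finite \<Rightarrow> complex) \<Rightarrow> real^'n \<Rightarrow> complex" where
  "smooth_rep f = (THE g. smooth g \<and> (AE x in lborel. f x = g x))"

definition \<Phi> :: "(real^'n::finite) set \<Rightarrow> real^'n \<Rightarrow> complex" where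
  "\<Phi> \<Omega> x = of_real (1 / (2 * pi) ^ CARD('n)) *
     (LINT \<omega>:\<Omega>|lborel. exp (\<i> * of_real (\<omega> \<bullet> x)))"

(* H stands for a subspace of L^2; summability is stated because infsum is 0 for divergent sums. *)
definition L2_frame :: "(real^'n::finite \<Rightarrow> complex) set \<Rightarrow> 'j set \<Rightarrow> ('j \<Rightarrow> real^'n \<Rightarrow> complex)
    \<Rightarrow> real \<Rightarrow> real \<Rightarrow> bool" where
  "L2_frame H J \<phi> A B \<longleftrightarrow> 0 < A \<and> 0 < B \<and> (\<forall>j\<in>J. \<phi> j \<in> H) \<and>
     (\<forall>f\<in>H. (\<lambda>j. (cmod (L2_inner f (\<phi> j)))\<^sup>2) summable_on J \<and>
        A * (L2_norm f)\<^sup>2 \<le> (\<Sum>\<^sub>\<infinity>j\<in>J. (cmod (L2_inner f (\<phi> j)))\<^sup>2) \<and>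
        (\<Sum>\<^sub>\<infinity>j\<in>J. (cmod (L2_inner f (\<phi> j)))\<^sup>2) \<le> B * (L2_norm f)\<^sup>2)"

section \<open>Norms, sampling density, Voronoi cells and weights\<close>

definition is_norm :: "(real^'n::finite \<Rightarrow> real) \<Rightarrow> bool" where
  "is_norm N \<longleftrightarrow> (\<forall>x. 0 \<le> N x) \<and> (\<forall>x. N x = 0 \<longleftrightarrow> x = 0) \<and>
     (\<forall>c x. N (c *\<^sub>R x) = \<bar>c\<bar> * N x) \<and> (\<forall>x y. N (x + y) \<le> N x + N y)"

definition b_const :: "(real^'n::finite \<Rightarrow> real) \<Rightarrow> real" where
  "b_const N = (LEAST b. 0 < b \<and> (\<forall>x. norm x \<le> b * N x))"

(* Supremum in [0,\<infinity>), so the empty band has radius 0; Sup {} is unspecified on real. *)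
definition band_radius :: "(real^'n::finite) set \<Rightarrow> real" where
  "band_radius \<Omega> = (if \<Omega> = {} then 0 else (SUP \<omega>\<in>\<Omega>. norm \<omega>))"

(* Extended-valued: infinite if I is empty or the points leave arbitrarily large gaps. *)
definition sampling_density :: "(real^'n::finite \<Rightarrow> real) \<Rightarrow> ('i \<Rightarrow> real^'n) \<Rightarrow> 'i set \<Rightarrow> ennreal" where
  "sampling_density N x I = (SUP y. INF n\<in>I. ennreal (N (y - x n)))"

(* For some norms and point sets these cells do not tile space.  If the norm is not strictly convex, two
   cells can overlap in positive measure (sup norm on the plane, points (2 i, 10 j) with i, j integers);
   if the points accumulate, the cells can fail to cover (dense points: every cell is a single point).
   That they partition space up to a null set is therefore a separate assumption where it is needed. *)
definition voronoi :: "(real^'n::finite \<Rightarrow> real) \<Rightarrow> ('i \<Rightarrow> real^'n) \<Rightarrow> 'i set \<Rightarrow> 'i \<Rightarrow> (real^'n) set" where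
  "voronoi N x I n = {y. \<forall>m\<in>I. m \<noteq> n \<longrightarrow> N (y - x n) \<le> N (y - x m)}"

definition weight :: "(real^'n::finite \<Rightarrow> real) \<Rightarrow> ('i \<Rightarrow> real^'n) \<Rightarrow> 'i set \<Rightarrow> 'i \<Rightarrow> ('n \<Rightarrow> nat) \<Rightarrow> real" where
  "weight N x I n \<alpha> =
     1 / mi_fact \<alpha> * (LINT y:voronoi N x I n|lborel. mi_pow (y - x n) (\<lambda>i. 2 * \<alpha> i))"

section \<open>The density constant\<close>

definition Rk :: "nat \<Rightarrow> real \<Rightarrow> real" where
  "Rk k z = exp z - (\<Sum>r\<le>k. z ^ r / fact r)"

definition sigma_star :: "nat \<Rightarrow> real \<Rightarrow> real" where
  "sigma_star d z = (z + sqrt (z * (real d + z))) / real d"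

definition hk :: "nat \<Rightarrow> real \<Rightarrow> real" where
  "hk k z = exp z * Rk k z"

definition gkd :: "nat \<Rightarrow> nat \<Rightarrow> real \<Rightarrow> real" where
  "gkd k d z = (1 + 2 * sigma_star d z) powr (real d / 2) * exp (z / sigma_star d z) * Rk k z"

definition Hk :: "nat \<Rightarrow> real \<Rightarrow> real" where
  "Hk k = the_inv_into {0<..} (hk k)"

definition Gkd :: "nat \<Rightarrow> nat \<Rightarrow> real \<Rightarrow> real" where
  "Gkd k d = the_inv_into {0<..} (gkd k d)"

definition Ckd :: "nat \<Rightarrow> nat \<Rightarrow> real" where
  "Ckd k d = max (Hk k 1) (Gkd k d 1)"

end

theory Submission
  imports Defs "HOL-Probability.Characteristic_Functions"
begin

text \<open>
  Write \<open>d\<close> for the dimension and \<open>z = m * b * \<delta>\<close>.  A bandlimited function \<open>f\<close> is the inverse Fourier transform of a function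
  \<open>F\<close> in L2 that vanishes outside the compact set \<open>\<Omega>\<close>, so every derivative of \<open>f\<close> costs at most a factor \<open>m\<close> in L2.  On the Voronoi
  cell of \<open>x n\<close>, whose points have Euclidean distance at most \<open>b * \<delta>\<close> from \<open>x n\<close>, compare \<open>f\<close> with its Taylor polynomial
  \<open>P\<close> of degree \<open>k\<close> at \<open>x n\<close>.  By Cauchy-Schwarz, and because the sum of \<open>1 / mi_fact \<alpha>\<close> over all \<open>\<alpha>\<close> is \<open>exp d\<close>, the squared norm
  of \<open>P\<close> is at most \<open>exp d\<close> times the weighted sum of the samples.  It remains to show that the norm of \<open>f - P\<close> is at most
  \<open>e\<close> times that of \<open>f\<close>, where \<open>e < 1\<close> is the smaller of \<open>hk k z\<close> and \<open>gkd k d z\<close>; the lower bound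
  \<open>exp (- d) * (1 - e)\<^sup>2\<close> follows by the triangle inequality (\<open>sample_sum_lower\<close>).

  The remainder \<open>f - P\<close> is the sum of the Taylor terms of degree \<open>p > k\<close> at \<open>x n\<close>.  If sampling at the points \<open>x n\<close>, as a map from
  bandlimited functions to step functions on the cells, has L2 norm at most \<open>M\<close>, then the term of degree \<open>p\<close> has norm at most
  \<open>M * z ^ p / fact p\<close> times that of \<open>f\<close>, and these add up to \<open>M * Rk k z\<close>.  Two values of \<open>M\<close> are available.  Both rest on a majorant
  \<open>G\<close> of the squared modulus of \<open>f\<close> on balls of radius \<open>r\<close>, whose integral is at most \<open>exp (2 * r * m)\<close> times the squared norm of
  \<open>f\<close> (\<open>band_majorant\<close>).  For \<open>r = b * \<delta>\<close> the sample at \<open>x n\<close> is dominated by \<open>G\<close> everywhere on its cell, and \<open>M = exp z\<close>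
  (\<open>sampling_const_exp\<close>).  For arbitrary \<open>r\<close> the sample is dominated by the mean of \<open>G\<close> over a ball around \<open>x n\<close>, and comparing volumes
  gives \<open>M = (1 + 2 * \<sigma>) powr (d / 2) * exp (z / \<sigma>)\<close> for every \<open>\<sigma> > 0\<close> (\<open>sampling_const_average\<close>).  Multiplied by \<open>Rk k z\<close>, these
  are \<open>hk k z\<close> and, for \<open>\<sigma> = sigma_star d z\<close>, \<open>gkd k d z\<close>.  The upper bound uses \<open>M = exp z\<close>: the derivatives of order \<open>p\<close>
  contribute at most \<open>z ^ (2 * p) / fact p * exp (2 * z)\<close> (\<open>sample_sum_upper\<close>).

  The translation between \<open>f\<close> and \<open>F\<close> is the Plancherel theorem (\<open>Plancherel_L1_L2\<close>), proved by Gaussian regularisation for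
  functions in the intersection of L1 and L2.  It is enough to have it there, because restrictions of L2 functions to balls and
  spectra with compact support belong to both spaces.
\<close>

section \<open>Change of variables and continuity of translation\<close>

abbreviation sqnorm :: "('a::euclidean_space \<Rightarrow> complex) \<Rightarrow> real" where
  "sqnorm f \<equiv> LBINT x. (cmod (f x))\<^sup>2"

abbreviation sq_integrable :: "('a::euclidean_space \<Rightarrow> complex) \<Rightarrow> bool" where
  "sq_integrable f \<equiv> integrable lborel (\<lambda>x. (cmod (f x))\<^sup>2)"

lemma lborel_integral_shift:
  fixes f :: "'a::euclidean_space \<Rightarrow> 'b::{banach, second_countable_topology}"
  assumes [measurable]: "f \<in> borel_measurable borel"
  shows "integral\<^sup>L lborel (\<lambda>x. f (x + v)) = integral\<^sup>L lborel f"
    and "integrable lborel (\<lambda>x. f (x + v)) \<longleftrightarrow> integrable lborel f"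
proof -
  have "integral\<^sup>L (distr lborel borel ((+) v)) f = integral\<^sup>L lborel (\<lambda>x. f (v + x))"
    by (rule integral_distr) auto
  then show "integral\<^sup>L lborel (\<lambda>x. f (x + v)) = integral\<^sup>L lborel f"
    by (simp add: lborel_distr_plus add.commute)
  have "integrable (distr lborel borel ((+) v)) f \<longleftrightarrow> integrable lborel (\<lambda>x. f (v + x))"
    by (rule integrable_distr_eq) auto
  then show "integrable lborel (\<lambda>x. f (x + v)) \<longleftrightarrow> integrable lborel f"
    by (simp add: lborel_distr_plus add.commute)
qed

lemma lborel_nn_integral_shift:
  fixes f :: "'a::euclidean_space \<Rightarrow> ennreal"
  assumes [measurable]: "f \<in> borel_measurable borel"
  shows "(\<integral>\<^sup>+x. f (x + v) \<partial>lborel) = integral\<^sup>N lborel f"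
proof -
  have "integral\<^sup>N (distr lborel borel ((+) v)) f = (\<integral>\<^sup>+x. f (v + x) \<partial>lborel)"
    by (rule nn_integral_distr) auto
  then show ?thesis by (simp add: lborel_distr_plus add.commute)
qed

lemma lborel_integral_scale:
  fixes f :: "'a::euclidean_space \<Rightarrow> 'b::{banach, second_countable_topology}"
  assumes [measurable]: "f \<in> borel_measurable borel" and c: "c \<noteq> 0"
  shows "integral\<^sup>L lborel f = \<bar>c\<bar> ^ DIM('a) *\<^sub>R integral\<^sup>L lborel (\<lambda>x. f (c *\<^sub>R x))"
    and "integrable lborel f \<longleftrightarrow> integrable lborel (\<lambda>x. f (c *\<^sub>R x))"
proof -
  have L: "(lborel :: 'a measure) = density (distr lborel borel (\<lambda>x. c *\<^sub>R x)) (\<lambda>_. \<bar>c\<bar>^DIM('a))"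
    using lborel_affine[OF c, of 0] by (simp add: ennreal_power)
  have "integral\<^sup>L lborel f = integral\<^sup>L (distr lborel borel (\<lambda>x. c *\<^sub>R x)) (\<lambda>x. \<bar>c\<bar>^DIM('a) *\<^sub>R f x)"
    by (subst L) (rule integral_density; simp)
  also have "\<dots> = \<bar>c\<bar> ^ DIM('a) *\<^sub>R integral\<^sup>L lborel (\<lambda>x. f (c *\<^sub>R x))"
    by (subst integral_distr) auto
  finally show "integral\<^sup>L lborel f = \<bar>c\<bar> ^ DIM('a) *\<^sub>R integral\<^sup>L lborel (\<lambda>x. f (c *\<^sub>R x))" .
  have "integrable lborel f \<longleftrightarrow> integrable (distr lborel borel (\<lambda>x. c *\<^sub>R x)) (\<lambda>x. \<bar>c\<bar>^DIM('a) *\<^sub>R f x)"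
    by (subst L) (rule integrable_density; simp)
  also have "\<dots> \<longleftrightarrow> integrable lborel (\<lambda>x. \<bar>c\<bar>^DIM('a) *\<^sub>R f (c *\<^sub>R x))"
    by (subst integrable_distr_eq) auto
  also have "\<dots> \<longleftrightarrow> integrable lborel (\<lambda>x. f (c *\<^sub>R x))"
    using c integrable_scaleR_right[of "inverse (\<bar>c\<bar>^DIM('a))" lborel "\<lambda>x. \<bar>c\<bar>^DIM('a) *\<^sub>R f (c *\<^sub>R x)"]
    by (intro iffI integrable_scaleR_right) auto
  finally show "integrable lborel f \<longleftrightarrow> integrable lborel (\<lambda>x. f (c *\<^sub>R x))" .
qed

lemma integrable_mult_square:
  fixes f g :: "'a \<Rightarrow> complex"
  assumes [measurable]: "f \<in> borel_measurable M" "g \<in> borel_measurable M"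
    and f: "integrable M (\<lambda>x. (cmod (f x))\<^sup>2)" and g: "integrable M (\<lambda>x. (cmod (g x))\<^sup>2)"
  shows "integrable M (\<lambda>x. f x * g x)"
proof (rule Bochner_Integration.integrable_bound)
  show "integrable M (\<lambda>x. (cmod (f x))\<^sup>2 + (cmod (g x))\<^sup>2)" using f g by simp
  have "cmod (f x * g x) \<le> (cmod (f x))\<^sup>2 + (cmod (g x))\<^sup>2" for x
  proof -
    have "0 \<le> (cmod (f x) - cmod (g x))\<^sup>2" by simp
    then have "2 * (cmod (f x) * cmod (g x)) \<le> (cmod (f x))\<^sup>2 + (cmod (g x))\<^sup>2"
      by (simp add: power2_diff algebra_simps)
    moreover have "0 \<le> cmod (f x) * cmod (g x)" by simp
    ultimately show ?thesis unfolding norm_mult by linarith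
  qed
  then show "AE x in M. cmod (f x * g x) \<le> norm ((cmod (f x))\<^sup>2 + (cmod (g x))\<^sup>2)"
    by simp
qed simp

lemma Cauchy_Schwarz_integral:
  fixes f g :: "'a \<Rightarrow> complex"
  assumes [measurable]: "f \<in> borel_measurable M" "g \<in> borel_measurable M"
    and f: "integrable M (\<lambda>x. (cmod (f x))\<^sup>2)" and g: "integrable M (\<lambda>x. (cmod (g x))\<^sup>2)"
  shows "(integral\<^sup>L M (\<lambda>x. cmod (f x) * cmod (g x)))\<^sup>2
           \<le> integral\<^sup>L M (\<lambda>x. (cmod (f x))\<^sup>2) * integral\<^sup>L M (\<lambda>x. (cmod (g x))\<^sup>2)"
proof -
  have i: "integrable M (\<lambda>x. cmod (f x) * cmod (g x))"
    using integrable_norm[OF integrable_mult_square[OF assms]] by (simp add: norm_mult)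
  have "ennreal ((integral\<^sup>L M (\<lambda>x. cmod (f x) * cmod (g x)))\<^sup>2)
     = (\<integral>\<^sup>+x. ennreal (cmod (f x)) * ennreal (cmod (g x)) \<partial>M)\<^sup>2"
    by (simp add: ennreal_power nn_integral_eq_integral[OF i] flip: ennreal_mult)
  also have "\<dots> \<le> (\<integral>\<^sup>+x. (ennreal (cmod (f x)))\<^sup>2 \<partial>M) * (\<integral>\<^sup>+x. (ennreal (cmod (g x)))\<^sup>2 \<partial>M)"
    by (rule Cauchy_Schwarz_nn_integral) auto
  also have "\<dots> = ennreal (integral\<^sup>L M (\<lambda>x. (cmod (f x))\<^sup>2) * integral\<^sup>L M (\<lambda>x. (cmod (g x))\<^sup>2))"
    by (simp add: ennreal_power nn_integral_eq_integral[OF f] nn_integral_eq_integral[OF g] ennreal_mult)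
  finally show ?thesis
    by (subst (asm) ennreal_le_iff) (auto intro!: mult_nonneg_nonneg)
qed

text \<open>The map sending \<open>p\<close> to \<open>norm p *\<^sub>R p\<close> identifies square-integrable with integrable functions,
and its inverse is Hoelder continuous of exponent one half.  This turns the continuity of
translations on L1 into their continuity on L2.\<close>

lemma norm_diff_square_le:
  fixes p q :: "'a::real_inner"
  shows "(norm (p - q))\<^sup>2 \<le> 2 * norm (norm p *\<^sub>R p - norm q *\<^sub>R q)"
proof (cases "p = q")
  case False
  define E where "E = norm p *\<^sub>R p - norm q *\<^sub>R q"
  have D: "(norm (p - q))\<^sup>2 = (norm p)\<^sup>2 + (norm q)\<^sup>2 - 2 * inner p q"
    by (simp add: power2_norm_eq_inner inner_diff_left inner_diff_right inner_commute)
  have "inner E (p - q) = norm p * (norm p)\<^sup>2 + norm q * (norm q)\<^sup>2 - (norm p + norm q) * inner p q"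
    by (simp add: E_def power2_norm_eq_inner inner_diff_left inner_diff_right inner_commute algebra_simps)
  also have "\<dots> = (norm p + norm q) * ((norm (p - q))\<^sup>2 / 2) + (norm p + norm q) * ((norm p - norm q)\<^sup>2 / 2)"
    unfolding D by (simp add: power2_eq_square field_simps)
  finally have "(norm p + norm q) * ((norm (p - q))\<^sup>2 / 2) \<le> inner E (p - q)"
    by simp
  also have "\<dots> \<le> norm E * norm (p - q)" by (rule norm_cauchy_schwarz)
  finally have 1: "(norm p + norm q) * ((norm (p - q))\<^sup>2 / 2) \<le> norm E * norm (p - q)" .
  have "norm (p - q) * ((norm (p - q))\<^sup>2 / 2) \<le> (norm p + norm q) * ((norm (p - q))\<^sup>2 / 2)"
    by (intro mult_right_mono norm_triangle_ineq4) auto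
  with 1 have "norm (p - q) * ((norm (p - q))\<^sup>2 / 2) \<le> norm (p - q) * norm E" by (simp add: mult.commute)
  then show ?thesis using False by (simp add: E_def)
qed simp

text \<open>A translation moves two functions by the same amount up to twice their L1 distance, so continuity
of translations passes to L1 limits.\<close>

lemma L1_translation_approx:
  fixes f :: "'a::euclidean_space \<Rightarrow> 'b::{banach, second_countable_topology}"
  assumes f: "integrable lborel f"
    and approx: "\<And>e. 0 < e \<Longrightarrow> \<exists>g. integrable lborel g \<and> (LBINT y. norm (g y - f y)) < e \<and>
      (\<lambda>n. LBINT y. norm (g (y + v n) - g y)) \<longlonglongrightarrow> 0"
  shows "(\<lambda>n. LBINT y. norm (f (y + v n) - f y)) \<longlonglongrightarrow> 0"
proof (rule LIMSEQ_I)
  fix e :: real assume e: "0 < e"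
  obtain g where g: "integrable lborel g" "(LBINT y. norm (g y - f y)) < e/4"
    and lim: "(\<lambda>n. LBINT y. norm (g (y + v n) - g y)) \<longlonglongrightarrow> 0"
    using approx[of "e/4"] e by auto
  note [measurable] = borel_measurable_integrable[OF f] borel_measurable_integrable[OF g(1)]
  define w where "w = (\<lambda>y. norm (g y - f y))"
  have [measurable]: "w \<in> borel_measurable borel" by (simp add: w_def)
  have iw: "integrable lborel w" using f g(1) by (simp add: w_def)
  then have iwv: "integrable lborel (\<lambda>y. w (y + v n))" for n by (simp add: lborel_integral_shift(2))
  have ig: "integrable lborel (\<lambda>y. norm (g (y + v n) - g y))" for n
    using g(1) by (intro integrable_norm Bochner_Integration.integrable_diff) (auto simp: lborel_integral_shift(2))
  obtain n0 where n0: "\<And>n. n \<ge> n0 \<Longrightarrow> (LBINT y. norm (g (y + v n) - g y)) < e/2"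
    using LIMSEQ_D[OF lim, of "e/2"] e by (auto simp: integral_nonneg_AE)
  show "\<exists>no. \<forall>n\<ge>no. norm ((LBINT y. norm (f (y + v n) - f y)) - 0) < e"
  proof (intro exI allI impI)
    fix n assume n: "n \<ge> n0"
    have "(LBINT y. norm (f (y + v n) - f y)) \<le> (LBINT y. norm (g (y + v n) - g y) + (w (y + v n) + w y))"
    proof (rule integral_mono')
      fix y
      have "f (y + v n) - f y = (g (y + v n) - g y) - (g (y + v n) - f (y + v n)) + (g y - f y)" by simp
      then show "norm (f (y + v n) - f y) \<le> norm (g (y + v n) - g y) + (w (y + v n) + w y)"
        unfolding w_def by (smt (verit) norm_triangle_ineq norm_triangle_ineq4)
    qed (use ig iw iwv in \<open>auto simp: w_def\<close>)
    also have "\<dots> = (LBINT y. norm (g (y + v n) - g y)) + 2 * (LBINT y. w y)"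
      using ig iw iwv lborel_integral_shift(1)[of w "v n"] by simp
    also have "\<dots> < e/2 + 2 * (e/4)" using n0[OF n] g(2) by (simp add: w_def)
    finally show "norm ((LBINT y. norm (f (y + v n) - f y)) - 0) < e"
      by (simp add: integral_nonneg_AE)
  qed
qed

text \<open>For an open set the indicator of the translate converges pointwise at every point of the set.  The
measure of the symmetric difference is expressed by that of the intersection, so this one-sided
information suffices.\<close>

lemma L1_translation_indicator_open:
  fixes U :: "'a::euclidean_space set"
  assumes U: "open U" "emeasure lborel U < \<infinity>" and v: "v \<longlonglongrightarrow> 0"
  shows "(\<lambda>n. LBINT y. \<bar>indicator U (y + v n) - indicator U y\<bar>) \<longlonglongrightarrow> (0::real)"
proof -
  let ?u = "indicator U :: 'a \<Rightarrow> real"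
  have [measurable]: "U \<in> sets borel" using U by simp
  have iU: "integrable lborel ?u" using U by simp
  then have iUv: "integrable lborel (\<lambda>y. ?u (y + v n))" for n by (subst lborel_integral_shift) auto
  have iUU: "integrable lborel (\<lambda>y. ?u (y + v n) * ?u y)" for n
    by (rule Bochner_Integration.integrable_bound[OF iU]) (auto simp: indicator_def)
  have "(\<lambda>n. LBINT y. ?u (y + v n) * ?u y) \<longlonglongrightarrow> (LBINT y. ?u y)"
  proof (rule integral_dominated_convergence[OF _ _ iU])
    show "AE y in lborel. (\<lambda>n. ?u (y + v n) * ?u y) \<longlonglongrightarrow> ?u y"
    proof (rule AE_I2)
      fix y
      show "(\<lambda>n. ?u (y + v n) * ?u y) \<longlonglongrightarrow> ?u y"
      proof (cases "y \<in> U")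
        case True
        have "(\<lambda>n. y + v n) \<longlonglongrightarrow> y" using tendsto_add[OF tendsto_const v, of y] by simp
        then have "\<forall>\<^sub>F n in sequentially. y + v n \<in> U"
          using U(1) True by (simp add: tendsto_def)
        then have "\<forall>\<^sub>F n in sequentially. ?u (y + v n) * ?u y = ?u y"
          by eventually_elim (use True in simp)
        then show ?thesis by (rule tendsto_eventually)
      qed simp
    qed
  qed (auto simp: indicator_def)
  then have "(\<lambda>n. 2 * (LBINT y. ?u y) - 2 * (LBINT y. ?u (y + v n) * ?u y)) \<longlonglongrightarrow> 2 * (LBINT y. ?u y) - 2 * (LBINT y. ?u y)"
    by (intro tendsto_intros)
  moreover have "(LBINT y. \<bar>?u (y + v n) - ?u y\<bar>) = 2 * (LBINT y. ?u y) - 2 * (LBINT y. ?u (y + v n) * ?u y)" for n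
  proof -
    have "(LBINT y. \<bar>?u (y + v n) - ?u y\<bar>) = (LBINT y. ?u (y + v n) + ?u y - 2 * (?u (y + v n) * ?u y))"
      by (intro Bochner_Integration.integral_cong) (auto simp: indicator_def)
    also have "\<dots> = (LBINT y. ?u (y + v n)) + (LBINT y. ?u y) - 2 * (LBINT y. ?u (y + v n) * ?u y)"
      using iU iUv iUU by simp
    also have "(LBINT y. ?u (y + v n)) = (LBINT y. ?u y)" by (rule lborel_integral_shift) simp
    finally show ?thesis by simp
  qed
  ultimately show ?thesis by simp
qed

lemma L1_translation_continuous:
  fixes f :: "'a::euclidean_space \<Rightarrow> 'b::{banach, second_countable_topology}"
  assumes "integrable lborel f" and v: "v \<longlonglongrightarrow> 0"
  shows "(\<lambda>n. LBINT y. norm (f (y + v n) - f y)) \<longlonglongrightarrow> 0"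
  using assms(1)
proof (induct rule: integrable_induct)
  case (base A c)
  have [measurable]: "A \<in> sets borel" using base by simp
  have "(\<lambda>n. LBINT y. norm (indicator A (y + v n) - indicator A y :: real)) \<longlonglongrightarrow> 0"
  proof (rule L1_translation_approx)
    show "integrable lborel (indicator A :: 'a \<Rightarrow> real)" using base by simp
    fix e :: real assume e: "0 < e"
    \<comment> \<open>Outer regularity replaces the measurable set by an open one.\<close>
    obtain U where U: "open U" "A \<subseteq> U" "emeasure lborel (U - A) < ennreal e"
      using outer_regular_lborel[of A e] e by auto
    have [measurable]: "U \<in> sets borel" using U by simp
    have "emeasure lborel U = emeasure lborel A + emeasure lborel (U - A)"
      using U by (subst plus_emeasure) (auto intro!: arg_cong[where f="emeasure lborel"])
    also have "\<dots> < \<infinity>" using base U(3) by (auto simp: ennreal_add_eq_top less_top[symmetric])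
    finally have Uf: "emeasure lborel U < \<infinity>" .
    have "(LBINT y. norm (indicator U y - indicator A y :: real)) = (LBINT y. indicator (U - A) y)"
      using U(2) by (intro Bochner_Integration.integral_cong) (auto simp: indicator_def)
    also have "\<dots> < e"
      using U(3) e by (simp add: measure_def) (metis enn2real_less_iff ennreal_less_top order.strict_trans top.extremum_strict e less_imp_le enn2real_ennreal)
    finally show "\<exists>g. integrable lborel g \<and> (LBINT y. norm (g y - indicator A y)) < e \<and>
      (\<lambda>n. LBINT y. norm (g (y + v n) - g y :: real)) \<longlonglongrightarrow> 0"
      using Uf L1_translation_indicator_open[OF U(1) Uf v] by (intro exI[of _ "indicator U"]) simp
  qed
  moreover have "norm (indicator A (y + v n) *\<^sub>R c - indicator A y *\<^sub>R c) = norm (indicator A (y + v n) - indicator A y :: real) * norm c" for y n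
    by (simp flip: scaleR_diff_left)
  ultimately show ?case using tendsto_mult_right[of _ 0 sequentially "norm c"] by simp
next
  case (add f g)
  note [measurable] = borel_measurable_integrable[OF add(1)] borel_measurable_integrable[OF add(3)]
  have i: "integrable lborel (\<lambda>y. norm (f (y + v n) - f y))" "integrable lborel (\<lambda>y. norm (g (y + v n) - g y))" for n
    using add(1,3) by (auto intro!: integrable_norm Bochner_Integration.integrable_diff simp: lborel_integral_shift(2))
  show ?case
  proof (rule tendsto_sandwich[OF always_eventually always_eventually tendsto_const])
    show "\<forall>n. 0 \<le> (LBINT y. norm (f (y + v n) + g (y + v n) - (f y + g y)))"
      by (simp add: integral_nonneg_AE)
    show "\<forall>n. (LBINT y. norm (f (y + v n) + g (y + v n) - (f y + g y)))
       \<le> (LBINT y. norm (f (y + v n) - f y)) + (LBINT y. norm (g (y + v n) - g y))"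
    proof
      fix n
      have "(LBINT y. norm (f (y + v n) + g (y + v n) - (f y + g y)))
        \<le> (LBINT y. norm (f (y + v n) - f y) + norm (g (y + v n) - g y))"
        by (rule integral_mono') (use i in \<open>auto simp: norm_diff_triangle_ineq\<close>)
      then show "(LBINT y. norm (f (y + v n) + g (y + v n) - (f y + g y)))
       \<le> (LBINT y. norm (f (y + v n) - f y)) + (LBINT y. norm (g (y + v n) - g y))"
        using i by simp
    qed
    show "(\<lambda>n. (LBINT y. norm (f (y + v n) - f y)) + (LBINT y. norm (g (y + v n) - g y))) \<longlonglongrightarrow> 0"
      using tendsto_add[OF add(2,4)] by simp
  qed
next
  case (lim f s)
  note [measurable] = borel_measurable_integrable[OF lim(5)] borel_measurable_integrable[OF lim(1)]
  have conv: "(\<lambda>i. LBINT y. norm (s i y - f y)) \<longlonglongrightarrow> (LBINT (y::'a). 0 :: real)"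
  proof (rule integral_dominated_convergence[where w="\<lambda>y. 3 * norm (f y)"])
    show "AE y in lborel. (\<lambda>i. norm (s i y - f y)) \<longlonglongrightarrow> 0"
      using lim(3) by (auto intro!: AE_I2 tendsto_norm_zero LIM_zero)
    show "AE y in lborel. norm (norm (s i y - f y)) \<le> 3 * norm (f y)" for i
    proof (rule AE_I2)
      fix y show "norm (norm (s i y - f y)) \<le> 3 * norm (f y)"
        using lim(4)[of y i] norm_triangle_ineq4[of "s i y" "f y"] by simp
    qed
  qed (use lim(5) in auto)
  show ?case
  proof (rule L1_translation_approx[OF lim(5)])
    fix e :: real assume "0 < e"
    then obtain i where "(LBINT y. norm (s i y - f y)) < e"
      using LIMSEQ_D[OF conv, of e] by (auto simp: integral_nonneg_AE)
    then show "\<exists>g. integrable lborel g \<and> (LBINT y. norm (g y - f y)) < e \<and>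
      (\<lambda>n. LBINT y. norm (g (y + v n) - g y)) \<longlonglongrightarrow> 0"
      using lim(1,2)[of i] by blast
  qed
qed

lemma L2_translation_continuous:
  fixes f :: "'a::euclidean_space \<Rightarrow> complex"
  assumes [measurable]: "f \<in> borel_measurable borel"
    and f: "sq_integrable f" and v: "v \<longlonglongrightarrow> 0"
  shows "(\<lambda>n. \<integral>y. (cmod (f (y + v n) - f y))\<^sup>2 \<partial>lborel) \<longlonglongrightarrow> 0"
    and "integrable lborel (\<lambda>y. (cmod (f (y + v n) - f y))\<^sup>2)"
proof -
  define h where "h x = cmod (f x) *\<^sub>R f x" for x
  have [measurable]: "h \<in> borel_measurable borel" by (simp add: h_def[abs_def])
  have h: "integrable lborel h"
    using f by (rule Bochner_Integration.integrable_bound) (auto simp: h_def power2_eq_square norm_mult)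
  have ih: "integrable lborel (\<lambda>y. norm (h (y + v n) - h y))" for n
    using h by (intro integrable_norm Bochner_Integration.integrable_diff) (auto simp: lborel_integral_shift(2))
  have le: "(cmod (f (y + v n) - f y))\<^sup>2 \<le> 2 * norm (h (y + v n) - h y)" for y n
    unfolding h_def by (rule norm_diff_square_le)
  show "integrable lborel (\<lambda>y. (cmod (f (y + v n) - f y))\<^sup>2)" for n
    by (rule Bochner_Integration.integrable_bound[where f="\<lambda>y. 2 * norm (h (y + v n) - h y)"]) (use ih le in auto)
  show "(\<lambda>n. \<integral>y. (cmod (f (y + v n) - f y))\<^sup>2 \<partial>lborel) \<longlonglongrightarrow> 0"
  proof (rule tendsto_sandwich[OF _ _ tendsto_const])
    show "\<forall>\<^sub>F n in sequentially. 0 \<le> (LBINT y. (cmod (f (y + v n) - f y))\<^sup>2)"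
      by (simp add: integral_nonneg_AE)
    have "(LBINT y. (cmod (f (y + v n) - f y))\<^sup>2) \<le> (LBINT y. 2 * norm (h (y + v n) - h y))" for n
      by (rule integral_mono') (use ih le in auto)
    then show "\<forall>\<^sub>F n in sequentially. (LBINT y. (cmod (f (y + v n) - f y))\<^sup>2) \<le> 2 * (LBINT y. norm (h (y + v n) - h y))"
      by simp
    show "(\<lambda>n. 2 * (LBINT y. norm (h (y + v n) - h y))) \<longlonglongrightarrow> 0"
      using tendsto_mult_left[OF L1_translation_continuous[OF h v], of 2] by simp
  qed
qed

section \<open>The Plancherel theorem\<close>

lemma lborel_integral_prod_Basis:
  fixes \<phi> :: "'a::euclidean_space \<Rightarrow> real \<Rightarrow> complex"
  assumes i: "\<And>b. b \<in> Basis \<Longrightarrow> integrable lborel (\<phi> b)"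
  shows "(LBINT x. (\<Prod>b\<in>Basis. \<phi> b (x \<bullet> b))) = (\<Prod>b\<in>Basis. integral\<^sup>L lborel (\<phi> b))" (is ?A)
    and "integrable lborel (\<lambda>x. \<Prod>b\<in>Basis. \<phi> b (x \<bullet> b))" (is ?B)
proof -
  interpret product_sigma_finite "\<lambda>_::'a. lborel :: real measure" by standard
  have [measurable]: "b \<in> Basis \<Longrightarrow> \<phi> b \<in> borel_measurable borel" for b
    using borel_measurable_integrable[OF i] by simp
  have e: "(\<Prod>b\<in>Basis. \<phi> b ((\<Sum>c\<in>Basis. y c *\<^sub>R c) \<bullet> b)) = (\<Prod>b\<in>Basis. \<phi> b (y b))" for y :: "'a \<Rightarrow> real"
    by (intro prod.cong refl) (simp add: inner_sum_left inner_Basis if_distrib cong: if_cong)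
  show ?A
    by (subst lborel_eq, subst integral_distr) (auto simp: e product_integral_prod i)
  show ?B
    by (subst lborel_eq, subst integrable_distr_eq) (auto simp: e intro!: product_integrable_prod i)
qed

definition gauss :: "'a::euclidean_space \<Rightarrow> real" where
  "gauss x = exp (- (norm x)\<^sup>2 / 2)"

lemma gauss_bounds: "0 < gauss x" "gauss x \<le> 1"
  by (simp_all add: gauss_def)

lemma gauss_measurable [measurable]: "gauss \<in> borel_measurable borel"
  unfolding gauss_def[abs_def] by measurable

lemma gauss_real_fourier:
  fixes t :: real
  shows "(LBINT x. complex_of_real (exp (- x\<^sup>2 / 2)) * exp (- (\<i> * of_real (x * t))))
           = of_real (sqrt (2 * pi) * exp (- t\<^sup>2 / 2))"
    and "integrable lborel (\<lambda>x. complex_of_real (exp (- x\<^sup>2 / 2)) * exp (- (\<i> * of_real (x * t))))"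
proof -
  have d: "std_normal_density x *\<^sub>R iexp ((- t) * x)
     = of_real (1 / sqrt (2 * pi)) * (complex_of_real (exp (- x\<^sup>2 / 2)) * exp (- (\<i> * of_real (x * t))))" for x
    by (simp add: std_normal_density_def scaleR_conv_of_real mult.commute)
  have "of_real (exp (- t\<^sup>2 / 2)) = char std_normal_distribution (- t)"
    by (simp add: char_std_normal_distribution)
  also have "\<dots> = (LBINT x. std_normal_density x *\<^sub>R iexp ((- t) * x))"
    unfolding char_def by (rule integral_density) auto
  also have "\<dots> = of_real (1 / sqrt (2 * pi)) * (LBINT x. complex_of_real (exp (- x\<^sup>2 / 2)) * exp (- (\<i> * of_real (x * t))))"
    unfolding d by simp
  finally show "(LBINT x. complex_of_real (exp (- x\<^sup>2 / 2)) * exp (- (\<i> * of_real (x * t))))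
           = of_real (sqrt (2 * pi) * exp (- t\<^sup>2 / 2))"
    by (simp add: field_simps)
  have n: "integrable lborel (\<lambda>x. sqrt (2 * pi) * std_normal_density x)" by simp
  show "integrable lborel (\<lambda>x. complex_of_real (exp (- x\<^sup>2 / 2)) * exp (- (\<i> * of_real (x * t))))"
    by (rule Bochner_Integration.integrable_bound[OF n])
      (auto simp: norm_mult std_normal_density_def)
qed

lemma gauss_eq_prod: "gauss x = (\<Prod>b\<in>Basis. exp (- (x \<bullet> b)\<^sup>2 / 2))"
proof -
  have "(norm x)\<^sup>2 = (\<Sum>b\<in>Basis. (x \<bullet> b)\<^sup>2)"
    unfolding power2_norm_eq_inner by (subst euclidean_inner) (simp add: power2_eq_square)
  then show ?thesis
    by (simp add: gauss_def exp_sum[symmetric] sum_divide_distrib sum_negf)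
qed

text \<open>The Gaussian factorises over the coordinates, which reduces its Fourier transform to the
characteristic function of the normal distribution.\<close>

lemma gauss_fourier:
  fixes v :: "'a::euclidean_space"
  shows "(LBINT x. of_real (gauss x) * exp (- (\<i> * of_real (x \<bullet> v))))
           = complex_of_real (sqrt (2 * pi) ^ DIM('a) * gauss v)"
    and "integrable lborel (gauss :: 'a \<Rightarrow> real)"
    and "integral\<^sup>L lborel (gauss :: 'a \<Rightarrow> real) = sqrt (2 * pi) ^ DIM('a)"
proof -
  have *: "of_real (gauss x) * exp (- (\<i> * of_real (x \<bullet> v)))
    = (\<Prod>b\<in>Basis. complex_of_real (exp (- (x \<bullet> b)\<^sup>2 / 2)) * exp (- (\<i> * of_real ((x \<bullet> b) * (v \<bullet> b)))))" for x v :: 'a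
  proof -
    have "exp (- (\<i> * of_real (x \<bullet> v))) = (\<Prod>b\<in>Basis. exp (- (\<i> * of_real ((x \<bullet> b) * (v \<bullet> b)))))"
      by (subst exp_sum[symmetric]) (simp_all add: euclidean_inner[of x v] sum_distrib_left sum_negf)
    then show ?thesis by (simp only: gauss_eq_prod of_real_prod prod.distrib)
  qed
  have 1: "(LBINT x. of_real (gauss x) * exp (- (\<i> * of_real (x \<bullet> v))))
           = complex_of_real (sqrt (2 * pi) ^ DIM('a) * gauss v)" for v :: 'a
    unfolding *
    by (subst lborel_integral_prod_Basis, rule gauss_real_fourier(2), simp only: gauss_real_fourier(1))
      (simp add: gauss_eq_prod[of v] prod.distrib)
  have 2: "integrable lborel (\<lambda>x. of_real (gauss x) * exp (- (\<i> * of_real (x \<bullet> v))))" for v :: 'a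
    unfolding * by (rule lborel_integral_prod_Basis) (rule gauss_real_fourier)
  show "(LBINT x. of_real (gauss x) * exp (- (\<i> * of_real (x \<bullet> v))))
           = complex_of_real (sqrt (2 * pi) ^ DIM('a) * gauss v)" by (rule 1)
  show i: "integrable lborel (gauss :: 'a \<Rightarrow> real)"
    using integrable_norm[OF 2[of "0::'a"]] by (simp add: norm_mult less_imp_le[OF gauss_bounds(1)])
  show "integral\<^sup>L lborel (gauss :: 'a \<Rightarrow> real) = sqrt (2 * pi) ^ DIM('a)"
  proof -
    have "complex_of_real (integral\<^sup>L lborel (gauss :: 'a \<Rightarrow> real)) = of_real (sqrt (2 * pi) ^ DIM('a))"
      using 1[of "0::'a"] by (simp add: gauss_def[of "0::'a"])
    then show ?thesis by (simp only: of_real_eq_iff)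
  qed
qed

lemma borel_measurable_cnj [measurable (raw)]:
  "f \<in> borel_measurable M \<Longrightarrow> (\<lambda>x. cnj (f x)) \<in> borel_measurable M"
  by (rule measurable_compose[of f M borel cnj borel])
    (auto intro!: borel_measurable_continuous_onI continuous_intros)

lemma fourier_measurable [measurable]:
  fixes f :: "real^'n::finite \<Rightarrow> complex"
  assumes [measurable]: "f \<in> borel_measurable borel"
  shows "fourier f \<in> borel_measurable borel"
  unfolding fourier_def[abs_def] by measurable

lemma integrable_mult_cis:
  fixes f :: "real^'n::finite \<Rightarrow> complex"
  assumes f: "integrable lborel f" and [measurable]: "g \<in> borel_measurable borel"
  shows "integrable lborel (\<lambda>x. f x * exp (- \<i> * of_real (g x)))"
    and "integrable lborel (\<lambda>x. f x * iexp (g x))"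
  by (rule Bochner_Integration.integrable_bound[OF f]; use borel_measurable_integrable[OF f] in \<open>auto simp: norm_mult\<close>)+

lemma fourier_bounded:
  fixes f :: "real^'n::finite \<Rightarrow> complex"
  assumes f: "integrable lborel f"
  shows "cmod (fourier f \<omega>) \<le> (LBINT x. cmod (f x))"
proof -
  have "cmod (fourier f \<omega>) \<le> (LBINT x. cmod (f x * exp (- \<i> * of_real (\<omega> \<bullet> x))))"
    unfolding fourier_def by (rule integral_norm_bound)
  then show ?thesis by (simp add: norm_mult)
qed

lemma integrable_pair_mult_bound:
  fixes f g :: "real^'n::finite \<Rightarrow> complex" and h :: "(real^'n) \<times> (real^'n) \<Rightarrow> complex"
  assumes f: "integrable lborel f" and g: "integrable lborel g"
    and [measurable]: "h \<in> borel_measurable (lborel \<Otimes>\<^sub>M lborel)"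
    and h: "\<And>x y. cmod (h (x, y)) \<le> cmod (f x) * cmod (g y)"
  shows "integrable (lborel \<Otimes>\<^sub>M lborel) h"
proof (rule lborel_pair.Fubini_integrable)
  note [measurable] = borel_measurable_integrable[OF f] borel_measurable_integrable[OF g]
  have i: "integrable lborel (\<lambda>y. h (x, y))" for x
    by (rule Bochner_Integration.integrable_bound[where f="\<lambda>y. cmod (f x) * cmod (g y)"])
      (use g h in auto)
  then show "AE x in lborel. integrable lborel (\<lambda>y. h (x, y))" by simp
  have "(LBINT y. cmod (h (x, y))) \<le> cmod (f x) * (LBINT y. cmod (g y))" for x
  proof -
    have "(LBINT y. cmod (h (x, y))) \<le> (LBINT y. cmod (f x) * cmod (g y))"
      by (rule integral_mono') (use g h in auto)
    then show ?thesis by simp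
  qed
  then have b: "norm (LBINT y. cmod (h (x, y))) \<le> norm (cmod (f x) * (LBINT y. cmod (g y)))" for x
    by (simp add: integral_nonneg_AE)
  show "integrable lborel (\<lambda>x. \<integral>y. norm (h (x, y)) \<partial>lborel)"
    by (rule Bochner_Integration.integrable_bound[where f="\<lambda>x. cmod (f x) * (LBINT y. cmod (g y))"])
      (use f b in \<open>auto intro!: lborel.borel_measurable_lebesgue_integral\<close>)
qed simp

text \<open>The multiplication formula is Fubini for \<open>f x * g \<omega> * exp (- \<i> \<omega> \<bullet> x)\<close>.  Used twice, it
turns a weighted integral of the squared modulus of the Fourier transform into one over \<open>f\<close> itself.\<close>

lemma fourier_swap:
  fixes f g :: "real^'n::finite \<Rightarrow> complex"
  assumes f: "integrable lborel f" and g: "integrable lborel g"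
  shows "(LBINT \<omega>. fourier f \<omega> * g \<omega>) = (LBINT x. f x * fourier g x)"
proof -
  note [measurable] = borel_measurable_integrable[OF f] borel_measurable_integrable[OF g]
  have "integrable (lborel \<Otimes>\<^sub>M lborel) (\<lambda>(x, \<omega>). f x * g \<omega> * exp (- \<i> * of_real (\<omega> \<bullet> x)))"
    by (rule integrable_pair_mult_bound[OF f g]) (auto simp: norm_mult)
  then have "(LBINT \<omega>. (LBINT x. f x * g \<omega> * exp (- \<i> * of_real (\<omega> \<bullet> x))))
     = (LBINT x. (LBINT \<omega>. f x * g \<omega> * exp (- \<i> * of_real (\<omega> \<bullet> x))))"
    by (rule lborel_pair.Fubini_integral)
  moreover have "(LBINT x. f x * g \<omega> * exp (- \<i> * of_real (\<omega> \<bullet> x))) = fourier f \<omega> * g \<omega>" for \<omega>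
    unfolding fourier_def by (simp add: mult.assoc mult.left_commute mult.commute flip: integral_mult_right_zero)
  moreover have "(LBINT \<omega>. f x * g \<omega> * exp (- \<i> * of_real (\<omega> \<bullet> x))) = f x * fourier g x" for x
    unfolding fourier_def by (simp add: mult.assoc inner_commute flip: integral_mult_right_zero)
  ultimately show ?thesis by simp
qed

lemma cnj_fourier:
  fixes f :: "real^'n::finite \<Rightarrow> complex"
  assumes [measurable]: "f \<in> borel_measurable borel"
  shows "cnj (fourier f \<omega>) = fourier (\<lambda>y. cnj (f (- y))) \<omega>"
proof -
  have "cnj (fourier f \<omega>) = (LBINT x. cnj (f x * exp (- \<i> * of_real (\<omega> \<bullet> x))))"
    unfolding fourier_def by (simp only: Bochner_Integration.integral_cnj)
  also have "\<dots> = (LBINT x. cnj (f (- x) * exp (- \<i> * of_real (\<omega> \<bullet> (- x)))))"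
    using lborel_integral_scale(1)[of "\<lambda>x. cnj (f x * exp (- \<i> * of_real (\<omega> \<bullet> x)))" "-1"] by simp
  also have "\<dots> = fourier (\<lambda>y. cnj (f (- y))) \<omega>"
    unfolding fourier_def by (simp add: exp_cnj)
  finally show ?thesis .
qed

lemma fourier_gauss_scaled:
  fixes v :: "real^'n::finite"
  assumes s: "s > 0"
  shows "fourier (\<lambda>\<omega>. of_real (gauss (s *\<^sub>R \<omega>))) v
           = of_real (sqrt (2 * pi) ^ CARD('n) / s ^ CARD('n) * gauss ((1/s) *\<^sub>R v))"
    and "integrable lborel (\<lambda>\<omega>::real^'n. gauss (s *\<^sub>R \<omega>))"
proof -
  let ?F = "fourier (\<lambda>\<omega>. of_real (gauss (s *\<^sub>R \<omega>))) v"
  have "complex_of_real (sqrt (2 * pi) ^ CARD('n) * gauss ((1/s) *\<^sub>R v))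
     = (LBINT x. of_real (gauss x) * exp (- (\<i> * of_real (x \<bullet> ((1/s) *\<^sub>R v)))))"
    using gauss_fourier(1)[of "(1/s) *\<^sub>R v"] by simp
  also have "\<dots> = s ^ CARD('n) *\<^sub>R (LBINT x. of_real (gauss (s *\<^sub>R x)) * exp (- (\<i> * of_real ((s *\<^sub>R x) \<bullet> ((1/s) *\<^sub>R v)))))"
    using s lborel_integral_scale(1)[of "\<lambda>x. complex_of_real (gauss x) * exp (- (\<i> * of_real (x \<bullet> ((1/s) *\<^sub>R v))))" s]
    by simp
  also have "(\<lambda>x::real^'n. (s *\<^sub>R x) \<bullet> ((1/s) *\<^sub>R v)) = (\<lambda>x. v \<bullet> x)"
    using s by (simp add: inner_commute fun_eq_iff)
  finally have "complex_of_real (sqrt (2 * pi) ^ CARD('n) * gauss ((1/s) *\<^sub>R v)) = of_real (s ^ CARD('n)) * ?F"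
    unfolding fourier_def scaleR_conv_of_real by (simp add: fun_eq_iff)
  then show "?F = of_real (sqrt (2 * pi) ^ CARD('n) / s ^ CARD('n) * gauss ((1/s) *\<^sub>R v))"
    using s by (simp add: field_simps)
  show "integrable lborel (\<lambda>\<omega>::real^'n. gauss (s *\<^sub>R \<omega>))"
    using s lborel_integral_scale(2)[of "gauss :: real^'n \<Rightarrow> real" s] gauss_fourier(2)[where 'a="real^'n"] by simp
qed

text \<open>The squared modulus of the Fourier transform of \<open>f\<close> is the Fourier transform of this function,
whose value at 0 is the squared norm of \<open>f\<close>.  Its continuity at 0 is what Plancherel needs.\<close>

definition autocorr :: "(real^'n::finite \<Rightarrow> complex) \<Rightarrow> real^'n \<Rightarrow> complex" where
  "autocorr f v = (LBINT x. f x * cnj (f (x - v)))"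

lemma autocorr_props:
  fixes f :: "real^'n::finite \<Rightarrow> complex"
  assumes [measurable]: "f \<in> borel_measurable borel" and f: "sq_integrable f"
  shows "autocorr f 0 = of_real (sqnorm f)"
    and "cmod (autocorr f v) \<le> (sqnorm f)"
    and "(LBINT x. cmod (f x) * cmod (f (x - v))) \<le> (sqnorm f)"
    and "integrable lborel (\<lambda>x. f x * cnj (f (x - v)))"
    and "autocorr f \<in> borel_measurable borel"
    and "w \<longlonglongrightarrow> 0 \<Longrightarrow> (\<lambda>n. autocorr f (w n)) \<longlonglongrightarrow> autocorr f 0"
proof -
  let ?A = "\<integral>x. (cmod (f x))\<^sup>2 \<partial>lborel"
  have A0: "0 \<le> ?A" by (simp add: integral_nonneg_AE)
  show "autocorr f 0 = of_real ?A"
    unfolding autocorr_def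
    by (simp only: diff_zero complex_norm_square[symmetric] of_real_power[symmetric] integral_complex_of_real)
  have fv: "integrable lborel (\<lambda>x. (cmod (f (x - v)))\<^sup>2)" "(LBINT x. (cmod (f (x - v)))\<^sup>2) = ?A" for v
    using f lborel_integral_shift[of "\<lambda>x. (cmod (f x))\<^sup>2" "- v"] by simp_all
  have "(LBINT x. cmod (f x) * cmod (f (x - v)))\<^sup>2 \<le> ?A * ?A" for v
    using Cauchy_Schwarz_integral[of f lborel "\<lambda>x. f (x - v)"] f fv by simp
  then have CS: "(LBINT x. cmod (f x) * cmod (f (x - v))) \<le> ?A" for v
    by (intro power2_le_imp_le[OF _ A0]) (simp only: power2_eq_square[of ?A])
  then show "(LBINT x. cmod (f x) * cmod (f (x - v))) \<le> ?A" .
  show i: "integrable lborel (\<lambda>x. f x * cnj (f (x - v)))" for v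
    by (rule integrable_mult_square) (use f fv in auto)
  have "cmod (autocorr f v) \<le> (LBINT x. cmod (f x * cnj (f (x - v))))"
    unfolding autocorr_def by (rule integral_norm_bound)
  then show "cmod (autocorr f v) \<le> ?A" using CS[of v] by (simp add: norm_mult)
  show "autocorr f \<in> borel_measurable borel"
    unfolding autocorr_def[abs_def] by measurable
  assume w: "w \<longlonglongrightarrow> 0"
  let ?D = "\<lambda>n. \<integral>y. (cmod (f (y + (- w n)) - f y))\<^sup>2 \<partial>lborel"
  have w': "(\<lambda>n. - w n) \<longlonglongrightarrow> 0" using tendsto_minus[OF w] by simp
  have D: "?D \<longlonglongrightarrow> 0" and iD: "integrable lborel (\<lambda>y. (cmod (f (y + (- w n)) - f y))\<^sup>2)" for n
    using L2_translation_continuous[OF _ f w'] by auto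
  have le: "\<forall>n. cmod (autocorr f (w n) - autocorr f 0) \<le> sqrt (?A * ?D n)"
  proof
    fix n
    have "autocorr f (w n) - autocorr f 0 = (LBINT x. f x * cnj (f (x - w n)) - f x * cnj (f (x - 0)))"
      unfolding autocorr_def by (rule Bochner_Integration.integral_diff[symmetric]; rule i)
    also have "cmod \<dots> \<le> (LBINT x. cmod (f x * cnj (f (x - w n)) - f x * cnj (f (x - 0))))"
      by (rule integral_norm_bound)
    also have "\<dots> = (LBINT x. cmod (f x) * cmod (f (x + (- w n)) - f x))"
    proof (intro Bochner_Integration.integral_cong refl)
      fix x
      have "f x * cnj (f (x - w n)) - f x * cnj (f (x - 0)) = f x * cnj (f (x + (- w n)) - f x)"
        by (simp add: right_diff_distrib)
      then show "cmod (f x * cnj (f (x - w n)) - f x * cnj (f (x - 0))) = cmod (f x) * cmod (f (x + (- w n)) - f x)"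
        by (simp only: norm_mult complex_mod_cnj)
    qed
    also have "\<dots> \<le> sqrt (?A * ?D n)"
      by (rule real_le_rsqrt, rule Cauchy_Schwarz_integral) (use f iD[of n] in auto)
    finally show "cmod (autocorr f (w n) - autocorr f 0) \<le> sqrt (?A * ?D n)" .
  qed
  have "(\<lambda>n. sqrt (?A * ?D n)) \<longlonglongrightarrow> 0"
    using tendsto_real_sqrt[OF tendsto_mult_left[OF D, of ?A]] by simp
  then have "(\<lambda>n. autocorr f (w n) - autocorr f 0) \<longlonglongrightarrow> 0"
    by (rule Lim_null_comparison[OF always_eventually[OF le]])
  then show "(\<lambda>n. autocorr f (w n)) \<longlonglongrightarrow> autocorr f 0" by (rule LIM_zero_cancel)
qed

text \<open>The Gaussian weight makes every integral absolutely convergent, so the multiplication formula can be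
applied twice, and a final use of Fubini collects the autocorrelation of \<open>f\<close> against a rescaled
Gaussian.\<close>

lemma gauss_weighted_fourier:
  fixes f :: "real^'n::finite \<Rightarrow> complex"
  assumes f1: "integrable lborel f" and f: "sq_integrable f" and s: "s > 0"
  shows "of_real (LBINT \<omega>. (cmod (fourier f \<omega>))\<^sup>2 * gauss (s *\<^sub>R \<omega>))
     = of_real (sqrt (2 * pi) ^ CARD('n)) * (LBINT u. of_real (gauss u) * autocorr f (s *\<^sub>R u))"
proof -
  note [measurable] = borel_measurable_integrable[OF f1, simplified]
  note a = autocorr_props[OF _ f, simplified]
  define K where "K v = sqrt (2 * pi) ^ CARD('n) / s ^ CARD('n) * gauss ((1/s) *\<^sub>R v)" for v :: "real^'n"
  have K: "fourier (\<lambda>\<omega>. of_real (gauss (s *\<^sub>R \<omega>))) v = of_real (K v)" for v :: "real^'n"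
    unfolding K_def by (rule fourier_gauss_scaled[OF s])
  have Kpos: "K v \<ge> 0" for v using s by (simp add: K_def less_imp_le[OF gauss_bounds(1)])
  have [measurable]: "K \<in> borel_measurable borel" unfolding K_def[abs_def] by measurable
  have iK: "integrable lborel K"
    using fourier_gauss_scaled(2)[of "1/s", where 'n='n] s by (simp add: K_def[abs_def])
  have ig: "integrable lborel (\<lambda>\<omega>::real^'n. complex_of_real (gauss (s *\<^sub>R \<omega>)))"
    using fourier_gauss_scaled(2)[OF s, where 'n='n] by (simp add: complex_of_real_integrable_eq)
  have ige: "integrable lborel (\<lambda>\<omega>::real^'n. complex_of_real (gauss (s *\<^sub>R \<omega>)) * exp (- \<i> * of_real (\<omega> \<bullet> x)))" for x
    by (rule integrable_mult_cis[OF ig]) simp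
  have igf: "integrable lborel (\<lambda>\<omega>. of_real (gauss (s *\<^sub>R \<omega>)) * cnj (fourier f \<omega>))"
  proof (rule Bochner_Integration.integrable_bound)
    show "integrable lborel (\<lambda>\<omega>::real^'n. gauss (s *\<^sub>R \<omega>) * (LBINT x. cmod (f x)))"
      using fourier_gauss_scaled(2)[OF s, where 'n='n] by simp
    show "AE \<omega> in lborel. cmod (of_real (gauss (s *\<^sub>R \<omega>)) * cnj (fourier f \<omega>)) \<le> norm (gauss (s *\<^sub>R \<omega>) * (LBINT x. cmod (f x)))"
      using order_trans[OF fourier_bounded[OF f1] abs_ge_self]
      by (auto simp: norm_mult abs_mult intro!: mult_left_mono AE_I2)
  qed simp
  have if': "integrable lborel (\<lambda>y. cnj (f (- y)))"
    using lborel_integral_scale(2)[of f "-1"] f1 by simp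
  \<comment> \<open>The second use of the multiplication formula, with the conjugate transform read as a transform.\<close>
  have inner: "fourier (\<lambda>\<omega>. of_real (gauss (s *\<^sub>R \<omega>)) * cnj (fourier f \<omega>)) x
     = (LBINT v. cnj (f (x - v)) * of_real (K v))" for x
  proof -
    have "fourier (\<lambda>\<omega>. of_real (gauss (s *\<^sub>R \<omega>)) * cnj (fourier f \<omega>)) x
      = (LBINT \<omega>. fourier (\<lambda>y. cnj (f (- y))) \<omega> * (of_real (gauss (s *\<^sub>R \<omega>)) * exp (- \<i> * of_real (\<omega> \<bullet> x))))"
      unfolding fourier_def[of "\<lambda>\<omega>. of_real (gauss (s *\<^sub>R \<omega>)) * cnj (fourier f \<omega>)"]
      by (intro Bochner_Integration.integral_cong refl) (simp add: cnj_fourier inner_commute mult_ac)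
    also have "\<dots> = (LBINT y. cnj (f (- y)) * fourier (\<lambda>\<omega>. of_real (gauss (s *\<^sub>R \<omega>)) * exp (- \<i> * of_real (\<omega> \<bullet> x))) y)"
      by (rule fourier_swap[OF if' ige])
    also have "\<dots> = (LBINT y. cnj (f (- y)) * of_real (K (x + y)))"
    proof (intro Bochner_Integration.integral_cong refl arg_cong2[where f="(*)"])
      fix y
      have "fourier (\<lambda>\<omega>. of_real (gauss (s *\<^sub>R \<omega>)) * exp (- \<i> * of_real (\<omega> \<bullet> x))) y
         = fourier (\<lambda>\<omega>. of_real (gauss (s *\<^sub>R \<omega>))) (x + y)"
        unfolding fourier_def
        by (intro Bochner_Integration.integral_cong refl)
          (simp add: inner_commute inner_add_left inner_add_right exp_add[symmetric] mult.assoc algebra_simps)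
      then show "fourier (\<lambda>\<omega>. of_real (gauss (s *\<^sub>R \<omega>)) * exp (- \<i> * of_real (\<omega> \<bullet> x))) y = of_real (K (x + y))"
        by (simp add: K)
    qed
    also have "\<dots> = (LBINT v. cnj (f (x - v)) * of_real (K v))"
      using lborel_integral_shift(1)[of "\<lambda>v. cnj (f (x - v)) * of_real (K v)" x] by (simp add: add.commute)
    finally show ?thesis .
  qed
  have pairint: "integrable (lborel \<Otimes>\<^sub>M lborel) (\<lambda>(v, x). f x * (cnj (f (x - v)) * of_real (K v)))"
  proof (rule lborel_pair.Fubini_integrable)
    have e: "f x * (cnj (f (x - v)) * of_real (K v)) = f x * cnj (f (x - v)) * of_real (K v)" for x v by simp
    show "AE v in lborel. integrable lborel (\<lambda>x. case (v, x) of (v, x) \<Rightarrow> f x * (cnj (f (x - v)) * of_real (K v)))"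
      using a(4) by (auto simp: e simp del: mult.assoc)
    show "integrable lborel (\<lambda>v. \<integral>x. norm (case (v, x) of (v, x) \<Rightarrow> f x * (cnj (f (x - v)) * of_real (K v))) \<partial>lborel)"
    proof (rule Bochner_Integration.integrable_bound)
      show "integrable lborel (\<lambda>v. K v * (sqnorm f))" using iK by simp
      have "cmod (f x * (cnj (f (x - v)) * of_real (K v))) = K v * (cmod (f x) * cmod (f (x - v)))" for v x
        using Kpos[of v] by (simp add: norm_mult)
      then have "(LBINT x. cmod (f x * (cnj (f (x - v)) * of_real (K v)))) = K v * (LBINT x. cmod (f x) * cmod (f (x - v)))" for v
        by (simp only: integral_mult_right_zero)
      also have "K v * (LBINT x. cmod (f x) * cmod (f (x - v))) \<le> K v * (sqnorm f)" for v
        using a(3) Kpos by (intro mult_left_mono)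
      finally show "AE v in lborel. norm (LBINT x. norm (case (v, x) of (v, x) \<Rightarrow> f x * (cnj (f (x - v)) * of_real (K v))))
          \<le> norm (K v * (sqnorm f))"
        using Kpos by (auto simp: integral_nonneg_AE)
    qed measurable
  qed measurable
  have "complex_of_real (LBINT \<omega>. (cmod (fourier f \<omega>))\<^sup>2 * gauss (s *\<^sub>R \<omega>))
     = (LBINT \<omega>. of_real ((cmod (fourier f \<omega>))\<^sup>2 * gauss (s *\<^sub>R \<omega>)))"
    by (rule integral_complex_of_real[symmetric])
  also have "\<dots> = (LBINT \<omega>. fourier f \<omega> * (of_real (gauss (s *\<^sub>R \<omega>)) * cnj (fourier f \<omega>)))"
    by (intro Bochner_Integration.integral_cong refl) (simp add: complex_norm_square mult_ac del: of_real_power)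
  also have "\<dots> = (LBINT x. f x * (LBINT v. cnj (f (x - v)) * of_real (K v)))"
    by (simp add: fourier_swap[OF f1 igf] inner)
  also have "\<dots> = (LBINT x. (LBINT v. f x * (cnj (f (x - v)) * of_real (K v))))"
    by simp
  also have "\<dots> = (LBINT v. (LBINT x. f x * (cnj (f (x - v)) * of_real (K v))))"
    by (rule lborel_pair.Fubini_integral[OF pairint])
  also have "\<dots> = (LBINT v. of_real (K v) * autocorr f v)"
    unfolding autocorr_def by (simp add: mult_ac flip: integral_mult_right_zero)
  also have "\<dots> = s ^ CARD('n) *\<^sub>R (LBINT u. of_real (K (s *\<^sub>R u)) * autocorr f (s *\<^sub>R u))"
    using lborel_integral_scale(1)[of "\<lambda>v. of_real (K v) * autocorr f v" s] s a(5) by simp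
  also have "\<dots> = of_real (sqrt (2 * pi) ^ CARD('n)) * (LBINT u. of_real (gauss u) * autocorr f (s *\<^sub>R u))"
    using s by (simp add: K_def scaleR_conv_of_real[where 'a=complex] mult.assoc)
  finally show ?thesis .
qed

text \<open>In the Gaussian-weighted identity the width of the weight tends to infinity: the left-hand side
converges monotonically, the right-hand side by continuity of the autocorrelation at 0.\<close>

theorem Plancherel_L1_L2:
  fixes f :: "real^'n::finite \<Rightarrow> complex"
  assumes f1: "integrable lborel f" and f: "sq_integrable f"
  shows "sq_integrable (fourier f)"
    and "(sqnorm (fourier f)) = (2 * pi) ^ CARD('n) * (sqnorm f)"
proof -
  note [measurable] = borel_measurable_integrable[OF f1, simplified]
  note a = autocorr_props[OF _ f, simplified]
  let ?A = "\<integral>x. (cmod (f x))\<^sup>2 \<partial>lborel"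
  define s where "s n = 1 / real (Suc n)" for n
  have s: "s n > 0" for n by (simp add: s_def)
  have s0: "s \<longlonglongrightarrow> 0" unfolding s_def[abs_def] using LIMSEQ_inverse_real_of_nat by (simp add: inverse_eq_divide)
  let ?J = "\<lambda>n. \<integral>\<omega>. (cmod (fourier f \<omega>))\<^sup>2 * gauss (s n *\<^sub>R \<omega>) \<partial>lborel"
  have ig: "integrable lborel (\<lambda>\<omega>. (cmod (fourier f \<omega>))\<^sup>2 * gauss (s n *\<^sub>R \<omega>))" for n
  proof (rule Bochner_Integration.integrable_bound)
    show "integrable lborel (\<lambda>\<omega>::real^'n. (LBINT x. cmod (f x))\<^sup>2 * gauss (s n *\<^sub>R \<omega>))"
      using fourier_gauss_scaled(2)[OF s, where 'n='n] by simp
    show "AE \<omega> in lborel. norm ((cmod (fourier f \<omega>))\<^sup>2 * gauss (s n *\<^sub>R \<omega>)) \<le> norm ((LBINT x. cmod (f x))\<^sup>2 * gauss (s n *\<^sub>R \<omega>))"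
    proof (rule AE_I2)
      fix \<omega> :: "real^'n"
      have "(cmod (fourier f \<omega>))\<^sup>2 * gauss (s n *\<^sub>R \<omega>) \<le> (LBINT x. cmod (f x))\<^sup>2 * gauss (s n *\<^sub>R \<omega>)"
        by (intro mult_right_mono power_mono fourier_bounded[OF f1]) (auto simp: less_imp_le[OF gauss_bounds(1)])
      then show "norm ((cmod (fourier f \<omega>))\<^sup>2 * gauss (s n *\<^sub>R \<omega>)) \<le> norm ((LBINT x. cmod (f x))\<^sup>2 * gauss (s n *\<^sub>R \<omega>))"
        by (simp add: less_imp_le[OF gauss_bounds(1)])
    qed
  qed simp
  have "(\<lambda>n. \<integral>u. of_real (gauss u) * autocorr f (s n *\<^sub>R u) \<partial>lborel) \<longlonglongrightarrow> (LBINT (u::real^'n). of_real (gauss u) * autocorr f 0)"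
  proof (rule integral_dominated_convergence[where w="\<lambda>u. gauss u * ?A"])
    show "AE u in lborel. (\<lambda>n. of_real (gauss u) * autocorr f (s n *\<^sub>R u)) \<longlonglongrightarrow> of_real (gauss u) * autocorr f 0"
    proof (rule AE_I2)
      fix u :: "real^'n"
      have "(\<lambda>n. s n *\<^sub>R u) \<longlonglongrightarrow> 0" using tendsto_scaleR[OF s0 tendsto_const] by simp
      then show "(\<lambda>n. of_real (gauss u) * autocorr f (s n *\<^sub>R u)) \<longlonglongrightarrow> of_real (gauss u) * autocorr f 0"
        by (intro tendsto_mult_left a(6))
    qed
    show "AE u in lborel. norm (of_real (gauss u) * autocorr f (s n *\<^sub>R u)) \<le> gauss u * ?A" for n
      using a(2) by (auto simp: norm_mult less_imp_le[OF gauss_bounds(1)] intro!: mult_left_mono AE_I2)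
  qed (use a(5) gauss_fourier(2)[where 'a="real^'n"] in auto)
  then have "(\<lambda>n. of_real (sqrt (2 * pi) ^ CARD('n)) * (LBINT u. of_real (gauss u) * autocorr f (s n *\<^sub>R u)))
      \<longlonglongrightarrow> of_real (sqrt (2 * pi) ^ CARD('n)) * (LBINT (u::real^'n). of_real (gauss u) * autocorr f 0)"
    by (rule tendsto_mult_left)
  also have "(\<lambda>n. of_real (sqrt (2 * pi) ^ CARD('n)) * (LBINT u. of_real (gauss u) * autocorr f (s n *\<^sub>R u)))
     = (\<lambda>n. of_real (?J n))"
    by (simp only: gauss_weighted_fourier[OF f1 f s])
  also have "of_real (sqrt (2 * pi) ^ CARD('n)) * (LBINT (u::real^'n). of_real (gauss u) * autocorr f 0)
     = complex_of_real ((2 * pi) ^ CARD('n) * ?A)"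
  proof -
    have "(LBINT (u::real^'n). of_real (gauss u) * autocorr f 0)
        = complex_of_real (integral\<^sup>L lborel (gauss :: real^'n \<Rightarrow> real)) * autocorr f 0"
      by (simp only: integral_mult_left_zero integral_complex_of_real)
    also have "\<dots> = of_real (sqrt (2 * pi) ^ CARD('n) * ?A)"
      by (simp only: gauss_fourier(3) a(1) of_real_mult DIM_cart DIM_real mult_1_right)
    moreover have "sqrt (2 * pi) ^ CARD('n) * (sqrt (2 * pi) ^ CARD('n) * ?A) = (2 * pi) ^ CARD('n) * ?A"
      by (simp only: mult.assoc[symmetric] power_mult_distrib[symmetric] real_sqrt_mult_self) simp
    ultimately show ?thesis by (simp only: of_real_mult[symmetric])
  qed
  finally have J: "?J \<longlonglongrightarrow> (2 * pi) ^ CARD('n) * ?A"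
    by (simp only: tendsto_of_real_iff)
  have "(\<lambda>n. \<integral>\<^sup>+\<omega>. ennreal ((cmod (fourier f \<omega>))\<^sup>2 * gauss (s n *\<^sub>R \<omega>)) \<partial>lborel) \<longlonglongrightarrow> (\<integral>\<^sup>+\<omega>. ennreal ((cmod (fourier f \<omega>))\<^sup>2) \<partial>lborel)"
  proof (rule nn_integral_LIMSEQ)
    show "incseq (\<lambda>n \<omega>. ennreal ((cmod (fourier f \<omega>))\<^sup>2 * gauss (s n *\<^sub>R \<omega>)))"
    proof (intro incseq_SucI le_funI ennreal_leI mult_left_mono)
      fix n and \<omega> :: "real^'n"
      have "s (Suc n) \<le> s n" by (simp add: s_def frac_le)
      then have "(s (Suc n) * norm \<omega>)\<^sup>2 \<le> (s n * norm \<omega>)\<^sup>2"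
        using s[of "Suc n"] by (intro power_mono mult_right_mono) auto
      then show "gauss (s n *\<^sub>R \<omega>) \<le> gauss (s (Suc n) *\<^sub>R \<omega>)"
        using s[of n] s[of "Suc n"] by (simp add: gauss_def)
    qed simp
    fix \<omega> :: "real^'n"
    have "(\<lambda>n. gauss (s n *\<^sub>R \<omega>)) \<longlonglongrightarrow> exp (- (norm (0 *\<^sub>R \<omega>))\<^sup>2 / 2)"
      unfolding gauss_def by (intro tendsto_intros s0) auto
    then have "(\<lambda>n. (cmod (fourier f \<omega>))\<^sup>2 * gauss (s n *\<^sub>R \<omega>)) \<longlonglongrightarrow> (cmod (fourier f \<omega>))\<^sup>2"
      by (auto dest: tendsto_mult_left[of _ _ _ "(cmod (fourier f \<omega>))\<^sup>2"])
    then show "(\<lambda>n. ennreal ((cmod (fourier f \<omega>))\<^sup>2 * gauss (s n *\<^sub>R \<omega>))) \<longlonglongrightarrow> ennreal ((cmod (fourier f \<omega>))\<^sup>2)"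
      by (rule tendsto_ennrealI)
  qed simp
  also have "(\<lambda>n. \<integral>\<^sup>+\<omega>. ennreal ((cmod (fourier f \<omega>))\<^sup>2 * gauss (s n *\<^sub>R \<omega>)) \<partial>lborel) = (\<lambda>n. ennreal (?J n))"
    by (intro ext nn_integral_eq_integral ig) (auto simp: less_imp_le[OF gauss_bounds(1)])
  finally have "(\<integral>\<^sup>+\<omega>. ennreal ((cmod (fourier f \<omega>))\<^sup>2) \<partial>lborel) = ennreal ((2 * pi) ^ CARD('n) * ?A)"
    using tendsto_ennrealI[OF J] by (rule LIMSEQ_unique)
  then have "has_bochner_integral lborel (\<lambda>\<omega>. (cmod (fourier f \<omega>))\<^sup>2) ((2 * pi) ^ CARD('n) * ?A)"
    by (intro has_bochner_integral_nn_integral) (auto simp: integral_nonneg_AE)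
  then show "sq_integrable (fourier f)"
    "(sqnorm (fourier f)) = (2 * pi) ^ CARD('n) * ?A"
    by (simp_all add: has_bochner_integral_iff)
qed

section \<open>Functions synthesised from a compactly supported spectrum\<close>

text \<open>The spectrum vanishes everywhere, not only almost everywhere, outside \<open>S\<close>; every class of functions with
essential support in a closed \<open>S\<close> has such a representative.\<close>

definition spectrum_in :: "(real^'n::finite) set \<Rightarrow> (real^'n \<Rightarrow> complex) \<Rightarrow> bool" where
  "spectrum_in S F \<longleftrightarrow> F \<in> borel_measurable borel \<and> sq_integrable F \<and>
     (\<forall>\<omega>. \<omega> \<notin> S \<longrightarrow> F \<omega> = 0)"

text \<open>The inverse Fourier transform of an integrable function.\<close>

definition synth :: "(real^'n::finite \<Rightarrow> complex) \<Rightarrow> real^'n \<Rightarrow> complex" where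
  "synth F x = of_real (1 / (2 * pi) ^ CARD('n)) * (LBINT \<omega>. F \<omega> * iexp (\<omega> \<bullet> x))"

lemma spectrum_inD:
  assumes "spectrum_in S F"
  shows "F \<in> borel_measurable borel" "sq_integrable F" "\<omega> \<notin> S \<Longrightarrow> F \<omega> = 0"
  using assms by (auto simp: spectrum_in_def)

lemma spectrum_in_integrable:
  assumes F: "spectrum_in S F" and S: "compact S"
  shows "integrable lborel F"
proof -
  note [measurable] = spectrum_inD(1)[OF F]
  have [measurable]: "S \<in> sets borel" using S by (rule borel_compact)
  have "integrable lborel (\<lambda>\<omega>. (cmod (F \<omega>))\<^sup>2 + indicator S \<omega> :: real)"
    using spectrum_inD(2)[OF F] emeasure_compact_finite[OF S] by simp
  then show ?thesis
  proof (rule Bochner_Integration.integrable_bound)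
    have "cmod (F \<omega>) \<le> (cmod (F \<omega>))\<^sup>2 + indicator S \<omega>" for \<omega>
    proof (cases "\<omega> \<in> S")
      case True
      have "0 \<le> (cmod (F \<omega>) - 1/2)\<^sup>2" by simp
      then show ?thesis using True by (simp add: power2_diff power_divide)
    qed (use spectrum_inD(3)[OF F] in simp)
    then show "AE \<omega> in lborel. cmod (F \<omega>) \<le> norm ((cmod (F \<omega>))\<^sup>2 + indicator S \<omega> :: real)"
      by simp
  qed simp
qed

lemma spectrum_in_mult:
  assumes F: "spectrum_in S F" and S: "compact S" and p: "continuous_on UNIV p"
  shows "spectrum_in S (\<lambda>\<omega>. p \<omega> * F \<omega>)"
proof -
  have [measurable]: "p \<in> borel_measurable borel" using p by (rule borel_measurable_continuous_onI)
  note [measurable] = spectrum_inD(1)[OF F]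
  have "bounded (p ` S)"
    using S p by (intro compact_imp_bounded compact_continuous_image) (auto intro: continuous_on_subset)
  then obtain B where B: "\<And>\<omega>. \<omega> \<in> S \<Longrightarrow> cmod (p \<omega>) \<le> B" by (auto simp: bounded_iff)
  have "(cmod (p \<omega> * F \<omega>))\<^sup>2 \<le> B\<^sup>2 * (cmod (F \<omega>))\<^sup>2" for \<omega>
    using B[of \<omega>] spectrum_inD(3)[OF F, of \<omega>]
    by (cases "\<omega> \<in> S") (auto simp: norm_mult power_mult_distrib intro!: mult_right_mono power_mono)
  then have le: "\<forall>\<omega>. norm ((cmod (p \<omega> * F \<omega>))\<^sup>2) \<le> norm (B\<^sup>2 * (cmod (F \<omega>))\<^sup>2)"
    by simp
  have "integrable lborel (\<lambda>\<omega>. B\<^sup>2 * (cmod (F \<omega>))\<^sup>2)" using spectrum_inD(2)[OF F] by simp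
  then have "integrable lborel (\<lambda>\<omega>. (cmod (p \<omega> * F \<omega>))\<^sup>2)"
    by (rule Bochner_Integration.integrable_bound[OF _ _ AE_I2]) (simp_all only: le, measurable)
  then show ?thesis using spectrum_inD(3)[OF F] by (auto simp: spectrum_in_def)
qed

lemma integrable_square_add:
  fixes f g :: "'a \<Rightarrow> complex"
  assumes [measurable]: "f \<in> borel_measurable M" "g \<in> borel_measurable M"
    and f: "integrable M (\<lambda>x. (cmod (f x))\<^sup>2)" and g: "integrable M (\<lambda>x. (cmod (g x))\<^sup>2)"
  shows "integrable M (\<lambda>x. (cmod (f x + g x))\<^sup>2)"
proof (rule Bochner_Integration.integrable_bound)
  show "integrable M (\<lambda>x. 2 * (cmod (f x))\<^sup>2 + 2 * (cmod (g x))\<^sup>2)" using f g by simp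
  have "(cmod (f x + g x))\<^sup>2 \<le> 2 * (cmod (f x))\<^sup>2 + 2 * (cmod (g x))\<^sup>2" for x
  proof -
    have "(cmod (f x + g x))\<^sup>2 \<le> (cmod (f x) + cmod (g x))\<^sup>2"
      by (intro power_mono norm_triangle_ineq) simp
    also have "\<dots> \<le> 2 * (cmod (f x))\<^sup>2 + 2 * (cmod (g x))\<^sup>2"
      using zero_le_power2[of "cmod (f x) - cmod (g x)"] by (simp add: power2_sum power2_diff)
    finally show ?thesis .
  qed
  then show "AE x in M. norm ((cmod (f x + g x))\<^sup>2) \<le> norm (2 * (cmod (f x))\<^sup>2 + 2 * (cmod (g x))\<^sup>2)"
    by simp
qed simp

lemma spectrum_in_add:
  assumes F: "spectrum_in S F" and G: "spectrum_in S G"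
  shows "spectrum_in S (\<lambda>\<omega>. F \<omega> + G \<omega>)"
  using integrable_square_add[of F lborel G] spectrum_inD[OF F] spectrum_inD[OF G]
  by (auto simp: spectrum_in_def)

lemma spectrum_in_truncate:
  fixes f :: "real^'n::finite \<Rightarrow> complex"
  assumes [measurable]: "f \<in> borel_measurable borel" "S \<in> sets borel" and f: "sq_integrable f"
  shows "spectrum_in S (\<lambda>x. indicator S x * f x)"
proof -
  have "integrable lborel (\<lambda>x. (cmod (indicator S x * f x))\<^sup>2)"
    by (rule Bochner_Integration.integrable_bound[OF f]) (auto simp: indicator_def)
  then show ?thesis by (auto simp: spectrum_in_def)
qed

lemma synth_eq_fourier: "synth F x = of_real (1 / (2 * pi) ^ CARD('n)) * fourier F (- x)"
  for x :: "real^'n::finite"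
  unfolding synth_def fourier_def by (simp add: inner_commute)

lemma synth_measurable [measurable]:
  assumes [measurable]: "F \<in> borel_measurable borel"
  shows "synth F \<in> borel_measurable borel"
  unfolding synth_eq_fourier[abs_def] by measurable

lemma synth_Plancherel:
  fixes F :: "real^'n::finite \<Rightarrow> complex"
  assumes F: "spectrum_in S F" and S: "compact S"
  shows "sq_integrable (synth F)"
    and "(sqnorm (synth F)) = 1 / (2 * pi) ^ CARD('n) * (sqnorm F)"
proof -
  note [measurable] = spectrum_inD(1)[OF F]
  note P = Plancherel_L1_L2[OF spectrum_in_integrable[OF F S] spectrum_inD(2)[OF F]]
  let ?c = "1 / (2 * pi) ^ CARD('n)"
  have e: "(cmod (synth F x))\<^sup>2 = ?c\<^sup>2 * (cmod (fourier F (- x)))\<^sup>2" for x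
    unfolding synth_eq_fourier by (simp add: norm_mult power_mult_distrib norm_divide norm_power power_divide)
  have i: "integrable lborel (\<lambda>x. (cmod (fourier F (- x)))\<^sup>2)"
    using lborel_integral_scale(2)[of "\<lambda>x. (cmod (fourier F x))\<^sup>2" "-1"] P(1) by simp
  then show "sq_integrable (synth F)" unfolding e by simp
  have "(sqnorm (synth F)) = ?c\<^sup>2 * (sqnorm (fourier F))"
    unfolding e using lborel_integral_scale(1)[of "\<lambda>x. (cmod (fourier F x))\<^sup>2" "-1"] by simp
  also have "\<dots> = ?c * (sqnorm F)"
    unfolding P(2) by (simp add: power2_eq_square)
  finally show "(sqnorm (synth F)) = ?c * (sqnorm F)" .
qed

lemma synth_add_scaled:
  assumes F: "spectrum_in S F" and G: "spectrum_in S G" and S: "compact S"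
  shows "synth (\<lambda>\<omega>. F \<omega> + c * G \<omega>) x = synth F x + c * synth G x"
proof -
  have 1: "integrable lborel (\<lambda>\<omega>. F \<omega> * iexp (\<omega> \<bullet> x))"
    by (rule integrable_mult_cis) (auto intro: spectrum_in_integrable F S)
  have 2: "integrable lborel (\<lambda>\<omega>. G \<omega> * iexp (\<omega> \<bullet> x))"
    by (rule integrable_mult_cis) (auto intro: spectrum_in_integrable G S)
  have "(LBINT \<omega>. (F \<omega> + c * G \<omega>) * iexp (\<omega> \<bullet> x))
    = (LBINT \<omega>. F \<omega> * iexp (\<omega> \<bullet> x) + c * (G \<omega> * iexp (\<omega> \<bullet> x)))"
    by (simp add: distrib_right mult.assoc)
  also have "\<dots> = (LBINT \<omega>. F \<omega> * iexp (\<omega> \<bullet> x)) + c * (LBINT \<omega>. G \<omega> * iexp (\<omega> \<bullet> x))"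
    using 1 2 by simp
  finally show ?thesis unfolding synth_def by (simp add: distrib_left mult.left_commute)
qed

text \<open>Two instances of polarisation are enough over the complex numbers: adding \<open>g\<close> gives the real part
of the inner product and adding \<open>\<i> * g\<close> gives its imaginary part.\<close>

lemma integral_mult_cnj_polarization:
  fixes f g :: "'a \<Rightarrow> complex"
  assumes [measurable]: "f \<in> borel_measurable M" "g \<in> borel_measurable M"
    and f: "integrable M (\<lambda>x. (cmod (f x))\<^sup>2)" and g: "integrable M (\<lambda>x. (cmod (g x))\<^sup>2)"
  defines "Q \<equiv> \<lambda>h. \<integral>x. (cmod (h x))\<^sup>2 \<partial>M"
  shows "(\<integral>x. f x * cnj (g x) \<partial>M) =
    of_real ((Q (\<lambda>x. f x + g x) - Q f - Q g) / 2) + \<i> * of_real ((Q (\<lambda>x. f x + \<i> * g x) - Q f - Q g) / 2)"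
proof -
  have g': "integrable M (\<lambda>x. (cmod (\<i> * g x))\<^sup>2)" using g by (simp add: norm_mult)
  have 1: "integrable M (\<lambda>x. (cmod (f x + g x))\<^sup>2)" by (rule integrable_square_add) (use f g in auto)
  have 2: "integrable M (\<lambda>x. (cmod (f x + \<i> * g x))\<^sup>2)" by (rule integrable_square_add) (use f g' in auto)
  have e: "z * cnj w = of_real (((cmod (z + w))\<^sup>2 - (cmod z)\<^sup>2 - (cmod w)\<^sup>2) / 2)
      + \<i> * of_real (((cmod (z + \<i> * w))\<^sup>2 - (cmod z)\<^sup>2 - (cmod w)\<^sup>2) / 2)" for z w
    unfolding cmod_power2 by (auto simp: complex_eq_iff power2_eq_square algebra_simps)
  have 3: "integrable M (\<lambda>x. complex_of_real (((cmod (f x + g x))\<^sup>2 - (cmod (f x))\<^sup>2 - (cmod (g x))\<^sup>2) / 2))"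
    using 1 f g by (simp only: complex_of_real_integrable_eq) simp
  have 4: "integrable M (\<lambda>x. complex_of_real (((cmod (f x + \<i> * g x))\<^sup>2 - (cmod (f x))\<^sup>2 - (cmod (g x))\<^sup>2) / 2))"
    using 2 f g by (simp only: complex_of_real_integrable_eq) simp
  have "(\<integral>x. f x * cnj (g x) \<partial>M) = (\<integral>x. complex_of_real (((cmod (f x + g x))\<^sup>2 - (cmod (f x))\<^sup>2 - (cmod (g x))\<^sup>2) / 2) \<partial>M)
     + \<i> * (\<integral>x. complex_of_real (((cmod (f x + \<i> * g x))\<^sup>2 - (cmod (f x))\<^sup>2 - (cmod (g x))\<^sup>2) / 2) \<partial>M)"
    unfolding e using 3 4 by (subst Bochner_Integration.integral_add) (auto simp del: of_real_divide)
  also have "(\<integral>x. complex_of_real (((cmod (f x + g x))\<^sup>2 - (cmod (f x))\<^sup>2 - (cmod (g x))\<^sup>2) / 2) \<partial>M)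
     = of_real ((Q (\<lambda>x. f x + g x) - Q f - Q g) / 2)"
    unfolding integral_complex_of_real Q_def using 1 f g by simp
  also have "(\<integral>x. complex_of_real (((cmod (f x + \<i> * g x))\<^sup>2 - (cmod (f x))\<^sup>2 - (cmod (g x))\<^sup>2) / 2) \<partial>M)
     = of_real ((Q (\<lambda>x. f x + \<i> * g x) - Q f - Q g) / 2)"
    unfolding integral_complex_of_real Q_def using 2 f g by simp
  finally show ?thesis .
qed

lemma synth_inner:
  fixes F G :: "real^'n::finite \<Rightarrow> complex"
  assumes F: "spectrum_in S F" and G: "spectrum_in S G" and S: "compact S"
  shows "(LBINT x. synth F x * cnj (synth G x)) = of_real (1 / (2 * pi) ^ CARD('n)) * (LBINT \<omega>. F \<omega> * cnj (G \<omega>))"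
proof -
  let ?c = "1 / (2 * pi) ^ CARD('n)"
  note [measurable] = spectrum_inD(1)[OF F] spectrum_inD(1)[OF G]
  have G': "spectrum_in S (\<lambda>\<omega>. \<i> * G \<omega>)" by (rule spectrum_in_mult[OF G S]) simp
  have a1: "synth F x + synth G x = synth (\<lambda>\<omega>. F \<omega> + G \<omega>) x" for x
    using synth_add_scaled[OF F G S, of 1 x] by simp
  have a2: "synth F x + \<i> * synth G x = synth (\<lambda>\<omega>. F \<omega> + \<i> * G \<omega>) x" for x
    using synth_add_scaled[OF F G S, of \<i> x] by simp
  have "(LBINT x. synth F x * cnj (synth G x)) =
     of_real ((?c * (LBINT \<omega>. (cmod (F \<omega> + G \<omega>))\<^sup>2) - ?c * (sqnorm F) - ?c * (sqnorm G)) / 2)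
    + \<i> * of_real ((?c * (LBINT \<omega>. (cmod (F \<omega> + \<i> * G \<omega>))\<^sup>2) - ?c * (sqnorm F) - ?c * (sqnorm G)) / 2)"
    using synth_measurable[OF spectrum_inD(1)[OF F]] synth_measurable[OF spectrum_inD(1)[OF G]]
    by (subst integral_mult_cnj_polarization)
      (simp_all only: a1 a2 synth_Plancherel[OF F S] synth_Plancherel[OF G S] synth_Plancherel[OF spectrum_in_add[OF F G] S]
        synth_Plancherel[OF spectrum_in_add[OF F G'] S] measurable_lborel2)
  also have "\<dots> = of_real ?c * (of_real (((LBINT \<omega>. (cmod (F \<omega> + G \<omega>))\<^sup>2) - (sqnorm F) - (sqnorm G)) / 2)
    + \<i> * of_real (((LBINT \<omega>. (cmod (F \<omega> + \<i> * G \<omega>))\<^sup>2) - (sqnorm F) - (sqnorm G)) / 2))"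
    by (simp only: right_diff_distrib[symmetric] times_divide_eq_right[symmetric] of_real_mult distrib_left mult.left_commute)
  also have "\<dots> = of_real ?c * (LBINT \<omega>. F \<omega> * cnj (G \<omega>))"
    by (subst integral_mult_cnj_polarization) (auto intro: spectrum_inD(2) F G)
  finally show ?thesis .
qed

lemma truncated_fourier_facts:
  fixes f :: "real^'n::finite \<Rightarrow> complex"
  assumes [measurable]: "f \<in> borel_measurable borel" and f: "sq_integrable f"
    and t: "t = (\<lambda>x. indicator (cball 0 R) x * f x)"
  shows "integrable lborel t" and "sq_integrable t" and "t \<in> borel_measurable borel"
    and "sq_integrable (fourier t)"
    and "(sqnorm (fourier t)) = (2 * pi) ^ CARD('n) * (sqnorm t)"
proof -
  have s: "spectrum_in (cball 0 R) t" unfolding t by (rule spectrum_in_truncate) (use f in auto)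
  show 1: "integrable lborel t" by (rule spectrum_in_integrable[OF s compact_cball])
  show 2: "sq_integrable t" "t \<in> borel_measurable borel"
    using s by (auto simp: spectrum_in_def)
  show "sq_integrable (fourier t)"
    "(sqnorm (fourier t)) = (2 * pi) ^ CARD('n) * (sqnorm t)"
    using Plancherel_L1_L2[OF 1 2(1)] by auto
qed

text \<open>With \<open>g\<close> the synthesised function and \<open>g\<^sub>R\<close> its restriction to the ball of radius \<open>R\<close>, Plancherel and
the multiplication formula evaluate every term in the expansion of the squared distance between \<open>F\<close>
and the transform of \<open>g\<^sub>R\<close>: it equals \<open>(2 * pi) ^ d\<close> times the squared norm of \<open>g\<close> outside the ball.\<close>

lemma has_fourier_L2_synth:
  fixes F :: "real^'n::finite \<Rightarrow> complex"
  assumes F: "spectrum_in S F" and S: "compact S"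
  shows "has_fourier_L2 (synth F) F"
proof -
  let ?C = "(2 * pi) ^ CARD('n) :: real"
  define g where "g = synth F"
  note [measurable] = spectrum_inD(1)[OF F]
  have gm [measurable]: "g \<in> borel_measurable borel" unfolding g_def by measurable
  have g: "sq_integrable g" and gF: "(sqnorm F) = ?C * (sqnorm g)"
    using synth_Plancherel[OF F S] by (auto simp: g_def)
  have iF: "integrable lborel F" by (rule spectrum_in_integrable[OF F S])
  define t where "t R = (\<lambda>x. indicator (cball 0 R) x * g x)" for R
  note T = truncated_fourier_facts[OF gm g t_def]
  note [measurable] = T(3)
  have tg: "(cmod (t R x))\<^sup>2 = indicator (cball 0 R) x * (cmod (g x))\<^sup>2" for R x
    by (simp add: t_def indicator_def)
  have cF: "fourier (\<lambda>\<omega>. cnj (F \<omega>)) x = of_real ?C * cnj (g x)" for x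
  proof -
    have "fourier (\<lambda>\<omega>. cnj (F \<omega>)) x = (LBINT \<omega>. cnj (F \<omega> * iexp (\<omega> \<bullet> x)))"
      unfolding fourier_def by (simp add: exp_cnj inner_commute)
    also have "\<dots> = of_real ?C * cnj (g x)"
      unfolding g_def synth_def by (simp only: Bochner_Integration.integral_cnj) simp
    finally show ?thesis .
  qed
  have cross: "(LBINT \<omega>. fourier (t R) \<omega> * cnj (F \<omega>)) = of_real (?C * (sqnorm (t R)))" for R
  proof -
    have "(LBINT \<omega>. fourier (t R) \<omega> * cnj (F \<omega>)) = (LBINT x. t R x * (of_real ?C * cnj (g x)))"
      using iF by (subst fourier_swap) (auto simp: cF T(1))
    also have "\<dots> = (LBINT x. of_real (?C * (cmod (t R x))\<^sup>2))"
    proof (intro Bochner_Integration.integral_cong refl)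
      fix x
      have "t R x * cnj (g x) = of_real ((cmod (t R x))\<^sup>2)"
        unfolding tg by (simp add: t_def indicator_def complex_norm_square[symmetric])
      then have "of_real ?C * (t R x * cnj (g x)) = of_real (?C * (cmod (t R x))\<^sup>2)"
        by (simp only: of_real_mult)
      then show "t R x * (of_real ?C * cnj (g x)) = of_real (?C * (cmod (t R x))\<^sup>2)"
        by (simp only: mult.left_commute[of "t R x"])
    qed
    also have "\<dots> = of_real (?C * (sqnorm (t R)))"
      by (simp only: integral_complex_of_real integral_mult_right_zero)
    finally show ?thesis .
  qed
  have F2: "sq_integrable F" by (rule spectrum_inD(2)[OF F])
  have main: "(\<integral>\<^sup>+\<omega>. ennreal ((cmod (F \<omega> - fourier (t R) \<omega>))\<^sup>2) \<partial>lborel)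
     = ennreal (?C * (sqnorm g) - ?C * (sqnorm (t R)))" for R
  proof -
    define X where "X \<omega> = fourier (t R) \<omega> * cnj (F \<omega>)" for \<omega>
    have ic: "integrable lborel X"
      unfolding X_def[abs_def] by (rule integrable_mult_square) (use F2 T in auto)
    have e: "(cmod (F \<omega> - fourier (t R) \<omega>))\<^sup>2 = (cmod (F \<omega>))\<^sup>2 + (cmod (fourier (t R) \<omega>))\<^sup>2 - 2 * Re (X \<omega>)" for \<omega>
      unfolding cmod_power2 X_def by (simp add: power2_eq_square algebra_simps)
    have i: "integrable lborel (\<lambda>\<omega>. (cmod (F \<omega> - fourier (t R) \<omega>))\<^sup>2)"
      unfolding e using F2 T(4) ic by auto
    have "(LBINT \<omega>. (cmod (F \<omega> - fourier (t R) \<omega>))\<^sup>2)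
       = (sqnorm F) + (sqnorm (fourier (t R))) - 2 * Re (integral\<^sup>L lborel X)"
      unfolding e using F2 T(4) ic by simp
    also have "\<dots> = ?C * (sqnorm g) - ?C * (sqnorm (t R))"
      unfolding X_def[abs_def] cross gF T(5) by simp
    finally show ?thesis using nn_integral_eq_integral[OF i] by simp
  qed
  have "((\<lambda>R. \<integral>x. (cmod (t R x))\<^sup>2 \<partial>lborel) \<longlongrightarrow> (sqnorm g)) at_top"
  proof (rule integral_dominated_convergence_at_top[where w="\<lambda>x. (cmod (g x))\<^sup>2"])
    show "AE x in lborel. ((\<lambda>R. (cmod (t R x))\<^sup>2) \<longlongrightarrow> (cmod (g x))\<^sup>2) at_top"
    proof (rule AE_I2)
      fix x
      have "\<forall>\<^sub>F R in at_top. (cmod (t R x))\<^sup>2 = (cmod (g x))\<^sup>2"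
        using eventually_ge_at_top[of "norm x"] by eventually_elim (simp add: tg)
      then show "((\<lambda>R. (cmod (t R x))\<^sup>2) \<longlongrightarrow> (cmod (g x))\<^sup>2) at_top" by (rule tendsto_eventually)
    qed
  qed (use g in \<open>auto simp: tg indicator_def\<close>)
  then have "((\<lambda>R. ?C * (sqnorm g) - ?C * (sqnorm (t R))) \<longlongrightarrow>
     ?C * (sqnorm g) - ?C * (sqnorm g)) at_top"
    by (intro tendsto_intros)
  then have "((\<lambda>R. \<integral>\<^sup>+\<omega>. ennreal ((cmod (F \<omega> - fourier (t R) \<omega>))\<^sup>2) \<partial>lborel) \<longlongrightarrow> 0) at_top"
    unfolding main by (auto dest: tendsto_ennrealI)
  moreover have "F \<in> L2" using F2 by (simp add: L2_def)
  ultimately show ?thesis unfolding has_fourier_L2_def t_def g_def by simp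
qed

text \<open>The complement of the essential support is a union of open null sets of \<open>F\<close>, of which countably many suffice
by the Lindeloef property.\<close>

lemma AE_zero_off_ess_support:
  assumes "ess_support F \<subseteq> S" "closed S"
  shows "AE \<omega> in lborel. \<omega> \<notin> S \<longrightarrow> F \<omega> = 0"
proof -
  define \<U> where "\<U> = {U. open U \<and> (AE \<omega> in lborel. \<omega> \<in> U \<longrightarrow> F \<omega> = 0)}"
  obtain \<V> where V: "\<V> \<subseteq> \<U>" "countable \<V>" "\<Union>\<V> = \<Union>\<U>"
    by (rule Lindelof[of \<U>]) (auto simp: \<U>_def)
  have "AE \<omega> in lborel. \<forall>U\<in>\<V>. \<omega> \<in> U \<longrightarrow> F \<omega> = 0"
    unfolding AE_ball_countable[OF V(2)] using V(1) by (auto simp: \<U>_def)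
  then show ?thesis
  proof eventually_elim
    case (elim \<omega>)
    have "- S \<subseteq> \<Union>\<V>" using assms unfolding ess_support_def V(3) \<U>_def[symmetric] by blast
    then show ?case using elim by blast
  qed
qed

text \<open>Uniqueness of the L2 Fourier transform: the difference \<open>h\<close> of \<open>f\<close> and the function synthesised from its
transform has truncated transforms tending to 0 in L2.  By Plancherel their norms are the norms of
the restrictions of \<open>h\<close> to growing balls, which increase; hence \<open>h\<close> vanishes almost everywhere.\<close>

lemma bandlimited_synth:
  fixes f :: "real^'n::finite \<Rightarrow> complex"
  assumes f: "f \<in> bandlimited S" and S: "compact S"
  obtains F where "spectrum_in S F" "AE x in lborel. f x = synth F x"
proof -
  let ?C = "(2 * pi) ^ CARD('n) :: real"
  obtain F0 where f2: "f \<in> L2" and F0: "has_fourier_L2 f F0" "ess_support F0 \<subseteq> S"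
    using f by (auto simp: bandlimited_def)
  have [measurable]: "S \<in> sets borel" using S by (rule borel_compact)
  have fm [measurable]: "f \<in> borel_measurable borel" and fi: "sq_integrable f"
    using f2 by (auto simp: L2_def)
  have [measurable]: "F0 \<in> borel_measurable borel" and F0i: "sq_integrable F0"
    using F0 by (auto simp: has_fourier_L2_def L2_def)
  define F where "F \<omega> = indicator S \<omega> * F0 \<omega>" for \<omega>
  have F: "spectrum_in S F"
    unfolding F_def[abs_def] by (rule spectrum_in_truncate) (use F0i in auto)
  have FF0: "AE \<omega> in lborel. F0 \<omega> = F \<omega>"
    using AE_zero_off_ess_support[OF F0(2) compact_imp_closed[OF S]] by eventually_elim (auto simp: F_def indicator_def)
  define g where "g = synth F"
  note [measurable] = spectrum_inD(1)[OF F]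
  have gm [measurable]: "g \<in> borel_measurable borel" unfolding g_def by measurable
  have g: "sq_integrable g"
    using synth_Plancherel[OF F S] by (auto simp: g_def)
  define h where "h x = f x - g x" for x
  have hm [measurable]: "h \<in> borel_measurable borel" unfolding h_def[abs_def] by measurable
  have h: "sq_integrable h"
    using integrable_square_add[of f lborel "\<lambda>x. - g x"] fi g by (simp add: h_def)
  define t where "t u R = (\<lambda>x. indicator (cball 0 R) x * u x)" for u :: "real^'n \<Rightarrow> complex" and R
  note Tf = truncated_fourier_facts[OF fm fi t_def]
  note Tg = truncated_fourier_facts[OF gm g t_def]
  note Th = truncated_fourier_facts[OF hm h t_def]
  note [measurable] = Tf(3) Tg(3) Th(3)
  have lin: "fourier (t h R) \<omega> = fourier (t f R) \<omega> - fourier (t g R) \<omega>" for R \<omega>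
  proof -
    have "fourier (t h R) \<omega> = (LBINT x. t f R x * exp (- \<i> * of_real (\<omega> \<bullet> x)) - t g R x * exp (- \<i> * of_real (\<omega> \<bullet> x)))"
      unfolding fourier_def by (intro Bochner_Integration.integral_cong refl) (simp add: t_def h_def algebra_simps)
    also have "\<dots> = fourier (t f R) \<omega> - fourier (t g R) \<omega>"
      unfolding fourier_def
      by (intro Bochner_Integration.integral_diff integrable_mult_cis Tf(1) Tg(1)) auto
    finally show ?thesis .
  qed
  define D where "D u R = (\<integral>\<^sup>+\<omega>. ennreal ((cmod (F \<omega> - fourier (t u R) \<omega>))\<^sup>2) \<partial>lborel)" for u R
  have Df: "(D f \<longlongrightarrow> 0) at_top"
  proof -
    have "(\<integral>\<^sup>+\<omega>. ennreal ((cmod (F0 \<omega> - fourier (t f R) \<omega>))\<^sup>2) \<partial>lborel) = D f R" for R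
      unfolding D_def by (rule nn_integral_cong_AE) (use FF0 in eventually_elim, simp)
    then show ?thesis using F0(1) by (simp add: has_fourier_L2_def t_def)
  qed
  have Dg: "(D g \<longlongrightarrow> 0) at_top"
    using has_fourier_L2_synth[OF F S] unfolding has_fourier_L2_def D_def[abs_def] t_def g_def by simp
  have le: "ennreal (?C * (sqnorm (t h R))) \<le> 2 * D f R + 2 * D g R" for R
  proof -
    have "ennreal (?C * (sqnorm (t h R))) = (\<integral>\<^sup>+\<omega>. ennreal ((cmod (fourier (t h R) \<omega>))\<^sup>2) \<partial>lborel)"
      using nn_integral_eq_integral[OF Th(4)[of R]] by (simp add: Th(5))
    also have "\<dots> \<le> (\<integral>\<^sup>+\<omega>. 2 * ennreal ((cmod (F \<omega> - fourier (t f R) \<omega>))\<^sup>2) + 2 * ennreal ((cmod (F \<omega> - fourier (t g R) \<omega>))\<^sup>2) \<partial>lborel)"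
    proof (rule nn_integral_mono)
      fix \<omega>
      define a where "a = F \<omega> - fourier (t f R) \<omega>"
      define b where "b = F \<omega> - fourier (t g R) \<omega>"
      have "(cmod (fourier (t h R) \<omega>))\<^sup>2 = (cmod (b - a))\<^sup>2" by (simp add: lin a_def b_def)
      also have "\<dots> \<le> (cmod b + cmod a)\<^sup>2" by (intro power_mono norm_triangle_ineq4) simp
      also have "\<dots> \<le> 2 * (cmod a)\<^sup>2 + 2 * (cmod b)\<^sup>2"
        using zero_le_power2[of "cmod b - cmod a"] by (simp add: power2_sum power2_diff)
      finally show "ennreal ((cmod (fourier (t h R) \<omega>))\<^sup>2) \<le> 2 * ennreal ((cmod (F \<omega> - fourier (t f R) \<omega>))\<^sup>2) + 2 * ennreal ((cmod (F \<omega> - fourier (t g R) \<omega>))\<^sup>2)"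
        unfolding a_def[symmetric] b_def[symmetric]
        by (simp add: ennreal_mult'[symmetric] ennreal_plus[symmetric] ennreal_leI del: ennreal_plus
            flip: ennreal_numeral)
    qed
    also have "\<dots> = 2 * D f R + 2 * D g R"
      unfolding D_def by (simp add: nn_integral_add nn_integral_cmult)
    finally show ?thesis .
  qed
  have lim: "((\<lambda>R. 2 * D f R + 2 * D g R) \<longlongrightarrow> 2 * 0 + 2 * 0) at_top"
    by (intro tendsto_add ennreal_tendsto_cmult Df Dg) auto
  have zero: "(sqnorm (t h R)) = 0" for R
  proof -
    have "\<forall>\<^sub>F R' in at_top. ennreal (?C * (sqnorm (t h R))) \<le> 2 * D f R' + 2 * D g R'"
      using eventually_ge_at_top[of R]
    proof eventually_elim
      case (elim R')
      have "(sqnorm (t h R)) \<le> (sqnorm (t h R'))"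
        by (rule integral_mono') (use elim Th(2) in \<open>auto simp: t_def indicator_def\<close>)
      then have "ennreal (?C * (sqnorm (t h R))) \<le> ennreal (?C * (sqnorm (t h R')))"
        by (intro ennreal_leI mult_left_mono) auto
      then show ?case using le[of R'] by (rule order_trans)
    qed
    then have "ennreal (?C * (sqnorm (t h R))) \<le> 2 * 0 + 2 * 0"
      by (intro tendsto_lowerbound[OF lim]) auto
    then have "?C * (sqnorm (t h R)) \<le> 0" by (simp add: ennreal_eq_0_iff)
    moreover have "0 \<le> (sqnorm (t h R))" by (simp add: integral_nonneg_AE)
    moreover have "0 < ?C" by simp
    ultimately show ?thesis by (meson mult_le_0_iff not_less order_antisym)
  qed
  have "AE x in lborel. t h (real n) x = 0" for n
    using zero[of "real n"] Th(2)[of "real n"]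
    by (subst (asm) integral_nonneg_eq_0_iff_AE) auto
  then have "AE x in lborel. \<forall>n. t h (real n) x = 0" by (simp add: AE_all_countable)
  then have "AE x in lborel. f x = synth F x"
  proof eventually_elim
    case (elim x)
    obtain n where "norm x \<le> real n" using real_arch_simple by blast
    then show ?case using elim[rule_format, of n] by (simp add: t_def h_def g_def)
  qed
  then show ?thesis using F that by blast
qed

lemma synth_bandlimited:
  assumes F: "spectrum_in S F" and S: "compact S"
  shows "synth F \<in> bandlimited S"
proof -
  note [measurable] = spectrum_inD(1)[OF F]
  have "synth F \<in> L2" using synth_Plancherel(1)[OF F S] by (simp add: L2_def)
  moreover have "ess_support F \<subseteq> S"
  proof -
    have "- S \<in> {U. open U \<and> (AE \<omega> in lborel. \<omega> \<in> U \<longrightarrow> F \<omega> = 0)}"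
      using spectrum_inD(3)[OF F] compact_imp_closed[OF S] by auto
    then show ?thesis unfolding ess_support_def by blast
  qed
  ultimately show ?thesis using has_fourier_L2_synth[OF F S] by (auto simp: bandlimited_def)
qed

section \<open>Multi-indices and Taylor expansion\<close>

lemma finite_multi_indices_on:
  fixes S :: "'n set"
  assumes "finite S"
  shows "finite {\<alpha>::'n \<Rightarrow> nat. (\<forall>i. i \<notin> S \<longrightarrow> \<alpha> i = 0) \<and> sum \<alpha> S = p}"
proof (rule finite_subset)
  show "{\<alpha>. (\<forall>i. i \<notin> S \<longrightarrow> \<alpha> i = 0) \<and> sum \<alpha> S = p} \<subseteq> {\<alpha>. \<forall>i. (i \<in> S \<longrightarrow> \<alpha> i \<in> {..p}) \<and> (i \<notin> S \<longrightarrow> \<alpha> i = 0)}"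
    using member_le_sum[of _ S] assms by auto
  show "finite {\<alpha>. \<forall>i. (i \<in> S \<longrightarrow> \<alpha> i \<in> {..p}) \<and> (i \<notin> S \<longrightarrow> \<alpha> i = 0)}"
    by (rule finite_set_of_finite_funs) (use assms in auto)
qed

lemma binomial_divided:
  fixes a b :: "'b::field_char_0"
  shows "(a + b) ^ p / fact p = (\<Sum>q\<le>p. a ^ q / fact q * (b ^ (p - q) / fact (p - q)))"
proof -
  have "(a + b) ^ p / fact p = (\<Sum>q\<le>p. of_nat (p choose q) * a ^ q * b ^ (p - q) / fact p)"
    by (simp add: binomial_ring sum_divide_distrib)
  also have "\<dots> = (\<Sum>q\<le>p. a ^ q / fact q * (b ^ (p - q) / fact (p - q)))"
    by (intro sum.cong refl) (simp add: binomial_fact)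
  finally show ?thesis .
qed

text \<open>The multinomial theorem in divided form, where the binomial theorem is a convolution and no
multinomial coefficients appear; induction on the set of variables splits off the exponent of
the new one.\<close>

lemma multinomial_divided:
  fixes a :: "'n \<Rightarrow> 'b::field_char_0"
  assumes "finite S"
  shows "(\<Sum>i\<in>S. a i) ^ p / fact p
    = (\<Sum>\<alpha> | (\<forall>i. i \<notin> S \<longrightarrow> \<alpha> i = 0) \<and> sum \<alpha> S = p. \<Prod>i\<in>S. a i ^ \<alpha> i / fact (\<alpha> i))"
  using assms
proof (induction S arbitrary: p rule: finite_induct)
  case empty
  have "{\<alpha>::'n \<Rightarrow> nat. (\<forall>i. i \<notin> {} \<longrightarrow> \<alpha> i = 0) \<and> sum \<alpha> {} = p} = (if p = 0 then {\<lambda>_. 0} else {})"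
    by (auto simp: fun_eq_iff)
  then show ?case by (simp add: power_0_left)
next
  case (insert j S)
  let ?M = "\<lambda>S p. {\<alpha>. (\<forall>i. i \<notin> S \<longrightarrow> \<alpha> i = 0) \<and> sum \<alpha> S = p} :: ('n \<Rightarrow> nat) set"
  let ?f = "\<lambda>S \<alpha>. \<Prod>i\<in>S. a i ^ \<alpha> i / fact (\<alpha> i)"
  have "(\<Sum>i\<in>insert j S. a i) ^ p / fact p = (\<Sum>q\<le>p. a j ^ q / fact q * ((\<Sum>i\<in>S. a i) ^ (p - q) / fact (p - q)))"
    using insert(1,2) by (simp add: binomial_divided)
  also have "\<dots> = (\<Sum>q\<le>p. \<Sum>\<beta>\<in>?M S (p - q). a j ^ q / fact q * ?f S \<beta>)"
    by (simp only: insert.IH sum_distrib_left)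
  also have "\<dots> = (\<Sum>(q, \<beta>)\<in>Sigma {..p} (\<lambda>q. ?M S (p - q)). a j ^ q / fact q * ?f S \<beta>)"
    by (rule sum.Sigma) (auto intro: finite_multi_indices_on insert(1))
  also have "\<dots> = (\<Sum>\<alpha>\<in>?M (insert j S) p. ?f (insert j S) \<alpha>)"
  proof (rule sum.reindex_bij_witness[where i="\<lambda>\<alpha>. (\<alpha> j, \<alpha>(j := 0))" and j="\<lambda>(q, \<beta>). \<beta>(j := q)"])
    have upd: "(\<Sum>i\<in>S. if i = j then q else \<beta> i) = sum \<beta> S" for \<beta> :: "'n \<Rightarrow> nat" and q
      using insert(2) by (intro sum.cong) auto
    have upd': "?f S (\<beta>(j := q)) = ?f S \<beta>" for \<beta> :: "'n \<Rightarrow> nat" and q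
      using insert(2) by (intro prod.cong) auto
    fix x assume x: "x \<in> Sigma {..p} (\<lambda>q. ?M S (p - q))"
    then show "(case x of (q, \<beta>) \<Rightarrow> \<beta>(j := q)) \<in> ?M (insert j S) p"
      using insert(1,2) by (auto simp: upd)
    show "((case x of (q, \<beta>) \<Rightarrow> \<beta>(j := q)) j, (case x of (q, \<beta>) \<Rightarrow> \<beta>(j := q))(j := 0)) = x"
      using x insert(2) by (auto simp: fun_eq_iff)
    show "?f (insert j S) (case x of (q, \<beta>) \<Rightarrow> \<beta>(j := q)) = (case x of (q, \<beta>) \<Rightarrow> a j ^ q / fact q * ?f S \<beta>)"
      using insert(1,2) by (cases x) (simp add: upd' del: fun_upd_apply, simp)
  next
    have upd: "(\<Sum>i\<in>S. if i = j then q else \<beta> i) = sum \<beta> S" for \<beta> :: "'n \<Rightarrow> nat" and q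
      using insert(2) by (intro sum.cong) auto
    fix \<alpha> assume "\<alpha> \<in> ?M (insert j S) p"
    then show "(\<alpha> j, \<alpha>(j := 0)) \<in> Sigma {..p} (\<lambda>q. ?M S (p - q))"
      using insert(1,2) by (auto simp: upd)
  qed (auto simp: fun_eq_iff)
  finally show ?case .
qed

lemma finite_mi_size_eq [simp]: "finite {\<alpha>::'n::finite \<Rightarrow> nat. mi_size \<alpha> = p}"
  using finite_multi_indices_on[of "UNIV::'n set" p] by (simp add: mi_size_def)

lemma finite_mi_size_le [simp]: "finite {\<alpha>::'n::finite \<Rightarrow> nat. mi_size \<alpha> \<le> k}"
proof -
  have "{\<alpha>::'n \<Rightarrow> nat. mi_size \<alpha> \<le> k} = (\<Union>p\<in>{..k}. {\<alpha>. mi_size \<alpha> = p})" by auto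
  then show ?thesis by simp
qed

lemma sum_mi_size_le:
  fixes f :: "('n::finite \<Rightarrow> nat) \<Rightarrow> 'b::comm_monoid_add"
  shows "(\<Sum>\<alpha> | mi_size \<alpha> \<le> k. f \<alpha>) = (\<Sum>p\<le>k. \<Sum>\<alpha> | mi_size \<alpha> = p. f \<alpha>)"
proof -
  have "(\<Sum>p\<le>k. \<Sum>\<alpha> | mi_size \<alpha> = p. f \<alpha>) = (\<Sum>p\<le>k. \<Sum>\<alpha> | \<alpha> \<in> {\<alpha>. mi_size \<alpha> \<le> k} \<and> mi_size \<alpha> = p. f \<alpha>)"
    by (intro sum.cong refl) auto
  also have "\<dots> = (\<Sum>\<alpha> | mi_size \<alpha> \<le> k. f \<alpha>)"
    by (rule sum.group) auto
  finally show ?thesis ..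
qed

lemma mi_fact_pos: "0 < mi_fact \<alpha>"
  unfolding mi_fact_def by (simp add: prod_pos)

lemma multinomial_mi:
  fixes a :: "'n::finite \<Rightarrow> real"
  shows "(\<Sum>\<alpha> | mi_size \<alpha> = p. (\<Prod>i\<in>UNIV. a i ^ \<alpha> i) / mi_fact \<alpha>) = (\<Sum>i\<in>UNIV. a i) ^ p / fact p"
  using multinomial_divided[of "UNIV::'n set" a p] by (simp add: mi_size_def mi_fact_def prod_dividef)

lemma multinomial_mi_complex:
  fixes a :: "'n::finite \<Rightarrow> complex"
  shows "(\<Sum>\<alpha> | mi_size \<alpha> = p. (\<Prod>i\<in>UNIV. a i ^ \<alpha> i) / of_real (mi_fact \<alpha>)) = (\<Sum>i\<in>UNIV. a i) ^ p / fact p"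
  using multinomial_divided[of "UNIV::'n set" a p] by (simp add: mi_size_def mi_fact_def prod_dividef)

lemma sum_mi_pow_double:
  fixes v :: "real^'n::finite"
  shows "(\<Sum>\<alpha> | mi_size \<alpha> = p. mi_pow v (\<lambda>i. 2 * \<alpha> i) / mi_fact \<alpha>) = norm v ^ (2 * p) / fact p"
proof -
  have "norm v ^ (2 * p) = (\<Sum>i\<in>UNIV. (v $ i)\<^sup>2) ^ p"
    by (simp add: power_mult norm_vec_def L2_set_def sum_nonneg)
  then show ?thesis
    using multinomial_mi[of "\<lambda>i. (v $ i)\<^sup>2" p] by (simp add: mi_pow_def power_mult)
qed

lemma sum_inverse_mi_fact_le:
  "(\<Sum>\<alpha>::'n::finite \<Rightarrow> nat | mi_size \<alpha> \<le> k. 1 / mi_fact \<alpha>) \<le> exp (real CARD('n))"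
proof -
  have "(\<Sum>\<alpha>::'n \<Rightarrow> nat | mi_size \<alpha> = p. 1 / mi_fact \<alpha>) = real CARD('n) ^ p / fact p" for p
    using multinomial_mi[of "\<lambda>_::'n. 1" p] by simp
  then have "(\<Sum>\<alpha>::'n \<Rightarrow> nat | mi_size \<alpha> \<le> k. 1 / mi_fact \<alpha>) = (\<Sum>p\<in>{..k}. real CARD('n) ^ p / fact p)"
    by (simp add: sum_mi_size_le)
  also have "\<dots> \<le> (\<Sum>p. real CARD('n) ^ p / fact p)"
    using summable_exp[of "real CARD('n)"] by (intro sum_le_suminf) (auto simp: field_simps)
  also have "\<dots> = exp (real CARD('n))"
    by (simp add: exp_def field_simps scaleR_conv_of_real)
  finally show ?thesis .
qed

lemma mi_pow_double_nonneg: "0 \<le> mi_pow v (\<lambda>i. 2 * \<alpha> i)"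
  unfolding mi_pow_def by (intro prod_nonneg) (simp add: power_mult)

lemma mi_pow_double_eq: "mi_pow v (\<lambda>i. 2 * \<alpha> i) = (mi_pow v \<alpha>)\<^sup>2"
  unfolding mi_pow_def by (simp add: power_mult[symmetric] prod_power_distrib mult.commute)

lemma mi_pow_double_le:
  fixes v :: "real^'n::finite"
  assumes "norm v \<le> r"
  shows "mi_pow v (\<lambda>i. 2 * \<alpha> i) \<le> r ^ (2 * mi_size \<alpha>)"
proof -
  have "mi_pow v (\<lambda>i. 2 * \<alpha> i) \<le> (\<Prod>i\<in>UNIV. r ^ (2 * \<alpha> i))"
    unfolding mi_pow_def
  proof (intro prod_mono conjI)
    fix i
    have "(v $ i) ^ (2 * \<alpha> i) = \<bar>v $ i\<bar> ^ (2 * \<alpha> i)" by (simp add: power_mult)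
    also have "\<dots> \<le> r ^ (2 * \<alpha> i)"
      using component_le_norm_cart[of v i] assms by (intro power_mono) auto
    finally show "(v $ i) ^ (2 * \<alpha> i) \<le> r ^ (2 * \<alpha> i)" .
  qed (simp add: power_mult)
  also have "\<dots> = r ^ (2 * mi_size \<alpha>)"
    by (simp add: mi_size_def power_sum sum_distrib_left)
  finally show ?thesis .
qed

text \<open>The symbol of the partial derivative of multi-index \<open>\<alpha>\<close> on the Fourier side.\<close>

definition symb :: "('n::finite \<Rightarrow> nat) \<Rightarrow> real^'n \<Rightarrow> complex" where
  "symb \<alpha> \<omega> = (\<Prod>i\<in>UNIV. (\<i> * of_real (\<omega> $ i)) ^ \<alpha> i)"

text \<open>The spectrum of the derivative of multi-index \<open>\<alpha>\<close> of the function with spectrum \<open>F\<close>; the lemma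
\<open>mi_deriv_synth\<close> below justifies this reading.\<close>

abbreviation dsym :: "('n::finite \<Rightarrow> nat) \<Rightarrow> (real^'n \<Rightarrow> complex) \<Rightarrow> real^'n \<Rightarrow> complex" where
  "dsym \<alpha> F \<equiv> \<lambda>\<omega>. symb \<alpha> \<omega> * F \<omega>"

lemma continuous_symb [continuous_intros]: "continuous_on A (symb \<alpha>)"
  unfolding symb_def[abs_def] by (intro continuous_intros)

lemma cmod_symb_square: "(cmod (symb \<alpha> \<omega>))\<^sup>2 = mi_pow \<omega> (\<lambda>i. 2 * \<alpha> i)"
proof -
  have "cmod (symb \<alpha> \<omega>) = \<bar>mi_pow \<omega> \<alpha>\<bar>"
    by (simp add: symb_def mi_pow_def norm_mult norm_power abs_prod power_abs flip: prod_norm)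
  then show ?thesis by (simp add: mi_pow_double_eq)
qed

lemma symb_Taylor:
  fixes v \<omega> :: "real^'n::finite"
  shows "(\<Sum>\<alpha> | mi_size \<alpha> = p. of_real (mi_pow v \<alpha> / mi_fact \<alpha>) * symb \<alpha> \<omega>) = (\<i> * of_real (\<omega> \<bullet> v)) ^ p / fact p"
proof -
  have "\<i> * of_real (\<omega> \<bullet> v) = (\<Sum>i\<in>UNIV. \<i> * of_real (\<omega> $ i) * of_real (v $ i))"
    by (simp add: inner_vec_def sum_distrib_left mult.assoc)
  then have "(\<i> * of_real (\<omega> \<bullet> v)) ^ p / fact p
     = (\<Sum>\<alpha> | mi_size \<alpha> = p. (\<Prod>i\<in>UNIV. (\<i> * of_real (\<omega> $ i) * of_real (v $ i)) ^ \<alpha> i) / of_real (mi_fact \<alpha>))"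
    by (simp only: multinomial_mi_complex)
  also have "\<dots> = (\<Sum>\<alpha> | mi_size \<alpha> = p. of_real (mi_pow v \<alpha> / mi_fact \<alpha>) * symb \<alpha> \<omega>)"
    by (intro sum.cong refl) (simp add: symb_def mi_pow_def power_mult_distrib prod.distrib)
  finally show ?thesis ..
qed

lemma spectrum_in_symb:
  assumes "spectrum_in S F" "compact S"
  shows "spectrum_in S (dsym \<alpha> F)"
  by (rule spectrum_in_mult[OF assms]) (rule continuous_symb)

text \<open>The homogeneous part of degree \<open>p\<close> of the Taylor series at \<open>u\<close>, evaluated at the increment \<open>v\<close>.\<close>

definition taylor_term :: "(real^'n::finite \<Rightarrow> complex) \<Rightarrow> nat \<Rightarrow> real^'n \<Rightarrow> real^'n \<Rightarrow> complex" where
  "taylor_term F p u v = (\<Sum>\<alpha> | mi_size \<alpha> = p. of_real (mi_pow v \<alpha> / mi_fact \<alpha>) * synth (dsym \<alpha> F) u)"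

text \<open>Up to the factor \<open>fact p\<close> this is the squared Euclidean norm of the tensor of \<open>p\<close>-th derivatives
at \<open>u\<close>.  This normalisation makes both the Cauchy-Schwarz estimate of \<open>taylor_term\<close> and the integral over
the whole space rotation invariant, so that only Euclidean norms enter.\<close>

definition jet_energy :: "(real^'n::finite \<Rightarrow> complex) \<Rightarrow> nat \<Rightarrow> real^'n \<Rightarrow> real" where
  "jet_energy F p u = (\<Sum>\<alpha> | mi_size \<alpha> = p. (cmod (synth (dsym \<alpha> F) u))\<^sup>2 / mi_fact \<alpha>)"

lemma jet_energy_nonneg: "0 \<le> jet_energy F p u"
  unfolding jet_energy_def by (intro sum_nonneg divide_nonneg_pos mi_fact_pos) auto

lemma taylor_term_eq:
  fixes F :: "real^'n::finite \<Rightarrow> complex"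
  assumes F: "spectrum_in S F" and S: "compact S"
  shows "taylor_term F p u v = of_real (1 / (2 * pi) ^ CARD('n)) *
    (LBINT \<omega>. F \<omega> * iexp (\<omega> \<bullet> u) * ((\<i> * of_real (\<omega> \<bullet> v)) ^ p / fact p))"
    and "integrable lborel (\<lambda>\<omega>. F \<omega> * iexp (\<omega> \<bullet> u) * ((\<i> * of_real (\<omega> \<bullet> v)) ^ p / fact p))"
proof -
  have i: "integrable lborel (\<lambda>\<omega>. symb \<alpha> \<omega> * F \<omega> * iexp (\<omega> \<bullet> u))" for \<alpha>
    by (rule integrable_mult_cis) (auto intro: spectrum_in_integrable spectrum_in_symb F S)
  have e: "F \<omega> * iexp (\<omega> \<bullet> u) * ((\<i> * of_real (\<omega> \<bullet> v)) ^ p / fact p)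
     = (\<Sum>\<alpha> | mi_size \<alpha> = p. of_real (mi_pow v \<alpha> / mi_fact \<alpha>) * (symb \<alpha> \<omega> * F \<omega> * iexp (\<omega> \<bullet> u)))" for \<omega>
    unfolding symb_Taylor[symmetric] sum_distrib_left by (intro sum.cong refl) (simp only: mult_ac)
  show "integrable lborel (\<lambda>\<omega>. F \<omega> * iexp (\<omega> \<bullet> u) * ((\<i> * of_real (\<omega> \<bullet> v)) ^ p / fact p))"
    unfolding e by (intro Bochner_Integration.integrable_sum integrable_mult_right i)
  show "taylor_term F p u v = of_real (1 / (2 * pi) ^ CARD('n)) *
    (LBINT \<omega>. F \<omega> * iexp (\<omega> \<bullet> u) * ((\<i> * of_real (\<omega> \<bullet> v)) ^ p / fact p))"
    unfolding e
    by (subst Bochner_Integration.integral_sum, intro integrable_mult_right i,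
        unfold taylor_term_def synth_def sum_distrib_left integral_mult_right_zero)
      (intro sum.cong refl mult.left_commute)
qed

text \<open>The exponential series may be integrated term by term because the frequencies in \<open>S\<close> are bounded.\<close>

lemma taylor_sums:
  fixes F :: "real^'n::finite \<Rightarrow> complex"
  assumes F: "spectrum_in S F" and S: "compact S"
  shows "(\<lambda>p. taylor_term F p u v) sums synth F (u + v)"
proof -
  have iF: "integrable lborel F" by (rule spectrum_in_integrable[OF F S])
  obtain B where B: "B > 0" "\<And>\<omega>. \<omega> \<in> S \<Longrightarrow> norm \<omega> \<le> B"
    using compact_imp_bounded[OF S] by (auto simp: bounded_pos)
  define G where "G p \<omega> = F \<omega> * iexp (\<omega> \<bullet> u) * ((\<i> * of_real (\<omega> \<bullet> v)) ^ p / fact p)" for p \<omega>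
  have Gi: "integrable lborel (G p)" for p
    unfolding G_def[abs_def] by (rule taylor_term_eq[OF F S])
  have Gn: "norm (G p \<omega>) = cmod (F \<omega>) * (\<bar>\<omega> \<bullet> v\<bar> ^ p / fact p)" for p \<omega>
    by (simp add: G_def norm_mult norm_divide norm_power)
  have Gle: "norm (G p \<omega>) \<le> cmod (F \<omega>) * ((B * norm v) ^ p / fact p)" for p \<omega>
  proof (cases "\<omega> \<in> S")
    case True
    have "\<bar>\<omega> \<bullet> v\<bar> \<le> norm \<omega> * norm v" by (rule Cauchy_Schwarz_ineq2)
    also have "\<dots> \<le> B * norm v" using B(2)[OF True] by (intro mult_right_mono) auto
    finally show ?thesis unfolding Gn by (intro mult_left_mono divide_right_mono power_mono) auto
  qed (use spectrum_inD(3)[OF F] in \<open>simp add: Gn\<close>)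
  have sB: "summable (\<lambda>p. (B * norm v) ^ p / fact p)"
    using summable_exp[of "B * norm v"] by (simp add: field_simps)
  have "(\<lambda>p. integral\<^sup>L lborel (G p)) sums (LBINT \<omega>. (\<Sum>p. G p \<omega>))"
  proof (rule sums_integral[OF Gi])
    show "AE \<omega> in lborel. summable (\<lambda>p. norm (G p \<omega>))"
      by (rule AE_I2, rule summable_comparison_test'[where N=0, OF summable_mult[OF sB]]) (use Gle in auto)
    show "summable (\<lambda>p. \<integral>\<omega>. norm (G p \<omega>) \<partial>lborel)"
    proof (rule summable_comparison_test'[where N=0, OF summable_mult[OF sB]])
      fix p
      have "(LBINT \<omega>. norm (G p \<omega>)) \<le> (LBINT \<omega>. cmod (F \<omega>) * ((B * norm v) ^ p / fact p))"
        by (rule integral_mono) (use Gi iF Gle in auto)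
      then show "norm (LBINT \<omega>. norm (G p \<omega>)) \<le> (LBINT \<omega>. cmod (F \<omega>)) * ((B * norm v) ^ p / fact p)"
        by (simp add: integral_nonneg_AE)
    qed
  qed
  moreover have "(\<Sum>p. G p \<omega>) = F \<omega> * iexp (\<omega> \<bullet> (u + v))" for \<omega>
  proof -
    have "(\<lambda>p. (\<i> * of_real (\<omega> \<bullet> v)) ^ p / fact p) sums iexp (\<omega> \<bullet> v)"
      using exp_converges[of "\<i> * of_real (\<omega> \<bullet> v)"] by (simp add: scaleR_conv_of_real field_simps)
    then have "(\<lambda>p. G p \<omega>) sums (F \<omega> * iexp (\<omega> \<bullet> u) * iexp (\<omega> \<bullet> v))"
      unfolding G_def by (rule sums_mult)
    then show ?thesis
      by (simp add: sums_iff inner_add_right distrib_left exp_add mult.assoc)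
  qed
  ultimately have "(\<lambda>p. of_real (1 / (2 * pi) ^ CARD('n)) * integral\<^sup>L lborel (G p)) sums synth F (u + v)"
    unfolding synth_def by (simp only: sums_mult)
  then show ?thesis unfolding taylor_term_eq(1)[OF F S] G_def[abs_def] .
qed

lemma taylor_term_le:
  "(cmod (taylor_term F p u v))\<^sup>2 \<le> norm v ^ (2 * p) / fact p * jet_energy F p u"
proof -
  let ?A = "{\<alpha>. mi_size \<alpha> = p} :: ('a \<Rightarrow> nat) set"
  let ?s = "\<lambda>\<alpha>. cmod (synth (dsym \<alpha> F) u)"
  have "cmod (taylor_term F p u v) \<le> (\<Sum>\<alpha>\<in>?A. \<bar>mi_pow v \<alpha>\<bar> / mi_fact \<alpha> * ?s \<alpha>)"
    unfolding taylor_term_def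
    by (rule order_trans[OF norm_sum], intro sum_mono)
      (simp add: norm_mult norm_divide less_imp_le[OF mi_fact_pos])
  also have "\<dots> = (\<Sum>\<alpha>\<in>?A. (\<bar>mi_pow v \<alpha>\<bar> / sqrt (mi_fact \<alpha>)) * (?s \<alpha> / sqrt (mi_fact \<alpha>)))"
    by (intro sum.cong refl) (simp add: less_imp_le[OF mi_fact_pos])
  finally have "(cmod (taylor_term F p u v))\<^sup>2 \<le> (\<Sum>\<alpha>\<in>?A. (\<bar>mi_pow v \<alpha>\<bar> / sqrt (mi_fact \<alpha>)) * (?s \<alpha> / sqrt (mi_fact \<alpha>)))\<^sup>2"
    by (intro power_mono) auto
  also have "\<dots> \<le> (\<Sum>\<alpha>\<in>?A. (\<bar>mi_pow v \<alpha>\<bar> / sqrt (mi_fact \<alpha>))\<^sup>2) * (\<Sum>\<alpha>\<in>?A. (?s \<alpha> / sqrt (mi_fact \<alpha>))\<^sup>2)"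
    by (rule Cauchy_Schwarz_ineq_sum)
  also have "(\<Sum>\<alpha>\<in>?A. (\<bar>mi_pow v \<alpha>\<bar> / sqrt (mi_fact \<alpha>))\<^sup>2) = norm v ^ (2 * p) / fact p"
    unfolding sum_mi_pow_double[symmetric] mi_pow_double_eq
    by (intro sum.cong refl) (simp add: power_divide less_imp_le[OF mi_fact_pos])
  also have "(\<Sum>\<alpha>\<in>?A. (?s \<alpha> / sqrt (mi_fact \<alpha>))\<^sup>2) = jet_energy F p u"
    unfolding jet_energy_def by (intro sum.cong refl) (simp add: power_divide less_imp_le[OF mi_fact_pos])
  finally show ?thesis .
qed

text \<open>The contribution of the derivatives at one sampling point \<open>u\<close>, before the integration over the cell
that produces the weights.\<close>

definition local_energy :: "nat \<Rightarrow> (real^'n::finite \<Rightarrow> complex) \<Rightarrow> real^'n \<Rightarrow> real^'n \<Rightarrow> real" where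
  "local_energy k F u v = (\<Sum>\<alpha> | mi_size \<alpha> \<le> k. mi_pow v (\<lambda>i. 2 * \<alpha> i) / mi_fact \<alpha> * (cmod (synth (dsym \<alpha> F) u))\<^sup>2)"

lemma local_energy_nonneg: "0 \<le> local_energy k F u v"
  unfolding local_energy_def
  by (intro sum_nonneg mult_nonneg_nonneg divide_nonneg_pos mi_pow_double_nonneg mi_fact_pos) auto

lemma local_energy_le:
  assumes "norm v \<le> r"
  shows "local_energy k F u v \<le> (\<Sum>p\<le>k. r ^ (2 * p) * jet_energy F p u)"
  unfolding local_energy_def sum_mi_size_le jet_energy_def sum_distrib_left
proof (intro sum_mono)
  fix p and \<alpha> :: "'a \<Rightarrow> nat" assume "\<alpha> \<in> {\<alpha>. mi_size \<alpha> = p}"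
  then have "mi_pow v (\<lambda>i. 2 * \<alpha> i) / mi_fact \<alpha> \<le> r ^ (2 * p) / mi_fact \<alpha>"
    using mi_pow_double_le[OF assms, of \<alpha>] mi_fact_pos[of \<alpha>] by (simp add: divide_right_mono)
  from mult_right_mono[OF this zero_le_power2[of "cmod (synth (dsym \<alpha> F) u)"]]
  show "mi_pow v (\<lambda>i. 2 * \<alpha> i) / mi_fact \<alpha> * (cmod (synth (dsym \<alpha> F) u))\<^sup>2
      \<le> r ^ (2 * p) * ((cmod (synth (dsym \<alpha> F) u))\<^sup>2 / mi_fact \<alpha>)"
    by (simp add: mult_ac)
qed

text \<open>Cauchy-Schwarz, with the reciprocal factorials distributed evenly over the two factors.  The sum of all
of them, over multi-indices of arbitrary size, is the exponential of the dimension.\<close>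

lemma taylor_poly_le:
  fixes u v :: "real^'n::finite"
  shows "(cmod (\<Sum>p<Suc k. taylor_term F p u v))\<^sup>2 \<le> exp (real CARD('n)) * local_energy k F u v"
proof -
  let ?A = "{\<alpha>::'n \<Rightarrow> nat. mi_size \<alpha> \<le> k}"
  let ?s = "\<lambda>\<alpha>. synth (dsym \<alpha> F) u"
  have mf: "0 < mi_fact \<alpha>" for \<alpha> :: "'n \<Rightarrow> nat" by (rule mi_fact_pos)
  have "(\<Sum>p<Suc k. taylor_term F p u v) = (\<Sum>\<alpha>\<in>?A. of_real (mi_pow v \<alpha> / mi_fact \<alpha>) * ?s \<alpha>)"
    unfolding taylor_term_def lessThan_Suc_atMost by (rule sum_mi_size_le[symmetric])
  then have "cmod (\<Sum>p<Suc k. taylor_term F p u v) \<le> (\<Sum>\<alpha>\<in>?A. \<bar>mi_pow v \<alpha>\<bar> / mi_fact \<alpha> * cmod (?s \<alpha>))"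
    by (simp only:, intro order_trans[OF norm_sum] sum_mono) (simp add: norm_mult norm_divide less_imp_le[OF mf])
  also have "\<dots> = (\<Sum>\<alpha>\<in>?A. (1 / sqrt (mi_fact \<alpha>)) * (\<bar>mi_pow v \<alpha>\<bar> * cmod (?s \<alpha>) / sqrt (mi_fact \<alpha>)))"
    by (intro sum.cong refl) (simp add: less_imp_le[OF mf])
  finally have "(cmod (\<Sum>p<Suc k. taylor_term F p u v))\<^sup>2 \<le> (\<Sum>\<alpha>\<in>?A. (1 / sqrt (mi_fact \<alpha>)) * (\<bar>mi_pow v \<alpha>\<bar> * cmod (?s \<alpha>) / sqrt (mi_fact \<alpha>)))\<^sup>2"
    by (intro power_mono) auto
  also have "\<dots> \<le> (\<Sum>\<alpha>\<in>?A. (1 / sqrt (mi_fact \<alpha>))\<^sup>2) * (\<Sum>\<alpha>\<in>?A. (\<bar>mi_pow v \<alpha>\<bar> * cmod (?s \<alpha>) / sqrt (mi_fact \<alpha>))\<^sup>2)"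
    by (rule Cauchy_Schwarz_ineq_sum)
  also have "(\<Sum>\<alpha>\<in>?A. (1 / sqrt (mi_fact \<alpha>))\<^sup>2) = (\<Sum>\<alpha>\<in>?A. 1 / mi_fact \<alpha>)"
    by (simp add: power_divide less_imp_le[OF mf])
  also have "(\<Sum>\<alpha>\<in>?A. (\<bar>mi_pow v \<alpha>\<bar> * cmod (?s \<alpha>) / sqrt (mi_fact \<alpha>))\<^sup>2) = local_energy k F u v"
    unfolding local_energy_def by (simp add: power_divide power_mult_distrib mi_pow_double_eq less_imp_le[OF mf])
  also have "(\<Sum>\<alpha>\<in>?A. 1 / mi_fact \<alpha>) * local_energy k F u v \<le> exp (real CARD('n)) * local_energy k F u v"
    by (intro mult_right_mono sum_inverse_mi_fact_le local_energy_nonneg)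
  finally show ?thesis .
qed

text \<open>Cauchy-Schwarz for series with free weights \<open>a\<close>.  It takes the place of the triangle inequality in L2
for infinite sums, since the right-hand side can be integrated term by term.\<close>

lemma weighted_square_sums_le:
  fixes t :: "nat \<Rightarrow> complex" and a e :: "nat \<Rightarrow> real"
  assumes t: "t sums s" and a: "summable a" "\<And>p. 0 < a p" and te: "\<And>p. (cmod (t p))\<^sup>2 \<le> a p * e p"
  shows "ennreal ((cmod s)\<^sup>2) \<le> ennreal (suminf a) * (\<Sum>p. ennreal (e p))"
proof -
  have e0: "0 \<le> e p" for p using te[of p] a(2)[of p] by (meson order_trans zero_le_mult_iff zero_le_power2 not_less)
  have fin: "(cmod (\<Sum>p<n. t p))\<^sup>2 \<le> (\<Sum>p<n. a p) * (\<Sum>p<n. e p)" for n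
  proof -
    have "cmod (\<Sum>p<n. t p) \<le> (\<Sum>p<n. cmod (t p))" by (rule norm_sum)
    also have "\<dots> \<le> (\<Sum>p<n. sqrt (a p) * sqrt (e p))"
      using te by (intro sum_mono) (simp add: real_le_rsqrt flip: real_sqrt_mult)
    finally have "(cmod (\<Sum>p<n. t p))\<^sup>2 \<le> (\<Sum>p<n. sqrt (a p) * sqrt (e p))\<^sup>2" by (intro power_mono) auto
    also have "\<dots> \<le> (\<Sum>p<n. (sqrt (a p))\<^sup>2) * (\<Sum>p<n. (sqrt (e p))\<^sup>2)" by (rule Cauchy_Schwarz_ineq_sum)
    also have "\<dots> = (\<Sum>p<n. a p) * (\<Sum>p<n. e p)" using less_imp_le[OF a(2)] e0 by simp
    finally show ?thesis .
  qed
  have "ennreal ((cmod (\<Sum>p<n. t p))\<^sup>2) \<le> ennreal (suminf a) * (\<Sum>p. ennreal (e p))" for n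
  proof -
    have "ennreal ((cmod (\<Sum>p<n. t p))\<^sup>2) \<le> ennreal (\<Sum>p<n. a p) * ennreal (\<Sum>p<n. e p)"
      using fin[of n] e0 less_imp_le[OF a(2)] by (simp add: ennreal_mult[symmetric] sum_nonneg ennreal_leI)
    also have "ennreal (\<Sum>p<n. e p) = (\<Sum>p<n. ennreal (e p))" using e0 by (simp add: sum_ennreal)
    also have "ennreal (\<Sum>p<n. a p) * (\<Sum>p<n. ennreal (e p)) \<le> ennreal (suminf a) * (\<Sum>p. ennreal (e p))"
    proof (rule mult_mono)
      show "ennreal (\<Sum>p<n. a p) \<le> ennreal (suminf a)"
        using a less_imp_le[OF a(2)] by (intro ennreal_leI sum_le_suminf) auto
      show "(\<Sum>p<n. ennreal (e p)) \<le> (\<Sum>p. ennreal (e p))" by (intro sum_le_suminf) auto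
    qed auto
    finally show ?thesis .
  qed
  then have bound: "\<exists>N. \<forall>n\<ge>N. ennreal ((cmod (\<Sum>p<n. t p))\<^sup>2) \<le> ennreal (suminf a) * (\<Sum>p. ennreal (e p))"
    by blast
  have "(\<lambda>n. ennreal ((cmod (\<Sum>p<n. t p))\<^sup>2)) \<longlonglongrightarrow> ennreal ((cmod s)\<^sup>2)"
    using t unfolding sums_def by (intro tendsto_intros)
  then show ?thesis using bound by (rule LIMSEQ_le_const2)
qed

text \<open>The function \<open>R\<^sub>k\<close> of the theorem is the tail starting at \<open>Suc k\<close>; the tail starting at 0 is \<open>exp\<close>.\<close>

definition exp_tail :: "nat \<Rightarrow> real \<Rightarrow> real" where
  "exp_tail j z = (\<Sum>p. z ^ (p + j) / fact (p + j))"

lemma exp_tail_eq: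
  "summable (\<lambda>p. z ^ (p + j) / fact (p + j) :: real)" "exp_tail j z = exp z - (\<Sum>p<j. z ^ p / fact p)"
  "exp_tail 0 z = exp z"  "exp_tail (Suc k) z = Rk k z"
proof -
  have s: "summable (\<lambda>p. z ^ p / fact p :: real)" using summable_exp[of z] by (simp add: field_simps)
  then show "summable (\<lambda>p. z ^ (p + j) / fact (p + j) :: real)" for j by (subst summable_iff_shift)
  have e: "(\<Sum>p. z ^ p / fact p) = exp z" by (simp add: exp_def field_simps scaleR_conv_of_real)
  show *: "exp_tail j z = exp z - (\<Sum>p<j. z ^ p / fact p)" for j
    using suminf_split_initial_segment[OF s, of j] by (simp add: exp_tail_def e)
  show "exp_tail 0 z = exp z" by (simp add: *)
  show "exp_tail (Suc k) z = Rk k z" by (simp add: * Rk_def lessThan_Suc_atMost)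
qed

text \<open>The weights \<open>(r * m) ^ p / fact p\<close> are proportional to the L2 norms that the terms of degree \<open>p\<close> can have when all
frequencies are bounded by \<open>m\<close>, so that after integration the Cauchy-Schwarz estimate is as good as the triangle inequality.  The
bound depends on the increment \<open>v\<close> only through \<open>r\<close>.\<close>

lemma taylor_remainder_le:
  assumes F: "spectrum_in S F" and S: "compact S" and v: "norm v \<le> r" and r: "0 < r" and m: "0 < m"
  shows "ennreal ((cmod (synth F (u + v) - (\<Sum>p<j. taylor_term F p u v)))\<^sup>2)
    \<le> ennreal (exp_tail j (r * m)) * (\<Sum>p. ennreal ((r / m) ^ (p + j) * jet_energy F (p + j) u))"
  unfolding exp_tail_def
proof (rule weighted_square_sums_le)
  show "(\<lambda>p. taylor_term F (p + j) u v) sums (synth F (u + v) - (\<Sum>p<j. taylor_term F p u v))"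
    using taylor_sums[OF F S] by (rule sums_split_initial_segment)
  show "summable (\<lambda>p. (r * m) ^ (p + j) / fact (p + j))" by (rule exp_tail_eq(1))
  show "0 < (r * m) ^ (p + j) / fact (p + j)" for p using r m by simp
  fix p
  let ?q = "p + j"
  have "(cmod (taylor_term F ?q u v))\<^sup>2 \<le> norm v ^ (2 * ?q) / fact ?q * jet_energy F ?q u"
    by (rule taylor_term_le)
  also have "\<dots> \<le> r ^ (2 * ?q) / fact ?q * jet_energy F ?q u"
    using v by (intro mult_right_mono divide_right_mono power_mono jet_energy_nonneg) auto
  also have "r ^ (2 * ?q) = (r * m) ^ ?q * (r / m) ^ ?q"
    using m unfolding power_mult power_mult_distrib[symmetric] by (simp add: power2_eq_square)
  finally show "(cmod (taylor_term F ?q u v))\<^sup>2 \<le> (r * m) ^ ?q / fact ?q * ((r / m) ^ ?q * jet_energy F ?q u)"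
    by simp
qed

lemma jet_energy_measurable:
  assumes F: "spectrum_in S F" and S: "compact S"
  shows "jet_energy F p \<in> borel_measurable borel"
proof -
  have [measurable]: "synth (dsym \<alpha> F) \<in> borel_measurable borel" for \<alpha>
    by (rule synth_measurable, rule spectrum_inD(1), rule spectrum_in_symb[OF F S])
  show ?thesis unfolding jet_energy_def[abs_def] by measurable
qed

text \<open>By Plancherel both sides are integrals of the squared spectrum, and the multinomial theorem sums the squared
symbols to \<open>norm \<omega> ^ (2 * p) / fact p\<close>.\<close>

lemma sum_symb_energy_le:
  fixes F :: "real^'n::finite \<Rightarrow> complex"
  assumes F: "spectrum_in S F" and S: "compact S" and m: "\<And>\<omega>. \<omega> \<in> S \<Longrightarrow> norm \<omega> \<le> m"
  shows "(\<Sum>\<alpha> | mi_size \<alpha> = p. (sqnorm (synth (dsym \<alpha> F))) / mi_fact \<alpha>)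
     \<le> m ^ (2 * p) / fact p * (sqnorm (synth F))"
proof -
  let ?c = "1 / (2 * pi) ^ CARD('n) :: real"
  have s: "spectrum_in S (dsym \<alpha> F)" for \<alpha> by (rule spectrum_in_symb[OF F S])
  note i = spectrum_inD(2)[OF s] spectrum_inD(2)[OF F]
  have "(\<Sum>\<alpha> | mi_size \<alpha> = p. (sqnorm (synth (dsym \<alpha> F))) / mi_fact \<alpha>)
     = ?c * (LBINT \<omega>. (\<Sum>\<alpha> | mi_size \<alpha> = p. (cmod (symb \<alpha> \<omega> * F \<omega>))\<^sup>2 / mi_fact \<alpha>))"
    using i by (subst Bochner_Integration.integral_sum)
      (auto simp: synth_Plancherel(2)[OF s S] sum_distrib_left)
  also have "\<dots> \<le> ?c * (LBINT \<omega>. m ^ (2 * p) / fact p * (cmod (F \<omega>))\<^sup>2)"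
  proof (intro mult_left_mono integral_mono)
    fix \<omega>
    have "(\<Sum>\<alpha> | mi_size \<alpha> = p. (cmod (symb \<alpha> \<omega> * F \<omega>))\<^sup>2 / mi_fact \<alpha>) = (\<Sum>\<alpha> | mi_size \<alpha> = p. mi_pow \<omega> (\<lambda>i. 2 * \<alpha> i) / mi_fact \<alpha>) * (cmod (F \<omega>))\<^sup>2"
      by (simp add: norm_mult power_mult_distrib cmod_symb_square sum_distrib_right)
    also have "\<dots> = norm \<omega> ^ (2 * p) / fact p * (cmod (F \<omega>))\<^sup>2" by (simp only: sum_mi_pow_double)
    also have "\<dots> \<le> m ^ (2 * p) / fact p * (cmod (F \<omega>))\<^sup>2"
    proof (cases "\<omega> \<in> S")
      case True
      then show ?thesis using m[OF True] by (intro mult_right_mono divide_right_mono power_mono) auto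
    qed (use spectrum_inD(3)[OF F] in simp)
    finally show "(\<Sum>\<alpha> | mi_size \<alpha> = p. (cmod (symb \<alpha> \<omega> * F \<omega>))\<^sup>2 / mi_fact \<alpha>) \<le> m ^ (2 * p) / fact p * (cmod (F \<omega>))\<^sup>2" .
  qed (use i in auto)
  also have "\<dots> = m ^ (2 * p) / fact p * (sqnorm (synth F))"
    unfolding synth_Plancherel(2)[OF F S] by simp
  finally show ?thesis .
qed

lemma nn_integral_jet_energy_le:
  assumes F: "spectrum_in S F" and S: "compact S" and m: "\<And>\<omega>. \<omega> \<in> S \<Longrightarrow> norm \<omega> \<le> m"
  shows "(\<integral>\<^sup>+x. ennreal (jet_energy F p x) \<partial>lborel)
     \<le> ennreal (m ^ (2 * p) / fact p * (sqnorm (synth F)))"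
proof -
  have i: "integrable lborel (\<lambda>x. (cmod (synth (dsym \<alpha> F) x))\<^sup>2 / mi_fact \<alpha>)" for \<alpha>
    using synth_Plancherel(1)[OF spectrum_in_symb[OF F S] S] by simp
  have j: "integrable lborel (jet_energy F p)"
    unfolding jet_energy_def[abs_def] by (intro Bochner_Integration.integrable_sum i)
  have "(\<integral>\<^sup>+x. ennreal (jet_energy F p x) \<partial>lborel) = ennreal (integral\<^sup>L lborel (jet_energy F p))"
    by (rule nn_integral_eq_integral[OF j]) (simp add: jet_energy_nonneg)
  also have "integral\<^sup>L lborel (jet_energy F p) = (\<Sum>\<alpha> | mi_size \<alpha> = p. (sqnorm (synth (dsym \<alpha> F))) / mi_fact \<alpha>)"
    unfolding jet_energy_def[abs_def] using i by (subst Bochner_Integration.integral_sum) auto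
  finally show ?thesis using sum_symb_energy_le[OF F S m, of p] by (simp add: ennreal_leI)
qed

section \<open>Derivatives and shifted kernels\<close>

text \<open>The error is the integral of the second-order remainder of the complex exponential, which is at most
\<open>(norm \<omega> * norm (y - x))\<^sup>2\<close>, against the integrable spectrum.\<close>

lemma synth_has_derivative:
  fixes F :: "real^'n::finite \<Rightarrow> complex"
  assumes F: "spectrum_in S F" and S: "compact S"
  shows "(synth F has_derivative (\<lambda>h. \<Sum>i\<in>UNIV. (h $ i) *\<^sub>R synth (\<lambda>\<omega>. \<i> * of_real (\<omega> $ i) * F \<omega>) x)) (at x)"
proof -
  let ?c = "1 / (2 * pi) ^ CARD('n) :: real"
  let ?D = "\<lambda>h. \<Sum>i\<in>UNIV. (h $ i) *\<^sub>R synth (\<lambda>\<omega>. \<i> * of_real (\<omega> $ i) * F \<omega>) x"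
  have iF: "integrable lborel F" by (rule spectrum_in_integrable[OF F S])
  obtain B where B: "B > 0" "\<And>\<omega>. \<omega> \<in> S \<Longrightarrow> norm \<omega> \<le> B"
    using compact_imp_bounded[OF S] by (auto simp: bounded_pos)
  define e where "e y \<omega> = iexp (\<omega> \<bullet> y)" for y \<omega> :: "real^'n"
  have ie: "integrable lborel (\<lambda>\<omega>. F \<omega> * e y \<omega>)" for y
    unfolding e_def by (rule integrable_mult_cis[OF iF]) simp
  have iFi: "integrable lborel (\<lambda>\<omega>. \<i> * of_real (\<omega> $ i) * F \<omega>)" for i
    by (rule spectrum_in_integrable[OF spectrum_in_mult[OF F S] S]) (intro continuous_intros)
  have iei: "integrable lborel (\<lambda>\<omega>. \<i> * of_real (\<omega> $ i) * F \<omega> * e x \<omega>)" for i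
    unfolding e_def by (rule integrable_mult_cis[OF iFi]) simp
  have lin: "F \<omega> * e x \<omega> * (\<i> * of_real (\<omega> \<bullet> h)) = (\<Sum>i\<in>UNIV. of_real (h $ i) * (\<i> * of_real (\<omega> $ i) * F \<omega> * e x \<omega>))" for \<omega> h
    by (simp add: inner_vec_def sum_distrib_left mult_ac)
  have il: "integrable lborel (\<lambda>\<omega>. F \<omega> * e x \<omega> * (\<i> * of_real (\<omega> \<bullet> h)))" for h
    unfolding lin by (intro Bochner_Integration.integrable_sum integrable_mult_right iei)
  have D: "?D h = of_real ?c * (LBINT \<omega>. F \<omega> * e x \<omega> * (\<i> * of_real (\<omega> \<bullet> h)))" for h
    unfolding lin
    by (subst Bochner_Integration.integral_sum, intro integrable_mult_right iei,
        unfold synth_def e_def sum_distrib_left integral_mult_right_zero scaleR_conv_of_real)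
      (intro sum.cong refl mult.left_commute)
  have s: "synth F y = of_real ?c * (LBINT \<omega>. F \<omega> * e y \<omega>)" for y
    unfolding synth_def e_def ..
  let ?K = "?c * ((LBINT \<omega>. cmod (F \<omega>)) * B\<^sup>2)"
  have le: "norm (synth F y - synth F x - ?D (y - x)) \<le> ?K * (norm (y - x))\<^sup>2" for y
  proof -
    let ?R = "\<lambda>\<omega>. F \<omega> * e y \<omega> - F \<omega> * e x \<omega> - F \<omega> * e x \<omega> * (\<i> * of_real (\<omega> \<bullet> (y - x)))"
    have R: "synth F y - synth F x - ?D (y - x) = of_real ?c * (LBINT \<omega>. ?R \<omega>)"
      unfolding s D using ie il by (simp add: right_diff_distrib)
    have Rle: "norm (?R \<omega>) \<le> cmod (F \<omega>) * (B\<^sup>2 * (norm (y - x))\<^sup>2)" for \<omega>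
    proof (cases "\<omega> \<in> S")
      case True
      let ?t = "\<omega> \<bullet> (y - x)"
      have "?R \<omega> = F \<omega> * e x \<omega> * (iexp ?t - (\<Sum>k\<le>1. (\<i> * of_real ?t) ^ k / fact k))"
        by (simp add: e_def inner_diff_right exp_diff algebra_simps exp_minus_inverse)
      then have "norm (?R \<omega>) = cmod (F \<omega>) * cmod (iexp ?t - (\<Sum>k\<le>1. (\<i> * of_real ?t) ^ k / fact k))"
        by (simp only: norm_mult e_def) simp
      also have "\<dots> \<le> cmod (F \<omega>) * (\<bar>?t\<bar> ^ Suc 1 / fact (Suc 1))"
        by (intro mult_left_mono iexp_approx1) auto
      also have "\<dots> \<le> cmod (F \<omega>) * (B * norm (y - x)) ^ 2"
      proof -
        have "\<bar>?t\<bar> \<le> norm \<omega> * norm (y - x)" by (rule Cauchy_Schwarz_ineq2)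
        also have "\<dots> \<le> B * norm (y - x)" using B(2)[OF True] by (intro mult_right_mono) auto
        finally have "\<bar>?t\<bar> ^ 2 \<le> (B * norm (y - x)) ^ 2" by (intro power_mono) auto
        moreover have "\<bar>?t\<bar> ^ Suc 1 / fact (Suc 1) \<le> \<bar>?t\<bar> ^ 2" by (simp add: power2_eq_square)
        ultimately show ?thesis by (intro mult_left_mono) auto
      qed
      finally show ?thesis by (simp add: power_mult_distrib)
    qed (use spectrum_inD(3)[OF F] in simp)
    have "norm (synth F y - synth F x - ?D (y - x)) = ?c * norm (LBINT \<omega>. ?R \<omega>)"
      unfolding R by (simp add: norm_mult norm_divide norm_power)
    also have "\<dots> \<le> ?c * (LBINT \<omega>. cmod (F \<omega>) * (B\<^sup>2 * (norm (y - x))\<^sup>2))"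
    proof (rule mult_left_mono)
      have "integrable lborel ?R" by (intro Bochner_Integration.integrable_diff ie il)
      then show "norm (LBINT \<omega>. ?R \<omega>) \<le> (LBINT \<omega>. cmod (F \<omega>) * (B\<^sup>2 * (norm (y - x))\<^sup>2))"
        by (intro order_trans[OF integral_norm_bound] integral_mono integrable_norm) (use iF Rle in auto)
    qed simp
    also have "\<dots> = ?K * (norm (y - x))\<^sup>2" by simp
    finally show ?thesis .
  qed
  show ?thesis
  proof (rule has_derivativeI_sandwich[where e=1 and H="\<lambda>y. ?K * norm (y - x)"])
    show "bounded_linear ?D"
      by (intro bounded_linear_sum bounded_linear_scaleR_const bounded_linear_vec_nth)
    show "norm (synth F y - synth F x - ?D (y - x)) / norm (y - x) \<le> ?K * norm (y - x)" if "y \<noteq> x" for y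
      using le[of y] that by (simp add: divide_le_eq power2_eq_square mult.assoc)
    have "((\<lambda>y. ?K * norm (y - x)) \<longlongrightarrow> ?K * norm (x - x)) (at x)"
      by (intro tendsto_intros)
    then show "((\<lambda>y. ?K * norm (y - x)) \<longlongrightarrow> 0) (at x)" by simp
  qed simp
qed

lemma partial_synth:
  assumes F: "spectrum_in S F" and S: "compact S"
  shows "partial i (synth F) = synth (\<lambda>\<omega>. \<i> * of_real (\<omega> $ i) * F \<omega>)"
proof
  fix x
  have "((\<lambda>t. synth F (x + t *\<^sub>R axis i 1)) has_derivative
     (\<lambda>h. \<Sum>j\<in>UNIV. ((h *\<^sub>R axis i 1) $ j) *\<^sub>R synth (\<lambda>\<omega>. \<i> * of_real (\<omega> $ j) * F \<omega>) x)) (at 0)"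
  proof (rule has_derivative_compose[where f="\<lambda>t. x + t *\<^sub>R axis i 1" and f'="\<lambda>h. h *\<^sub>R axis i 1"])
    show "((\<lambda>t. x + t *\<^sub>R axis i 1) has_derivative (\<lambda>h. h *\<^sub>R axis i 1)) (at 0)"
      by (auto intro!: derivative_eq_intros)
    show "(synth F has_derivative (\<lambda>h. \<Sum>j\<in>UNIV. (h $ j) *\<^sub>R synth (\<lambda>\<omega>. \<i> * of_real (\<omega> $ j) * F \<omega>) x)) (at (x + 0 *\<^sub>R axis i 1))"
      using synth_has_derivative[OF F S, of x] by simp
  qed
  also have "(\<lambda>h. \<Sum>j\<in>UNIV. ((h *\<^sub>R axis i 1) $ j) *\<^sub>R synth (\<lambda>\<omega>. \<i> * of_real (\<omega> $ j) * F \<omega>) x)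
     = (\<lambda>h. h *\<^sub>R synth (\<lambda>\<omega>. \<i> * of_real (\<omega> $ i) * F \<omega>) x)"
    by (auto simp: axis_def fun_eq_iff if_distrib if_distribR cong: if_cong)
  finally show "partial i (synth F) x = synth (\<lambda>\<omega>. \<i> * of_real (\<omega> $ i) * F \<omega>) x"
    unfolding partial_def by (intro vector_derivative_at) (simp add: has_vector_derivative_def)
qed

lemma foldr_partial_synth:
  fixes F :: "real^'n::finite \<Rightarrow> complex"
  assumes F: "spectrum_in S F" and S: "compact S"
  shows "foldr partial is (synth F) = synth (\<lambda>\<omega>. symb (count_list is) \<omega> * F \<omega>)"
proof (induction "is")
  case Nil
  then show ?case by (simp add: symb_def)
next
  case (Cons j js)
  have "symb (count_list (j # js)) \<omega> = \<i> * of_real (\<omega> $ j) * symb (count_list js) \<omega>" for \<omega> :: "real^'n"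
  proof -
    have "symb (count_list (j # js)) \<omega> = (\<Prod>i\<in>UNIV. (if i = j then \<i> * of_real (\<omega> $ i) else 1) * (\<i> * of_real (\<omega> $ i)) ^ count_list js i)"
      unfolding symb_def by (intro prod.cong) auto
    then show ?thesis unfolding symb_def by (simp add: prod.distrib)
  qed
  then show ?case
    by (simp only: foldr.simps comp_def Cons.IH partial_synth[OF spectrum_in_symb[OF F S] S] mult.assoc)
qed

lemma smooth_synth:
  assumes F: "spectrum_in S F" and S: "compact S"
  shows "smooth (synth F)"
  unfolding smooth_def foldr_partial_synth[OF F S]
  using synth_has_derivative[OF spectrum_in_symb[OF F S] S] by (auto simp: differentiable_def)

lemma mi_deriv_synth:
  assumes F: "spectrum_in S F" and S: "compact S"
  shows "mi_deriv \<alpha> (synth F) = synth (dsym \<alpha> F)"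
proof -
  \<comment> \<open>The choice in the definition of \<open>mi_deriv\<close> succeeds: a multiset with multiplicities \<open>\<alpha>\<close> can be enumerated.\<close>
  have "\<exists>is. \<forall>i. count_list is i = \<alpha> i"
  proof -
    obtain xs where "mset xs = Abs_multiset \<alpha>" using ex_mset by blast
    then have "count (mset xs) = \<alpha>" by (simp add: count_Abs_multiset)
    then show ?thesis by (auto simp: count_mset fun_eq_iff)
  qed
  then have "\<forall>i. count_list (SOME is. \<forall>i. count_list is i = \<alpha> i) i = \<alpha> i" by (rule someI_ex)
  then have "count_list (SOME is. \<forall>i. count_list is i = \<alpha> i) = \<alpha>" by auto
  then show ?thesis unfolding mi_deriv_def foldr_partial_synth[OF F S] by simp
qed

lemma continuous_AE_eq_imp_eq:
  fixes g h :: "'a::euclidean_space \<Rightarrow> 'b::real_normed_vector"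
  assumes "continuous_on UNIV g" "continuous_on UNIV h" and ae: "AE x in lborel. g x = h x"
  shows "g = h"
proof (rule ccontr)
  assume "g \<noteq> h"
  then obtain x where x: "g x \<noteq> h x" by auto
  have o: "open {x. g x \<noteq> h x}" by (rule open_Collect_neq) fact+
  then have "{x. g x \<noteq> h x} \<in> null_sets lborel"
    using ae by (subst (asm) AE_iff_null) auto
  then have "negligible {x. g x \<noteq> h x}"
    unfolding negligible_iff_null_sets by (rule null_sets_completionI)
  then show False using open_not_negligible[OF o] x by auto
qed

text \<open>Two smooth representatives are continuous and agree almost everywhere, hence everywhere.\<close>

lemma smooth_rep_eq:
  fixes f g :: "real^'n::finite \<Rightarrow> complex"
  assumes g: "smooth g" and ae: "AE x in lborel. f x = g x"
  shows "smooth_rep f = g"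
  unfolding smooth_rep_def
proof (rule the_equality)
  show "smooth g \<and> (AE x in lborel. f x = g x)" using assms by simp
  fix h assume h: "smooth h \<and> (AE x in lborel. f x = h x)"
  have c: "continuous_on UNIV u" if "smooth u" for u :: "real^'n \<Rightarrow> complex"
  proof -
    have "\<forall>x. foldr partial [] u differentiable (at x)" using that unfolding smooth_def by blast
    then show ?thesis by (auto intro!: continuous_at_imp_continuous_on differentiable_imp_continuous_within)
  qed
  have "AE x in lborel. h x = g x" using h ae by auto
  then show "h = g" using h g by (intro continuous_AE_eq_imp_eq c) auto
qed

lemma spectrum_in_indicator:
  fixes S :: "(real^'n::finite) set"
  assumes "compact S"
  shows "spectrum_in S (indicator S)"
proof -
  have [measurable]: "S \<in> sets borel" using assms by (rule borel_compact)
  have "(\<lambda>\<omega>. (cmod (indicator S \<omega>))\<^sup>2) = (indicator S :: _ \<Rightarrow> real)" by (auto simp: indicator_def)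
  then show ?thesis
    using emeasure_compact_finite[OF assms] by (simp add: spectrum_in_def)
qed

lemma \<Phi>_eq_synth: "\<Phi> S = synth (indicator S)"
  unfolding \<Phi>_def synth_def set_lebesgue_integral_def
  by (intro ext arg_cong2[where f="(*)"] refl Bochner_Integration.integral_cong) (simp add: indicator_def)

lemma synth_diff: "synth F (y - a) = synth (\<lambda>\<omega>. iexp (- (\<omega> \<bullet> a)) * F \<omega>) y"
proof -
  have "F \<omega> * iexp (\<omega> \<bullet> (y - a)) = iexp (- (\<omega> \<bullet> a)) * F \<omega> * iexp (\<omega> \<bullet> y)" for \<omega>
    by (simp add: inner_diff_right right_diff_distrib exp_diff exp_minus field_simps)
  then show ?thesis by (simp only: synth_def)
qed

lemma cnj_symb: "cnj (symb \<alpha> \<omega>) = (- 1) ^ mi_size \<alpha> * symb \<alpha> \<omega>"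
proof -
  have "cnj (symb \<alpha> \<omega>) = (\<Prod>i\<in>UNIV. (- 1) ^ \<alpha> i * (\<i> * of_real (\<omega> $ i)) ^ \<alpha> i)"
    unfolding symb_def cnj_prod by (intro prod.cong refl) (simp add: power_mult_distrib[symmetric])
  then show ?thesis by (simp add: symb_def prod.distrib mi_size_def power_sum)
qed

text \<open>The shifted derivative of the kernel has spectrum \<open>exp (- \<i> \<omega> \<bullet> a) * symb \<alpha> \<omega>\<close> on \<open>S\<close>.  By Plancherel its inner product
with \<open>f\<close> is the derivative of \<open>f\<close> at \<open>a\<close> up to a sign, because the symbol is real or purely imaginary.\<close>

lemma shifted_kernel_bandlimited:
  fixes S :: "(real^'n::finite) set"
  assumes S: "compact S"
  shows "(\<lambda>y. of_real s * mi_deriv \<alpha> (\<Phi> S) (y - a)) \<in> bandlimited S"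
    and "\<lbrakk>spectrum_in S F; f \<in> borel_measurable borel; AE x in lborel. f x = synth F x\<rbrakk> \<Longrightarrow>
      (cmod (L2_inner f (\<lambda>y. of_real s * mi_deriv \<alpha> (\<Phi> S) (y - a))))\<^sup>2 = s\<^sup>2 * (cmod (synth (dsym \<alpha> F) a))\<^sup>2"
proof -
  let ?c = "1 / (2 * pi) ^ CARD('n) :: real"
  define p where "p \<omega> = of_real s * (iexp (- (\<omega> \<bullet> a)) * symb \<alpha> \<omega>)" for \<omega>
  define G where "G \<omega> = p \<omega> * indicator S \<omega>" for \<omega>
  have "continuous_on UNIV p" unfolding p_def by (intro continuous_intros)
  then have G: "spectrum_in S G"
    unfolding G_def[abs_def] by (intro spectrum_in_mult spectrum_in_indicator S)
  have \<phi>: "(\<lambda>y. of_real s * mi_deriv \<alpha> (\<Phi> S) (y - a)) = synth G"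
  proof
    fix y
    have "mi_deriv \<alpha> (\<Phi> S) (y - a) = synth (\<lambda>\<omega>. iexp (- (\<omega> \<bullet> a)) * (symb \<alpha> \<omega> * indicator S \<omega>)) y"
      unfolding \<Phi>_eq_synth mi_deriv_synth[OF spectrum_in_indicator[OF S] S] synth_diff ..
    then show "of_real s * mi_deriv \<alpha> (\<Phi> S) (y - a) = synth G y"
      unfolding synth_def G_def p_def by (simp add: mult_ac flip: integral_mult_right_zero)
  qed
  show "(\<lambda>y. of_real s * mi_deriv \<alpha> (\<Phi> S) (y - a)) \<in> bandlimited S"
    unfolding \<phi> by (rule synth_bandlimited[OF G S])
  assume F: "spectrum_in S F" and fm: "f \<in> borel_measurable borel" and f: "AE x in lborel. f x = synth F x"
  have pw: "F \<omega> * cnj (G \<omega>) = (of_real s * (- 1) ^ mi_size \<alpha>) * (symb \<alpha> \<omega> * F \<omega> * iexp (\<omega> \<bullet> a))" for \<omega>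
  proof (cases "\<omega> \<in> S")
    case True
    then show ?thesis by (simp add: G_def p_def cnj_symb exp_cnj mult_ac)
  qed (simp add: spectrum_inD(3)[OF F])
  have eq: "(LBINT x. f x * cnj (synth G x)) = (LBINT x. synth F x * cnj (synth G x))"
  proof -
    note [measurable] = fm spectrum_inD(1)[OF F] spectrum_inD(1)[OF G]
    show ?thesis by (rule integral_cong_AE) (use f in \<open>auto elim: eventually_mono\<close>)
  qed
  have "L2_inner f (synth G) = of_real ?c * (LBINT \<omega>. F \<omega> * cnj (G \<omega>))"
    unfolding L2_inner_def eq by (rule synth_inner[OF F G S])
  also have "\<dots> = (of_real s * (- 1) ^ mi_size \<alpha>) * synth (dsym \<alpha> F) a"
    by (simp only: pw synth_def integral_mult_right_zero mult.left_commute[of "of_real ?c"])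
  finally show "(cmod (L2_inner f (\<lambda>y. of_real s * mi_deriv \<alpha> (\<Phi> S) (y - a))))\<^sup>2 = s\<^sup>2 * (cmod (synth (dsym \<alpha> F) a))\<^sup>2"
    unfolding \<phi> by (simp add: norm_mult norm_power power_mult_distrib)
qed

section \<open>Voronoi cells and sampling inequalities\<close>

context
  fixes N :: "real^'n::finite \<Rightarrow> real"
  assumes N: "is_norm N"
begin

lemma is_normD:
  "0 \<le> N x" "N x = 0 \<longleftrightarrow> x = 0" "N (c *\<^sub>R x) = \<bar>c\<bar> * N x" "N (x + y) \<le> N x + N y" "N (- x) = N x" "N (x - y) = N (y - x)"
proof -
  show *: "0 \<le> N x" "N x = 0 \<longleftrightarrow> x = 0" "N (c *\<^sub>R x) = \<bar>c\<bar> * N x" "N (x + y) \<le> N x + N y" for x y c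
    using N unfolding is_norm_def by blast+
  show m: "N (- x) = N x" for x using *(3)[of "-1" x] by simp
  show "N (x - y) = N (y - x)" using m[of "x - y"] by simp
qed

lemma norm_le_const_mult: "N x \<le> (\<Sum>i\<in>UNIV. N (axis i 1)) * norm x"
proof -
  have "N (\<Sum>i\<in>A. (x $ i) *\<^sub>R axis i 1) \<le> (\<Sum>i\<in>A. \<bar>x $ i\<bar> * N (axis i 1))" if "finite A" for A
    using that
  proof induction
    case (insert i A)
    then show ?case using is_normD(4)[of "(x $ i) *\<^sub>R axis i 1" "\<Sum>i\<in>A. (x $ i) *\<^sub>R axis i 1"] by (simp add: is_normD(3))
  qed (use is_normD(2)[of 0] in simp)
  from this[of UNIV] have "N (\<Sum>i\<in>UNIV. (x $ i) *\<^sub>R axis i 1) \<le> (\<Sum>i\<in>UNIV. \<bar>x $ i\<bar> * N (axis i 1))" by simp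
  also have "(\<Sum>i\<in>UNIV. (x $ i) *\<^sub>R axis i 1) = x"
    by (simp add: vec_eq_iff axis_def if_distrib cong: if_cong)
  also have "(\<Sum>i\<in>UNIV. \<bar>x $ i\<bar> * N (axis i 1)) \<le> (\<Sum>i\<in>UNIV. norm x * N (axis i 1))"
    by (intro sum_mono mult_right_mono component_le_norm_cart is_normD)
  finally show ?thesis by (simp add: sum_distrib_left mult.commute)
qed

lemma continuous_on_is_norm: "continuous_on A N"
proof (rule lipschitz_on_continuous_on)
  have "\<bar>N x - N y\<bar> \<le> (\<Sum>i\<in>UNIV. N (axis i 1)) * norm (x - y)" for x y
  proof -
    have "N x \<le> N (x - y) + N y" "N y \<le> N (y - x) + N x"
      using is_normD(4)[of "x - y" y] is_normD(4)[of "y - x" x] by simp_all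
    then have "\<bar>N x - N y\<bar> \<le> N (x - y)" using is_normD(6)[of x y] by linarith
    then show ?thesis using norm_le_const_mult[of "x - y"] by linarith
  qed
  then show "(\<Sum>i\<in>UNIV. N (axis i 1))-lipschitz_on A N"
    by (auto simp: lipschitz_on_def dist_norm intro!: sum_nonneg is_normD)
qed

lemma is_norm_measurable [measurable]: "N \<in> borel_measurable borel"
  by (rule borel_measurable_continuous_onI[OF continuous_on_is_norm])

text \<open>The least constant exists because the quotient of the two norms attains its maximum on the Euclidean
unit sphere.\<close>

lemma b_const_props: "0 < b_const N" "norm x \<le> b_const N * N x"
proof -
  have pos: "0 < N x" if "x \<noteq> 0" for x using is_normD(1,2)[of x] that by linarith
  have "continuous_on (sphere 0 1) (\<lambda>x. 1 / N x)"
    by (intro continuous_intros continuous_on_is_norm) (auto simp: is_normD(2))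
  moreover have "sphere (0::real^'n) 1 \<noteq> {}" by simp
  ultimately obtain x0 where x0: "x0 \<in> sphere 0 1" "\<And>x. x \<in> sphere 0 1 \<Longrightarrow> 1 / N x \<le> 1 / N x0"
    using continuous_attains_sup[OF compact_sphere] by blast
  have x0': "0 < N x0" "norm x0 = 1"
  proof -
    show "norm x0 = 1" using x0(1) by simp
    then show "0 < N x0" by (intro pos) auto
  qed
  let ?b = "1 / N x0"
  have le: "norm x \<le> ?b * N x" for x
  proof (cases "x = 0")
    case False
    have "1 / N ((1 / norm x) *\<^sub>R x) \<le> ?b" using False by (intro x0(2)) simp
    then show ?thesis using pos[OF False] False x0' by (simp add: is_normD(3) field_simps)
  qed (simp add: is_normD)
  have "b_const N = ?b"
    unfolding b_const_def
  proof (rule Least_equality)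
    fix b assume "0 < b \<and> (\<forall>x. norm x \<le> b * N x)"
    then have "norm x0 \<le> b * N x0" by blast
    then show "?b \<le> b" using x0' by (simp add: field_simps)
  qed (use le x0' in auto)
  then show "0 < b_const N" "norm x \<le> b_const N * N x" using le x0' by auto
qed

lemma emeasure_norm_ball:
  assumes r: "0 < r"
  shows "emeasure lborel {u. N (u - a) \<le> r} = ennreal (r ^ CARD('n) * measure lborel {u. N u \<le> 1})"
    and "0 < measure lborel {u. N u \<le> 1}"
proof -
  let ?b = "b_const N"
  have sub: "{u. N u \<le> r} \<subseteq> cball 0 (?b * r)" for r
  proof
    fix u assume "u \<in> {u. N u \<le> r}"
    then have "?b * N u \<le> ?b * r" using b_const_props(1) by simp
    then show "u \<in> cball 0 (?b * r)" using b_const_props(2)[of u] by simp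
  qed
  have [measurable]: "{u. N u \<le> r} \<in> sets borel" for r by measurable
  have fin: "emeasure lborel {u. N u \<le> r} < \<infinity>" for r
  proof -
    have "emeasure lborel {u. N u \<le> r} \<le> emeasure lborel (cball (0::real^'n) (?b * r))"
      by (rule emeasure_mono[OF sub]) simp
    also have "\<dots> < \<infinity>" by (rule emeasure_compact_finite) simp
    finally show ?thesis .
  qed
  have meas: "measure lborel {u. N u \<le> r} = r ^ CARD('n) * measure lborel {u. N u \<le> 1}"
  proof -
    have "integral\<^sup>L lborel (indicator {u. N u \<le> r} :: _ \<Rightarrow> real) = \<bar>r\<bar> ^ CARD('n) *\<^sub>R integral\<^sup>L lborel (\<lambda>u. indicator {u. N u \<le> r} (r *\<^sub>R u))"
      using r lborel_integral_scale(1)[of "indicator {u. N u \<le> r} :: _ \<Rightarrow> real" r] by simp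
    also have "(\<lambda>u. indicator {u. N u \<le> r} (r *\<^sub>R u)) = (indicator {u. N u \<le> 1} :: _ \<Rightarrow> real)"
      using r by (auto simp: fun_eq_iff indicator_def is_normD(3))
    finally show ?thesis using r by simp
  qed
  have "emeasure lborel {u. N (u - a) \<le> r} = (\<integral>\<^sup>+u. indicator {u. N u \<le> r} (u + (- a)) \<partial>lborel)"
  proof -
    have "(\<lambda>u. indicator {u. N u \<le> r} (u + (- a))) = (indicator {u. N (u - a) \<le> r} :: _ \<Rightarrow> ennreal)"
      by (auto simp: indicator_def)
    then show ?thesis by simp
  qed
  also have "\<dots> = emeasure lborel {u. N u \<le> r}"
    by (subst lborel_nn_integral_shift) auto
  also have "\<dots> = ennreal (r ^ CARD('n) * measure lborel {u. N u \<le> 1})"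
    unfolding meas[symmetric] using fin[of r] by (intro emeasure_eq_ennreal_measure) auto
  finally show "emeasure lborel {u. N (u - a) \<le> r} = ennreal (r ^ CARD('n) * measure lborel {u. N u \<le> 1})" .
  have o: "open {u. N u < 1}" by (intro open_Collect_less continuous_on_is_norm continuous_on_const)
  have "emeasure lborel {u. N u < 1} \<noteq> 0"
  proof
    assume "emeasure lborel {u. N u < 1} = 0"
    then have "{u. N u < 1} \<in> null_sets lborel" using o by (intro null_setsI) auto
    then have "negligible {u. N u < 1}" unfolding negligible_iff_null_sets by (rule null_sets_completionI)
    moreover have "0 \<in> {u. N u < 1}" using is_normD(2)[of 0] by simp
    ultimately show False using open_not_negligible[OF o] by blast
  qed
  moreover have "emeasure lborel {u. N u < 1} \<le> emeasure lborel {u. N u \<le> 1}" by (rule emeasure_mono) auto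
  ultimately have "emeasure lborel {u. N u \<le> 1} \<noteq> 0" by auto
  then show "0 < measure lborel {u. N u \<le> 1}"
    using fin[of 1] by (simp add: measure_def enn2real_positive_iff less_top zero_less_iff_neq_zero)
qed

end

text \<open>A maximal function for bandlimited functions: \<open>G u\<close> dominates the squared modulus of the synthesised function
on the whole ball around \<open>u\<close>, yet its integral is only a constant times the squared norm.  It is the
Taylor estimate at \<open>u\<close> without any terms removed.\<close>

lemma band_majorant:
  assumes F: "spectrum_in S F" and S: "compact S" and m: "\<And>\<omega>. \<omega> \<in> S \<Longrightarrow> norm \<omega> \<le> m" "0 < m" and r: "0 < r"
  obtains G where "G \<in> borel_measurable borel"
    and "\<And>u w. norm (w - u) \<le> r \<Longrightarrow> ennreal ((cmod (synth F w))\<^sup>2) \<le> G u"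
    and "integral\<^sup>N lborel G \<le> ennreal (exp (2 * (r * m)) * (sqnorm (synth F)))"
proof
  let ?Q = "\<integral>x. (cmod (synth F x))\<^sup>2 \<partial>lborel"
  let ?G = "\<lambda>u. ennreal (exp (r * m)) * (\<Sum>p. ennreal ((r / m) ^ p * jet_energy F p u))"
  have [measurable]: "jet_energy F p \<in> borel_measurable borel" for p by (rule jet_energy_measurable[OF F S])
  show "?G \<in> borel_measurable borel" by measurable
  show "ennreal ((cmod (synth F w))\<^sup>2) \<le> ?G u" if "norm (w - u) \<le> r" for u w
    using taylor_remainder_le[OF F S that r m(2), of u 0] by (simp add: exp_tail_eq)
  have Q: "0 \<le> ?Q" by (simp add: integral_nonneg_AE)
  have "integral\<^sup>N lborel ?G = ennreal (exp (r * m)) * (\<Sum>p. \<integral>\<^sup>+u. ennreal ((r / m) ^ p * jet_energy F p u) \<partial>lborel)"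
    by (simp add: nn_integral_cmult nn_integral_suminf)
  also have "\<dots> \<le> ennreal (exp (r * m)) * (\<Sum>p. ennreal ((r * m) ^ p / fact p * ?Q))"
  proof (intro mult_left_mono suminf_le)
    fix p
    have "(\<integral>\<^sup>+u. ennreal ((r / m) ^ p * jet_energy F p u) \<partial>lborel) = ennreal ((r / m) ^ p) * (\<integral>\<^sup>+u. ennreal (jet_energy F p u) \<partial>lborel)"
      using r m(2) by (simp add: ennreal_mult jet_energy_nonneg nn_integral_cmult)
    also have "\<dots> \<le> ennreal ((r / m) ^ p) * ennreal (m ^ (2 * p) / fact p * ?Q)"
      by (intro mult_left_mono nn_integral_jet_energy_le[OF F S m(1)]) auto
    also have "\<dots> = ennreal ((r / m) ^ p * (m ^ (2 * p) / fact p * ?Q))"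
      using r m(2) by (intro ennreal_mult'[symmetric]) simp
    also have "(r / m) ^ p * (m ^ (2 * p) / fact p * ?Q) = (r * m) ^ p / fact p * ?Q"
      using m(2) by (simp add: power_mult power_divide power_mult_distrib power2_eq_square field_simps)
    finally show "(\<integral>\<^sup>+u. ennreal ((r / m) ^ p * jet_energy F p u) \<partial>lborel) \<le> ennreal ((r * m) ^ p / fact p * ?Q)" .
  qed auto
  also have "(\<Sum>p. ennreal ((r * m) ^ p / fact p * ?Q)) = ennreal (exp (r * m) * ?Q)"
  proof (rule suminf_ennreal_eq)
    show "0 \<le> (r * m) ^ p / fact p * ?Q" for p using r m(2) Q by simp
    have "(\<lambda>p. (r * m) ^ p / fact p) sums exp (r * m)"
      using exp_converges[of "r * m"] by (simp add: field_simps)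
    then show "(\<lambda>p. (r * m) ^ p / fact p * ?Q) sums (exp (r * m) * ?Q)" by (rule sums_mult2)
  qed
  also have "ennreal (exp (r * m)) * ennreal (exp (r * m) * ?Q) = ennreal (exp (2 * (r * m)) * ?Q)"
    using Q by (simp add: ennreal_mult[symmetric] mult.assoc[symmetric] exp_add[symmetric])
  finally show "integral\<^sup>N lborel ?G \<le> ennreal (exp (2 * (r * m)) * ?Q)" .
qed

text \<open>The sampling points, with finite density; a real number represents the extended-valued density.\<close>

locale voronoi_sampling =
  fixes N :: "real^'n::finite \<Rightarrow> real" and x :: "'i \<Rightarrow> real^'n" and I :: "'i set" and \<delta> :: real
  assumes N: "is_norm N" and countable_I: "countable I"
    and tiling: "AE y in lborel. \<exists>!n. n \<in> I \<and> y \<in> voronoi N x I n"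
    and density: "sampling_density N x I = ennreal \<delta>" and \<delta>_nonneg: "0 \<le> \<delta>"
begin

abbreviation "cell \<equiv> voronoi N x I"

lemma cell_measurable [measurable]: "cell n \<in> sets borel"
proof -
  have "cell n = (\<Inter>m\<in>I - {n}. {y. N (y - x n) \<le> N (y - x m)})"
    by (auto simp: voronoi_def)
  also have "closed \<dots>"
    by (intro closed_INT ballI closed_Collect_le continuous_on_compose2[OF continuous_on_is_norm[OF N, of UNIV]] continuous_intros) auto
  finally show ?thesis by (rule borel_closed)
qed

text \<open>Within its own cell a sampling point is nearest, so its distance is the infimum bounded by the density.\<close>

lemma cell_radius:
  assumes "n \<in> I" "y \<in> cell n"
  shows "N (y - x n) \<le> \<delta>" "norm (y - x n) \<le> b_const N * \<delta>"
proof -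
  have "ennreal (N (y - x n)) \<le> (INF m\<in>I. ennreal (N (y - x m)))"
    using assms(2) by (intro INF_greatest ennreal_leI) (auto simp: voronoi_def)
  also have "\<dots> \<le> ennreal \<delta>"
    unfolding density[symmetric] sampling_density_def by (rule SUP_upper) simp
  finally show *: "N (y - x n) \<le> \<delta>" using \<delta>_nonneg by (simp add: ennreal_le_iff)
  have "norm (y - x n) \<le> b_const N * N (y - x n)" by (rule b_const_props[OF N])
  also have "\<dots> \<le> b_const N * \<delta>" using * b_const_props(1)[OF N] by (intro mult_left_mono) auto
  finally show "norm (y - x n) \<le> b_const N * \<delta>" .
qed

lemma cell_finite:
  assumes "n \<in> I"
  shows "emeasure lborel (cell n) < \<infinity>"
proof -
  have "cell n \<subseteq> cball (x n) (b_const N * \<delta>)"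
    using cell_radius(2)[OF assms] by (auto simp: dist_norm norm_minus_commute)
  then have "emeasure lborel (cell n) \<le> emeasure lborel (cball (x n) (b_const N * \<delta>))"
    by (rule emeasure_mono) simp
  also have "\<dots> < \<infinity>" by (rule emeasure_compact_finite) simp
  finally show ?thesis .
qed

lemma tiling_nn_integral:
  assumes [measurable]: "h \<in> borel_measurable borel"
  shows "(\<integral>\<^sup>+n. (\<integral>\<^sup>+y. indicator (cell n) y * h y \<partial>lborel) \<partial>count_space I) = integral\<^sup>N lborel h"
proof -
  have "(\<integral>\<^sup>+n. (\<integral>\<^sup>+y. indicator (cell n) y * h y \<partial>lborel) \<partial>count_space I)
      = (\<integral>\<^sup>+y. (\<integral>\<^sup>+n. indicator (cell n) y * h y \<partial>count_space I) \<partial>lborel)"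
    by (rule nn_integral_count_space_nn_integral[symmetric, OF countable_I]) measurable
  also have "\<dots> = integral\<^sup>N lborel h"
  proof (rule nn_integral_cong_AE)
    show "AE y in lborel. (\<integral>\<^sup>+n. indicator (cell n) y * h y \<partial>count_space I) = h y"
      using tiling
    proof eventually_elim
      case (elim y)
      then obtain n where n: "n \<in> I" "y \<in> cell n" and u: "\<And>k. k \<in> I \<Longrightarrow> y \<in> cell k \<Longrightarrow> k = n" by metis
      have z: "indicator (cell k) y * h y = 0" if "k \<in> I" "k \<notin> {n}" for k
        using u[OF that(1)] that(2) by (cases "y \<in> cell k") auto
      have "(\<integral>\<^sup>+n. indicator (cell n) y * h y \<partial>count_space I) = (\<Sum>n\<in>{n}. indicator (cell n) y * h y)"
        by (rule nn_integral_count_space'[OF _ z]) (use n in auto)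
      then show ?case using n by simp
    qed
  qed
  finally show ?thesis .
qed

text \<open>With density 0 every cell would be contained in the countable set of sampling points.\<close>

lemma density_pos: "0 < \<delta>"
proof (rule ccontr)
  assume "\<not> 0 < \<delta>"
  then have 0: "\<delta> = 0" using \<delta>_nonneg by simp
  have "y = x n" if "n \<in> I" "y \<in> cell n" for n y
    using cell_radius(1)[OF that] is_normD(1,2)[OF N, of "y - x n"] 0 by simp
  then have sub: "y \<in> x ` I" if "n \<in> I" "y \<in> cell n" for n y using that by blast
  have "AE y in lborel. y \<notin> x ` I"
    by (rule AE_not_in, rule countable_imp_null_set_lborel) (simp add: countable_I)
  with tiling have "AE y in (lborel :: (real^'n) measure). False"
  proof eventually_elim
    case (elim y)
    then show False using sub by blast
  qed
  then have "ae_filter (lborel :: (real^'n) measure) = bot" by (simp add: eventually_False)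
  then show False by (simp add: ae_filter_eq_bot_iff)
qed

text \<open>The integral of the step function with value \<open>c n\<close> on the cell of the \<open>n\<close>-th point.\<close>

definition sampled :: "('i \<Rightarrow> ennreal) \<Rightarrow> ennreal" where
  "sampled c = (\<integral>\<^sup>+n. emeasure lborel (cell n) * c n \<partial>count_space I)"

lemma sampled_cmult: "sampled (\<lambda>n. a * c n) = a * sampled c"
  unfolding sampled_def by (simp add: mult.left_commute nn_integral_cmult)

lemma sampled_eq_cells: "sampled c = (\<integral>\<^sup>+n. (\<integral>\<^sup>+y. indicator (cell n) y * c n \<partial>lborel) \<partial>count_space I)"
  unfolding sampled_def by (simp add: nn_integral_multc)

lemma sampled_sum: "sampled (\<lambda>n. \<Sum>a\<in>A. c a n) = (\<Sum>a\<in>A. sampled (c a))"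
  unfolding sampled_def by (simp add: sum_distrib_left nn_integral_sum)

lemma sampled_suminf: "sampled (\<lambda>n. \<Sum>p. c p n) = (\<Sum>p. sampled (c p))"
  unfolding sampled_def ennreal_suminf_cmult[symmetric] by (subst nn_integral_suminf) auto

end

locale bandlimited_sampling = voronoi_sampling N x I \<delta>
  for N :: "real^'n::finite \<Rightarrow> real" and x :: "'i \<Rightarrow> real^'n" and I :: "'i set" and \<delta> :: real +
  fixes S :: "(real^'n) set" and m :: real
  assumes S: "compact S" and m: "\<And>\<omega>. \<omega> \<in> S \<Longrightarrow> norm \<omega> \<le> m" and m_pos: "0 < m"
begin

definition energy :: "(real^'n \<Rightarrow> complex) \<Rightarrow> real" where
  "energy F = (sqnorm (synth F))"

definition radius :: real where "radius = b_const N * \<delta>"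

text \<open>The product of bandwidth, norm constant and density on which all bounds depend.\<close>

definition zeta :: real where "zeta = m * b_const N * \<delta>"

lemma radius_pos: "0 < radius"
  using density_pos b_const_props(1)[OF N] by (simp add: radius_def)

lemma zeta_eq: "zeta = radius * m" "0 < zeta"
proof -
  show "zeta = radius * m" by (simp add: zeta_def radius_def)
  then show "0 < zeta" using radius_pos m_pos by simp
qed

lemma energy_nonneg: "0 \<le> energy F"
  by (simp add: energy_def integral_nonneg_AE)

text \<open>Holds if sampling on the cells is bounded by \<open>M\<close> as a map between L2 norms.  Two values of \<open>M\<close> are provided,
and they give the two functions \<open>h\<^sub>k\<close> and \<open>g\<^sub>k\<^sub>d\<close> when multiplied by \<open>R\<^sub>k\<close>.\<close>

definition sampling_const :: "real \<Rightarrow> bool" where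
  "sampling_const M \<longleftrightarrow> 0 \<le> M \<and> (\<forall>F. spectrum_in S F \<longrightarrow>
     sampled (\<lambda>n. ennreal ((cmod (synth F (x n)))\<^sup>2)) \<le> ennreal (M\<^sup>2 * energy F))"

text \<open>Each point of a cell is so close to the sampling point that the majorant there already dominates the
sample.\<close>

lemma sampling_const_exp: "sampling_const (exp zeta)"
  unfolding sampling_const_def
proof (intro conjI allI impI)
  fix F assume F: "spectrum_in S F"
  obtain G where [measurable]: "G \<in> borel_measurable borel"
    and G: "\<And>u w. norm (w - u) \<le> radius \<Longrightarrow> ennreal ((cmod (synth F w))\<^sup>2) \<le> G u"
    and GI: "integral\<^sup>N lborel G \<le> ennreal (exp (2 * (radius * m)) * energy F)"
    unfolding energy_def using band_majorant[OF F S m m_pos radius_pos] by blast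
  have "sampled (\<lambda>n. ennreal ((cmod (synth F (x n)))\<^sup>2))
    \<le> (\<integral>\<^sup>+n. (\<integral>\<^sup>+y. indicator (cell n) y * G y \<partial>lborel) \<partial>count_space I)"
    unfolding sampled_eq_cells
  proof (intro nn_integral_mono)
    fix n y assume n: "n \<in> space (count_space I)"
    show "indicator (cell n) y * ennreal ((cmod (synth F (x n)))\<^sup>2) \<le> indicator (cell n) y * G y"
    proof (cases "y \<in> cell n")
      case True
      then have "norm (x n - y) \<le> radius"
        using cell_radius(2)[of n y] n by (simp add: radius_def norm_minus_commute)
      then show ?thesis by (intro mult_left_mono G) auto
    qed simp
  qed
  also have "\<dots> \<le> ennreal (exp (2 * (radius * m)) * energy F)"
    using GI by (simp add: tiling_nn_integral)
  also have "exp (2 * (radius * m)) = (exp zeta)\<^sup>2"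
    by (simp add: zeta_eq(1) power2_eq_square exp_add[symmetric])
  finally show "sampled (\<lambda>n. ennreal ((cmod (synth F (x n)))\<^sup>2)) \<le> ennreal ((exp zeta)\<^sup>2 * energy F)" .
qed simp

text \<open>The sample is dominated by the average of a majorant over a ball of radius \<open>r\<close> around the sampling
point.  Summed over the cells, each point \<open>u\<close> is counted with at most the volume of the ball of radius
\<open>r + \<delta>\<close>.  The price is the volume ratio \<open>(1 + \<delta> / r) ^ d\<close>; in return the exponent of the majorant
involves the free radius \<open>r\<close> instead of \<open>\<delta>\<close>.\<close>

lemma sampling_const_average:
  assumes \<sigma>: "0 < \<sigma>"
  shows "sampling_const ((1 + 2 * \<sigma>) powr (real CARD('n) / 2) * exp (zeta / \<sigma>))"
  unfolding sampling_const_def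
proof (intro conjI allI impI)
  fix F assume F: "spectrum_in S F"
  let ?d = "CARD('n)"
  let ?c = "\<lambda>n. ennreal ((cmod (synth F (x n)))\<^sup>2)"
  define K where "K = measure lborel {u. N u \<le> 1}"
  \<comment> \<open>This radius turns the volume ratio into the power of \<open>1 + 2 * \<sigma>\<close>.\<close>
  define r where "r = \<delta> / (2 * \<sigma>)"
  have r: "0 < r" using density_pos \<sigma> by (simp add: r_def)
  have br: "0 < b_const N * r" using r b_const_props(1)[OF N] by simp
  have K: "0 < K" unfolding K_def using emeasure_norm_ball(2)[OF N r] .
  have ball: "emeasure lborel {u. N (u - a) \<le> s} = ennreal (s ^ ?d * K)" if "0 < s" for a s
    unfolding K_def by (rule emeasure_norm_ball(1)[OF N that])
  note [measurable] = is_norm_measurable[OF N]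
  obtain G where [measurable]: "G \<in> borel_measurable borel"
    and G: "\<And>u w. norm (w - u) \<le> b_const N * r \<Longrightarrow> ennreal ((cmod (synth F w))\<^sup>2) \<le> G u"
    and GI: "integral\<^sup>N lborel G \<le> ennreal (exp (2 * (b_const N * r * m)) * energy F)"
    unfolding energy_def using band_majorant[OF F S m m_pos br] by blast
  define H where "H y = (\<integral>\<^sup>+u. indicator {u. N (u - y) \<le> r + \<delta>} u * G u \<partial>lborel)" for y
  have [measurable]: "(\<lambda>(y, u). indicator {u. N (u - y) \<le> r + \<delta>} u * G u) \<in> borel_measurable (lborel \<Otimes>\<^sub>M lborel)"
  proof -
    have "(\<lambda>(y, u). indicator {u. N (u - y) \<le> r + \<delta>} u * G u) = (\<lambda>p. indicator {p \<in> space (lborel \<Otimes>\<^sub>M lborel). N (snd p - fst p) \<le> r + \<delta>} p * G (snd p))"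
      by (auto simp: fun_eq_iff indicator_def space_pair_measure)
    also have "\<dots> \<in> borel_measurable (lborel \<Otimes>\<^sub>M lborel)" by measurable
    finally show ?thesis .
  qed
  have Hm[measurable]: "H \<in> borel_measurable borel"
    unfolding H_def[abs_def] by (rule lborel.borel_measurable_nn_integral[where N=borel, simplified]) measurable
  have step: "ennreal (r ^ ?d * K) * ?c n \<le> H y" if "n \<in> I" "y \<in> cell n" for n y
  proof -
    have "ennreal (r ^ ?d * K) * ?c n = (\<integral>\<^sup>+u. indicator {u. N (u - x n) \<le> r} u * ?c n \<partial>lborel)"
      by (simp add: nn_integral_multc ball[OF r])
    also have "\<dots> \<le> H y"
      unfolding H_def
    proof (rule nn_integral_mono)
      fix u
      show "indicator {u. N (u - x n) \<le> r} u * ?c n \<le> indicator {u. N (u - y) \<le> r + \<delta>} u * G u"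
      proof (cases "N (u - x n) \<le> r")
        case True
        have "N (u - y) \<le> N (u - x n) + N (x n - y)"
          using is_normD(4)[OF N, of "u - x n" "x n - y"] by simp
        then have "N (u - y) \<le> r + \<delta>"
          using True cell_radius(1)[OF that] is_normD(6)[OF N, of "x n" y] by simp
        moreover have "norm (x n - u) \<le> b_const N * r"
        proof -
          have "norm (x n - u) \<le> b_const N * N (x n - u)" by (rule b_const_props(2)[OF N])
          also have "\<dots> \<le> b_const N * r"
            using True is_normD(6)[OF N, of "x n" u] b_const_props(1)[OF N] by (intro mult_left_mono) auto
          finally show ?thesis .
        qed
        ultimately show ?thesis using True G[of "x n" u] by simp
      qed simp
    qed
    finally show ?thesis .
  qed
  have "ennreal (r ^ ?d * K) * sampled ?c = sampled (\<lambda>n. ennreal (r ^ ?d * K) * ?c n)"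
    by (rule sampled_cmult[symmetric])
  also have "\<dots> \<le> (\<integral>\<^sup>+n. (\<integral>\<^sup>+y. indicator (cell n) y * H y \<partial>lborel) \<partial>count_space I)"
    unfolding sampled_eq_cells
  proof (intro nn_integral_mono)
    fix n y assume "n \<in> space (count_space I)"
    then show "indicator (cell n) y * (ennreal (r ^ ?d * K) * ?c n) \<le> indicator (cell n) y * H y"
      using step[of n y] by (cases "y \<in> cell n") auto
  qed
  also have "\<dots> = integral\<^sup>N lborel H" by (rule tiling_nn_integral[OF Hm])
  also have "\<dots> = (\<integral>\<^sup>+u. (\<integral>\<^sup>+y. indicator {u. N (u - y) \<le> r + \<delta>} u * G u \<partial>lborel) \<partial>lborel)"
    unfolding H_def by (rule lborel_pair.Fubini') measurable
  also have "\<dots> = (\<integral>\<^sup>+u. ennreal ((r + \<delta>) ^ ?d * K) * G u \<partial>lborel)"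
  proof (intro nn_integral_cong)
    fix u
    have "(\<integral>\<^sup>+y. indicator {u. N (u - y) \<le> r + \<delta>} u * G u \<partial>lborel) = (\<integral>\<^sup>+y. indicator {y. N (y - u) \<le> r + \<delta>} y * G u \<partial>lborel)"
      by (intro nn_integral_cong) (simp add: indicator_def is_normD(6)[OF N, of u])
    also have "\<dots> = ennreal ((r + \<delta>) ^ ?d * K) * G u"
      using ball[of "r + \<delta>" u] r density_pos by (simp add: nn_integral_multc)
    finally show "(\<integral>\<^sup>+y. indicator {u. N (u - y) \<le> r + \<delta>} u * G u \<partial>lborel) = ennreal ((r + \<delta>) ^ ?d * K) * G u" .
  qed
  also have "\<dots> = ennreal ((r + \<delta>) ^ ?d * K) * integral\<^sup>N lborel G" by (simp add: nn_integral_cmult)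
  also have "\<dots> \<le> ennreal ((r + \<delta>) ^ ?d * K) * ennreal (exp (2 * (b_const N * r * m)) * energy F)"
    by (intro mult_left_mono GI) simp
  finally have "ennreal (1 / (r ^ ?d * K)) * (ennreal (r ^ ?d * K) * sampled ?c)
     \<le> ennreal (1 / (r ^ ?d * K)) * (ennreal ((r + \<delta>) ^ ?d * K) * ennreal (exp (2 * (b_const N * r * m)) * energy F))"
    by (rule mult_left_mono) simp
  also have "ennreal (1 / (r ^ ?d * K)) * (ennreal (r ^ ?d * K) * sampled ?c) = sampled ?c"
    using r K by (simp add: mult.assoc[symmetric] ennreal_mult[symmetric])
  also have "ennreal (1 / (r ^ ?d * K)) * (ennreal ((r + \<delta>) ^ ?d * K) * ennreal (exp (2 * (b_const N * r * m)) * energy F))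
    = ennreal (1 / (r ^ ?d * K) * ((r + \<delta>) ^ ?d * K * (exp (2 * (b_const N * r * m)) * energy F)))"
  proof -
    have "0 \<le> 1 / (r ^ ?d * K)" "0 \<le> (r + \<delta>) ^ ?d * K" using r K density_pos by simp_all
    then show ?thesis by (simp only: ennreal_mult')
  qed
  also have "\<dots> \<le> ennreal (((1 + 2 * \<sigma>) powr (real ?d / 2) * exp (zeta / \<sigma>))\<^sup>2 * energy F)"
  proof (rule ennreal_leI)
    have "2 * (b_const N * r * m) = zeta / \<sigma>" by (simp add: r_def zeta_def)
    moreover have "1 / (r ^ ?d * K) * ((r + \<delta>) ^ ?d * K) = (1 + 2 * \<sigma>) ^ ?d"
    proof -
      have "r + \<delta> = (1 + 2 * \<sigma>) * r" using \<sigma> by (simp add: r_def field_simps)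
      then show ?thesis using r K by (simp add: power_mult_distrib)
    qed
    ultimately have "1 / (r ^ ?d * K) * ((r + \<delta>) ^ ?d * K * (exp (2 * (b_const N * r * m)) * energy F))
       = (1 + 2 * \<sigma>) ^ ?d * exp (zeta / \<sigma>) * energy F"
      by (simp only: mult.assoc[symmetric])
    also have "\<dots> \<le> (1 + 2 * \<sigma>) ^ ?d * (exp (zeta / \<sigma>))\<^sup>2 * energy F"
      using \<sigma> zeta_eq(2) energy_nonneg by (intro mult_right_mono mult_left_mono) (auto simp: power2_eq_square)
    also have "(1 + 2 * \<sigma>) ^ ?d = ((1 + 2 * \<sigma>) powr (real ?d / 2))\<^sup>2"
    proof -
      have "((1 + 2 * \<sigma>) powr (real ?d / 2))\<^sup>2 = (1 + 2 * \<sigma>) powr (real ?d)"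
        by (simp add: power2_eq_square flip: powr_add)
      also have "\<dots> = (1 + 2 * \<sigma>) ^ ?d" using \<sigma> by (intro powr_realpow) simp
      finally show ?thesis ..
    qed
    finally show "1 / (r ^ ?d * K) * ((r + \<delta>) ^ ?d * K * (exp (2 * (b_const N * r * m)) * energy F))
       \<le> ((1 + 2 * \<sigma>) powr (real ?d / 2) * exp (zeta / \<sigma>))\<^sup>2 * energy F"
      by (simp add: power_mult_distrib)
  qed
  finally show "sampled ?c \<le> ennreal (((1 + 2 * \<sigma>) powr (real ?d / 2) * exp (zeta / \<sigma>))\<^sup>2 * energy F)" .
qed simp

lemma sampled_jet_energy_le:
  assumes M: "sampling_const M" and F: "spectrum_in S F"
  shows "sampled (\<lambda>n. ennreal (jet_energy F p (x n))) \<le> ennreal (M\<^sup>2 * (m ^ (2 * p) / fact p * energy F))"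
proof -
  let ?A = "{\<alpha>::'n \<Rightarrow> nat. mi_size \<alpha> = p}"
  let ?F = "\<lambda>\<alpha> \<omega>. symb \<alpha> \<omega> * F \<omega>"
  have e: "ennreal (jet_energy F p u) = (\<Sum>\<alpha>\<in>?A. ennreal (1 / mi_fact \<alpha>) * ennreal ((cmod (synth (?F \<alpha>) u))\<^sup>2))" for u
    unfolding jet_energy_def
    by (subst sum_ennreal[symmetric])
      (auto simp: ennreal_mult'[symmetric] less_imp_le[OF mi_fact_pos])
  have "sampled (\<lambda>n. ennreal (jet_energy F p (x n)))
    = (\<Sum>\<alpha>\<in>?A. ennreal (1 / mi_fact \<alpha>) * sampled (\<lambda>n. ennreal ((cmod (synth (?F \<alpha>) (x n)))\<^sup>2)))"
    unfolding e by (simp only: sampled_sum sampled_cmult)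
  also have "\<dots> \<le> (\<Sum>\<alpha>\<in>?A. ennreal (1 / mi_fact \<alpha>) * ennreal (M\<^sup>2 * energy (?F \<alpha>)))"
    using M spectrum_in_symb[OF F S] by (intro sum_mono mult_left_mono) (auto simp: sampling_const_def)
  also have "\<dots> = ennreal (\<Sum>\<alpha>\<in>?A. 1 / mi_fact \<alpha> * (M\<^sup>2 * energy (?F \<alpha>)))"
    by (subst sum_ennreal[symmetric])
      (auto simp: ennreal_mult'[symmetric] less_imp_le[OF mi_fact_pos] energy_nonneg)
  also have "\<dots> \<le> ennreal (M\<^sup>2 * (m ^ (2 * p) / fact p * energy F))"
  proof (rule ennreal_leI)
    have "(\<Sum>\<alpha>\<in>?A. 1 / mi_fact \<alpha> * (M\<^sup>2 * energy (?F \<alpha>))) = M\<^sup>2 * (\<Sum>\<alpha>\<in>?A. energy (?F \<alpha>) / mi_fact \<alpha>)"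
      by (simp add: sum_distrib_left)
    also have "\<dots> \<le> M\<^sup>2 * (m ^ (2 * p) / fact p * energy F)"
      unfolding energy_def using sum_symb_energy_le[OF F S m, of p] by (intro mult_left_mono) auto
    finally show "(\<Sum>\<alpha>\<in>?A. 1 / mi_fact \<alpha> * (M\<^sup>2 * energy (?F \<alpha>))) \<le> M\<^sup>2 * (m ^ (2 * p) / fact p * energy F)" .
  qed
  finally show ?thesis .
qed

end

section \<open>Bounds for the weighted sum of samples\<close>

lemma weight_nonneg: "0 \<le> weight N x I n \<alpha>"
  unfolding weight_def set_lebesgue_integral_def
  by (intro mult_nonneg_nonneg integral_nonneg_AE AE_I2)
    (auto simp: less_imp_le[OF mi_fact_pos] mi_pow_double_nonneg)

context bandlimited_sampling
begin

lemma mi_pow_measurable [measurable]: "(\<lambda>y. mi_pow (y - a) \<alpha>) \<in> borel_measurable (borel :: (real^'n) measure)"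
  unfolding mi_pow_def by (intro borel_measurable_continuous_onI continuous_intros)

lemma weight_eq_nn_integral:
  assumes n: "n \<in> I"
  shows "ennreal (weight N x I n \<alpha>) = (\<integral>\<^sup>+y. indicator (cell n) y * ennreal (mi_pow (y - x n) (\<lambda>i. 2 * \<alpha> i) / mi_fact \<alpha>) \<partial>lborel)"
proof -
  let ?g = "\<lambda>y. indicator (cell n) y * (mi_pow (y - x n) (\<lambda>i. 2 * \<alpha> i) / mi_fact \<alpha>)"
  have g0: "0 \<le> ?g y" for y
    using mi_pow_double_nonneg mi_fact_pos[of \<alpha>] by (auto simp: indicator_def intro!: divide_nonneg_pos)
  have int: "integrable lborel ?g"
  proof (rule Bochner_Integration.integrable_bound)
    show "integrable lborel (\<lambda>y. radius ^ (2 * mi_size \<alpha>) / mi_fact \<alpha> * indicator (cell n) y)"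
      using cell_finite[OF n] by simp
    show "AE y in lborel. norm (?g y) \<le> norm (radius ^ (2 * mi_size \<alpha>) / mi_fact \<alpha> * indicator (cell n) y)"
    proof (rule AE_I2)
      fix y
      show "norm (?g y) \<le> norm (radius ^ (2 * mi_size \<alpha>) / mi_fact \<alpha> * indicator (cell n) y)"
      proof (cases "y \<in> cell n")
        case True
        have "mi_pow (y - x n) (\<lambda>i. 2 * \<alpha> i) \<le> radius ^ (2 * mi_size \<alpha>)"
          using cell_radius(2)[OF n True] by (intro mi_pow_double_le) (simp add: radius_def)
        then have "mi_pow (y - x n) (\<lambda>i. 2 * \<alpha> i) / mi_fact \<alpha> \<le> radius ^ (2 * mi_size \<alpha>) / mi_fact \<alpha>"
          using mi_fact_pos[of \<alpha>] by (intro divide_right_mono) auto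
        then show ?thesis using True mi_pow_double_nonneg[of "y - x n" \<alpha>] mi_fact_pos[of \<alpha>] radius_pos by simp
      qed simp
    qed
  qed measurable
  have "weight N x I n \<alpha> = 1 / mi_fact \<alpha> * (LBINT y. indicator (cell n) y * mi_pow (y - x n) (\<lambda>i. 2 * \<alpha> i))"
    by (simp add: weight_def set_lebesgue_integral_def)
  also have "\<dots> = integral\<^sup>L lborel ?g"
    by (subst integral_mult_right_zero[symmetric]) (intro Bochner_Integration.integral_cong refl, simp)
  finally have w: "weight N x I n \<alpha> = integral\<^sup>L lborel ?g" .
  have "ennreal (integral\<^sup>L lborel ?g) = (\<integral>\<^sup>+y. ennreal (?g y) \<partial>lborel)"
    using int g0 by (intro nn_integral_eq_integral[symmetric]) auto
  also have "\<dots> = (\<integral>\<^sup>+y. indicator (cell n) y * ennreal (mi_pow (y - x n) (\<lambda>i. 2 * \<alpha> i) / mi_fact \<alpha>) \<partial>lborel)"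
    by (intro nn_integral_cong) (simp add: indicator_def)
  finally show "ennreal (weight N x I n \<alpha>) = (\<integral>\<^sup>+y. indicator (cell n) y * ennreal (mi_pow (y - x n) (\<lambda>i. 2 * \<alpha> i) / mi_fact \<alpha>) \<partial>lborel)"
    unfolding w .
qed

definition sample_sum :: "nat \<Rightarrow> (real^'n \<Rightarrow> complex) \<Rightarrow> 'i \<Rightarrow> real" where
  "sample_sum k F n = (\<Sum>\<alpha> | mi_size \<alpha> \<le> k. weight N x I n \<alpha> * (cmod (synth (dsym \<alpha> F) (x n)))\<^sup>2)"

text \<open>The weights are the integrals of the divided monomials in \<open>local_energy\<close> over the cell.\<close>

lemma cell_integral_sample_sum:
  assumes n: "n \<in> I"
  shows "(\<integral>\<^sup>+y. indicator (cell n) y * ennreal (local_energy k F (x n) (y - x n)) \<partial>lborel) = ennreal (sample_sum k F n)"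
proof -
  let ?A = "{\<alpha>::'n \<Rightarrow> nat. mi_size \<alpha> \<le> k}"
  let ?s = "\<lambda>\<alpha>. (cmod (synth (dsym \<alpha> F) (x n)))\<^sup>2"
  let ?q = "\<lambda>\<alpha> y. mi_pow (y - x n) (\<lambda>i. 2 * \<alpha> i) / mi_fact \<alpha>"
  have "indicator (cell n) y * ennreal (local_energy k F (x n) (y - x n)) = (\<Sum>\<alpha>\<in>?A. (indicator (cell n) y * ennreal (?q \<alpha> y)) * ennreal (?s \<alpha>))" for y
  proof -
    have "ennreal (local_energy k F (x n) (y - x n)) = (\<Sum>\<alpha>\<in>?A. ennreal (?q \<alpha> y * ?s \<alpha>))"
      unfolding local_energy_def
      by (intro sum_ennreal[symmetric] mult_nonneg_nonneg divide_nonneg_pos mi_pow_double_nonneg mi_fact_pos) auto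
    also have "\<dots> = (\<Sum>\<alpha>\<in>?A. ennreal (?q \<alpha> y) * ennreal (?s \<alpha>))"
      by (intro sum.cong refl ennreal_mult'') simp
    finally show ?thesis by (simp only: sum_distrib_left mult.assoc)
  qed
  then have "(\<integral>\<^sup>+y. indicator (cell n) y * ennreal (local_energy k F (x n) (y - x n)) \<partial>lborel)
    = (\<integral>\<^sup>+y. (\<Sum>\<alpha>\<in>?A. (indicator (cell n) y * ennreal (?q \<alpha> y)) * ennreal (?s \<alpha>)) \<partial>lborel)"
    by simp
  also have "\<dots> = (\<Sum>\<alpha>\<in>?A. ennreal (weight N x I n \<alpha>) * ennreal (?s \<alpha>))"
    by (subst nn_integral_sum, measurable) (simp add: nn_integral_multc weight_eq_nn_integral[OF n])
  also have "\<dots> = ennreal (sample_sum k F n)"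
    unfolding sample_sum_def by (subst sum_ennreal[symmetric]) (auto simp: ennreal_mult weight_nonneg)
  finally show ?thesis .
qed

lemma sample_sum_upper:
  assumes F: "spectrum_in S F"
  shows "(\<integral>\<^sup>+n. ennreal (sample_sum k F n) \<partial>count_space I) \<le> ennreal (exp (2 * zeta + zeta\<^sup>2) * energy F)"
proof -
  let ?T = "\<lambda>n. \<Sum>p\<le>k. ennreal (radius ^ (2 * p)) * ennreal (jet_energy F p (x n))"
  have "(\<integral>\<^sup>+n. ennreal (sample_sum k F n) \<partial>count_space I) \<le> sampled ?T"
    unfolding sampled_eq_cells
  proof (rule nn_integral_mono)
    fix n assume "n \<in> space (count_space I)"
    then have n: "n \<in> I" by simp
    have "indicator (cell n) y * ennreal (local_energy k F (x n) (y - x n)) \<le> indicator (cell n) y * ?T n" for y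
    proof (cases "y \<in> cell n")
      case True
      have "ennreal (local_energy k F (x n) (y - x n)) \<le> ennreal (\<Sum>p\<le>k. radius ^ (2 * p) * jet_energy F p (x n))"
        using cell_radius(2)[OF n True] by (intro ennreal_leI local_energy_le) (simp add: radius_def)
      also have "\<dots> = ?T n"
        using radius_pos by (subst sum_ennreal[symmetric]) (auto simp: ennreal_mult jet_energy_nonneg)
      finally show ?thesis using True by simp
    qed simp
    then show "ennreal (sample_sum k F n) \<le> (\<integral>\<^sup>+y. indicator (cell n) y * ?T n \<partial>lborel)"
      unfolding cell_integral_sample_sum[OF n, symmetric] by (intro nn_integral_mono)
  qed
  also have "\<dots> = (\<Sum>p\<le>k. ennreal (radius ^ (2 * p)) * sampled (\<lambda>n. ennreal (jet_energy F p (x n))))"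
    by (simp only: sampled_sum sampled_cmult)
  also have "\<dots> \<le> (\<Sum>p\<le>k. ennreal (radius ^ (2 * p)) * ennreal ((exp zeta)\<^sup>2 * (m ^ (2 * p) / fact p * energy F)))"
    by (intro sum_mono mult_left_mono sampled_jet_energy_le sampling_const_exp F) auto
  also have "\<dots> = (\<Sum>p\<le>k. ennreal ((exp zeta)\<^sup>2 * energy F * ((zeta\<^sup>2) ^ p / fact p)))"
  proof (rule sum.cong[OF refl])
    fix p
    have "radius ^ (2 * p) * ((exp zeta)\<^sup>2 * (m ^ (2 * p) / fact p * energy F)) = (exp zeta)\<^sup>2 * energy F * ((zeta\<^sup>2) ^ p / fact p)"
      by (simp add: zeta_eq(1) power_mult_distrib power_mult[symmetric] field_simps)
    then show "ennreal (radius ^ (2 * p)) * ennreal ((exp zeta)\<^sup>2 * (m ^ (2 * p) / fact p * energy F)) = ennreal ((exp zeta)\<^sup>2 * energy F * ((zeta\<^sup>2) ^ p / fact p))"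
      using ennreal_mult'[of "radius ^ (2 * p)" "(exp zeta)\<^sup>2 * (m ^ (2 * p) / fact p * energy F)"] radius_pos
      by (simp only: zero_le_power less_imp_le)
  qed
  also have "\<dots> = ennreal ((exp zeta)\<^sup>2 * energy F * (\<Sum>p\<le>k. (zeta\<^sup>2) ^ p / fact p))"
    using energy_nonneg[of F] by (subst sum_ennreal) (auto simp: sum_distrib_left)
  also have "\<dots> \<le> ennreal ((exp zeta)\<^sup>2 * energy F * exp (zeta\<^sup>2))"
  proof (intro ennreal_leI mult_left_mono)
    have "0 \<le> Rk k (zeta\<^sup>2)"
      unfolding exp_tail_eq(4)[symmetric] exp_tail_def by (intro suminf_nonneg exp_tail_eq(1)) simp
    then show "(\<Sum>p\<le>k. (zeta\<^sup>2) ^ p / fact p) \<le> exp (zeta\<^sup>2)" by (simp add: Rk_def)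
  qed (use energy_nonneg[of F] in simp)
  also have "(exp zeta)\<^sup>2 * energy F * exp (zeta\<^sup>2) = exp (2 * zeta + zeta\<^sup>2) * energy F"
    by (simp add: exp_add exp_double)
  finally show ?thesis .
qed

lemma sampled_tail_le:
  assumes F: "spectrum_in S F" and M: "sampling_const M"
  shows "sampled (\<lambda>n. \<Sum>p. ennreal ((radius / m) ^ (p + Suc k) * jet_energy F (p + Suc k) (x n)))
    \<le> ennreal (M\<^sup>2 * Rk k zeta * energy F)" (is "sampled ?T \<le> _")
proof -
  have "sampled ?T = (\<Sum>p. ennreal ((radius / m) ^ (p + Suc k)) * sampled (\<lambda>n. ennreal (jet_energy F (p + Suc k) (x n))))"
  proof -
    have "ennreal ((radius / m) ^ q * jet_energy F q u) = ennreal ((radius / m) ^ q) * ennreal (jet_energy F q u)" for q u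
      using radius_pos m_pos by (intro ennreal_mult jet_energy_nonneg) simp
    then show ?thesis unfolding sampled_suminf by (simp only: sampled_cmult)
  qed
  also have "\<dots> \<le> (\<Sum>p. ennreal (M\<^sup>2 * energy F * (zeta ^ (p + Suc k) / fact (p + Suc k))))"
  proof (rule suminf_le)
    fix p
    let ?q = "p + Suc k"
    have "ennreal ((radius / m) ^ ?q) * sampled (\<lambda>n. ennreal (jet_energy F ?q (x n)))
      \<le> ennreal ((radius / m) ^ ?q) * ennreal (M\<^sup>2 * (m ^ (2 * ?q) / fact ?q * energy F))"
      by (intro mult_left_mono sampled_jet_energy_le M F) auto
    also have "\<dots> = ennreal ((radius / m) ^ ?q * (M\<^sup>2 * (m ^ (2 * ?q) / fact ?q * energy F)))"
      using radius_pos m_pos by (intro ennreal_mult'[symmetric]) simp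
    also have "(radius / m) ^ ?q * (M\<^sup>2 * (m ^ (2 * ?q) / fact ?q * energy F)) = M\<^sup>2 * energy F * (((radius / m) ^ ?q * m ^ (2 * ?q)) / fact ?q)"
      by simp
    also have "(radius / m) ^ ?q * m ^ (2 * ?q) = zeta ^ ?q"
      unfolding zeta_eq(1) power_mult power_mult_distrib[symmetric] using m_pos by (simp add: power2_eq_square)
    finally show "ennreal ((radius / m) ^ ?q) * sampled (\<lambda>n. ennreal (jet_energy F ?q (x n))) \<le> ennreal (M\<^sup>2 * energy F * (zeta ^ ?q / fact ?q))" .
  qed auto
  also have "\<dots> = ennreal (M\<^sup>2 * energy F * Rk k zeta)"
  proof (rule suminf_ennreal_eq)
    show "0 \<le> M\<^sup>2 * energy F * (zeta ^ (p + Suc k) / fact (p + Suc k))" for p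
      using energy_nonneg zeta_eq(2) by simp
    have "(\<lambda>p. zeta ^ (p + Suc k) / fact (p + Suc k)) sums Rk k zeta"
      unfolding exp_tail_eq(4)[symmetric] exp_tail_def by (rule summable_sums[OF exp_tail_eq(1)])
    then show "(\<lambda>p. M\<^sup>2 * energy F * (zeta ^ (p + Suc k) / fact (p + Suc k))) sums (M\<^sup>2 * energy F * Rk k zeta)"
      by (rule sums_mult)
  qed
  finally show ?thesis by (simp add: mult_ac)
  qed

text \<open>On the cell of \<open>x n\<close> the function is the sum of its Taylor polynomial \<open>P\<close> of degree \<open>k\<close> at \<open>x n\<close> and a remainder.
The remainder has relative L2 size at most \<open>e = M * R\<^sub>k\<close>, and the squared norm of \<open>P\<close> is at most \<open>exp d\<close> times the
weighted sum.\<close>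

lemma sample_sum_lower:
  assumes F: "spectrum_in S F" and M: "sampling_const M" and e: "0 < M * Rk k zeta" "M * Rk k zeta < 1"
  shows "ennreal (exp (- real CARD('n)) * (1 - M * Rk k zeta)\<^sup>2 * energy F) \<le> (\<integral>\<^sup>+n. ennreal (sample_sum k F n) \<partial>count_space I)"
proof -
  define e where "e = M * Rk k zeta"
  note e = e[folded e_def]
  define D where "D = exp (real CARD('n))"
  have D: "0 < D" by (simp add: D_def)
  let ?R = "Rk k zeta"
  have M0: "0 \<le> M" using M by (simp add: sampling_const_def)
  have R: "0 < ?R" using e(1) M0 by (simp add: e_def zero_less_mult_iff)
  let ?X = "\<integral>\<^sup>+n. ennreal (sample_sum k F n) \<partial>count_space I"
  define P where "P n y = (\<Sum>p<Suc k. taylor_term F p (x n) (y - x n))" for n y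
  define W where "W n y = local_energy k F (x n) (y - x n)" for n y
  define T where "T n = (\<Sum>p. ennreal ((radius / m) ^ (p + Suc k) * jet_energy F (p + Suc k) (x n)))" for n
  have PW: "(cmod (P n y))\<^sup>2 \<le> D * W n y" and W0: "0 \<le> W n y" for n y
    unfolding P_def D_def W_def by (rule taylor_poly_le local_energy_nonneg)+
  have [measurable]: "(\<lambda>y. W n y) \<in> borel_measurable borel" for n
    unfolding W_def local_energy_def by measurable
  note sumW = cell_integral_sample_sum[of _ k F, folded W_def]
  note sT = sampled_tail_le[OF F M, of k, folded T_def]
  have pw: "ennreal ((cmod (synth F y))\<^sup>2) \<le> ennreal (D / (1 - e)) * ennreal (W n y) + ennreal (?R / e) * T n"
    if n: "n \<in> I" "y \<in> cell n" for n y
  proof -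
    let ?g = "synth F y"
    have "ennreal ((cmod (?g - P n y))\<^sup>2) \<le> ennreal ?R * T n"
      using taylor_remainder_le[OF F S, of "y - x n" radius m "x n" "Suc k"] cell_radius(2)[OF n] radius_pos m_pos
      by (simp add: P_def T_def exp_tail_eq(4) zeta_eq(1) radius_def[symmetric])
    then have a: "ennreal (1 / e) * ennreal ((cmod (?g - P n y))\<^sup>2) \<le> ennreal (1 / e) * (ennreal ?R * T n)"
      by (rule mult_left_mono) simp
    have "ennreal (1 / e) * (ennreal ?R * T n) = ennreal (?R / e) * T n"
      using e R by (simp add: mult.assoc[symmetric] ennreal_mult[symmetric])
    moreover have "ennreal (1 / e * (cmod (?g - P n y))\<^sup>2) = ennreal (1 / e) * ennreal ((cmod (?g - P n y))\<^sup>2)"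
      by (rule ennreal_mult') (use e in simp)
    ultimately have a: "ennreal (1 / e * (cmod (?g - P n y))\<^sup>2) \<le> ennreal (?R / e) * T n"
      using a by (simp only:)
    \<comment> \<open>The weights are optimal when the remainder has relative size exactly \<open>e\<close>; after integration they reproduce the triangle inequality in L2.\<close>
    have "(cmod ?g)\<^sup>2 \<le> 1 / (1 - e) * (cmod (P n y))\<^sup>2 + 1 / e * (cmod (?g - P n y))\<^sup>2"
    proof -
      define s where "s = cmod (P n y)"
      define t where "t = cmod (?g - P n y)"
      have "cmod ?g \<le> s + t" unfolding s_def t_def using norm_triangle_ineq[of "P n y" "?g - P n y"] by simp
      then have "(cmod ?g)\<^sup>2 \<le> (s + t)\<^sup>2" by (intro power_mono) auto
      also have "(s + t)\<^sup>2 = 1 / (1 - e) * s\<^sup>2 + 1 / e * t\<^sup>2 - (e * s - (1 - e) * t)\<^sup>2 / (e * (1 - e))"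
        using e by (simp add: divide_simps) (simp add: power2_eq_square algebra_simps)
      also have "\<dots> \<le> 1 / (1 - e) * s\<^sup>2 + 1 / e * t\<^sup>2" using e by simp
      finally show ?thesis unfolding s_def t_def .
    qed
    also have "\<dots> \<le> 1 / (1 - e) * (D * W n y) + 1 / e * (cmod (?g - P n y))\<^sup>2"
      using PW[of n y] e by (intro add_right_mono mult_left_mono) auto
    finally have "ennreal ((cmod ?g)\<^sup>2) \<le> ennreal (D / (1 - e) * W n y + 1 / e * (cmod (?g - P n y))\<^sup>2)"
      by (simp add: ennreal_leI)
    also have "\<dots> = ennreal (D / (1 - e)) * ennreal (W n y) + ennreal (1 / e * (cmod (?g - P n y))\<^sup>2)"
    proof -
      have "0 \<le> D / (1 - e)" "0 \<le> D / (1 - e) * W n y" "0 \<le> 1 / e * (cmod (?g - P n y))\<^sup>2"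
        using e D W0[of n y] by simp_all
      then show ?thesis by (simp only: ennreal_plus ennreal_mult')
    qed
    also have "\<dots> \<le> ennreal (D / (1 - e)) * ennreal (W n y) + ennreal (?R / e) * T n"
      by (intro add_left_mono a)
    finally show ?thesis .
  qed
  have [measurable]: "synth F \<in> borel_measurable borel" by (rule synth_measurable[OF spectrum_inD(1)[OF F]])
  have "ennreal (energy F) = (\<integral>\<^sup>+y. ennreal ((cmod (synth F y))\<^sup>2) \<partial>lborel)"
    unfolding energy_def using synth_Plancherel(1)[OF F S] by (intro nn_integral_eq_integral[symmetric]) auto
  also have "\<dots> = (\<integral>\<^sup>+n. (\<integral>\<^sup>+y. indicator (cell n) y * ennreal ((cmod (synth F y))\<^sup>2) \<partial>lborel) \<partial>count_space I)"
    by (rule tiling_nn_integral[symmetric]) measurable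
  also have "\<dots> \<le> (\<integral>\<^sup>+n. (ennreal (D / (1 - e)) * ennreal (sample_sum k F n) + ennreal (?R / e) * (emeasure lborel (cell n) * T n)) \<partial>count_space I)"
  proof (rule nn_integral_mono)
    fix n assume "n \<in> space (count_space I)"
    then have n: "n \<in> I" by simp
    have "(\<integral>\<^sup>+y. indicator (cell n) y * ennreal ((cmod (synth F y))\<^sup>2) \<partial>lborel)
      \<le> (\<integral>\<^sup>+y. (ennreal (D / (1 - e)) * (indicator (cell n) y * ennreal (W n y)) + (ennreal (?R / e) * T n) * indicator (cell n) y) \<partial>lborel)"
    proof (rule nn_integral_mono)
      fix y
      show "indicator (cell n) y * ennreal ((cmod (synth F y))\<^sup>2) \<le> ennreal (D / (1 - e)) * (indicator (cell n) y * ennreal (W n y)) + (ennreal (?R / e) * T n) * indicator (cell n) y"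
        using pw[OF n, of y] by (cases "y \<in> cell n") auto
    qed
    also have "\<dots> = ennreal (D / (1 - e)) * (\<integral>\<^sup>+y. indicator (cell n) y * ennreal (W n y) \<partial>lborel) + (ennreal (?R / e) * T n) * emeasure lborel (cell n)"
      by (subst nn_integral_add) (auto simp: nn_integral_cmult)
    finally show "(\<integral>\<^sup>+y. indicator (cell n) y * ennreal ((cmod (synth F y))\<^sup>2) \<partial>lborel)
       \<le> ennreal (D / (1 - e)) * ennreal (sample_sum k F n) + ennreal (?R / e) * (emeasure lborel (cell n) * T n)"
      unfolding sumW[OF n] by (simp only: mult_ac)
  qed
  also have "\<dots> = ennreal (D / (1 - e)) * ?X + ennreal (?R / e) * sampled T"
    unfolding sampled_def by (simp add: nn_integral_add nn_integral_cmult)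
  also have "\<dots> \<le> ennreal (D / (1 - e)) * ?X + ennreal (?R / e) * ennreal (M\<^sup>2 * ?R * energy F)"
    by (intro add_left_mono mult_left_mono sT) simp
  also have "ennreal (?R / e) * ennreal (M\<^sup>2 * ?R * energy F) = ennreal (e * energy F)"
  proof -
    have "M * ?R = e" by (simp add: e_def)
    moreover have "?R / e * (M\<^sup>2 * ?R * energy F) = (M * ?R) * (M * ?R) / e * energy F" by (simp add: power2_eq_square)
    ultimately have "?R / e * (M\<^sup>2 * ?R * energy F) = e * energy F" using e by simp
    then show ?thesis using e R by (subst ennreal_mult'[symmetric]) auto
  qed
  finally have main: "ennreal (energy F) \<le> ennreal (D / (1 - e)) * ?X + ennreal (e * energy F)" .
  show ?thesis
  proof (cases ?X)
    case (real X)
    have "ennreal (energy F) \<le> ennreal (D / (1 - e) * X + e * energy F)"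
    proof -
      have "0 \<le> D / (1 - e)" "0 \<le> D / (1 - e) * X" "0 \<le> e * energy F"
        using e D real(1) energy_nonneg[of F] by simp_all
      then show ?thesis using main unfolding real(2) by (simp only: ennreal_plus ennreal_mult')
    qed
    then have "energy F \<le> D / (1 - e) * X + e * energy F"
      using real e D energy_nonneg[of F] by (subst (asm) ennreal_le_iff) auto
    then have "(1 - e) * energy F * (1 - e) \<le> D * X"
      using e by (simp add: field_simps)
    then have "exp (- real CARD('n)) * (1 - e)\<^sup>2 * energy F \<le> X"
      using D by (simp add: exp_minus D_def[symmetric] field_simps power2_eq_square)
    then show ?thesis unfolding real(2) e_def by (rule ennreal_leI)
  qed simp
qed

end

section \<open>The density constant\<close>

lemma Rk_ge: "0 \<le> z \<Longrightarrow> z ^ Suc k / fact (Suc k) \<le> Rk k z"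
  unfolding exp_tail_eq(4)[symmetric] exp_tail_def
  using sum_le_suminf[OF exp_tail_eq(1)[of z "Suc k"], of "{0}"] by simp

lemma Rk_pos: "0 < z \<Longrightarrow> 0 < Rk k z"
  using Rk_ge[of z k] by (smt (verit) divide_pos_pos fact_gt_zero zero_less_power)

text \<open>Passing from \<open>z\<close> to \<open>w\<close> multiplies each term of the tail series by at least \<open>w / z\<close>.\<close>

lemma Rk_strict_mono:
  assumes "0 < z" "z < w"
  shows "Rk k z < Rk k w"
proof -
  have c: "1 < w / z" using assms by simp
  have "w / z * Rk k z = (\<Sum>p. w / z * (z ^ (p + Suc k) / fact (p + Suc k)))"
    unfolding exp_tail_eq(4)[symmetric] exp_tail_def by (rule suminf_mult[symmetric, OF exp_tail_eq(1)])
  also have "\<dots> \<le> Rk k w"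
    unfolding exp_tail_eq(4)[symmetric] exp_tail_def
  proof (rule suminf_le[OF _ summable_mult[OF exp_tail_eq(1)] exp_tail_eq(1)])
    fix p
    have "w / z \<le> (w / z) ^ (p + Suc k)" using c self_le_power[of "w / z" "p + Suc k"] by simp
    then have "w / z * z ^ (p + Suc k) \<le> (w / z) ^ (p + Suc k) * z ^ (p + Suc k)"
      using assms by (intro mult_right_mono) auto
    also have "\<dots> = w ^ (p + Suc k)" using assms by (simp only: power_mult_distrib[symmetric]) simp
    finally show "w / z * (z ^ (p + Suc k) / fact (p + Suc k)) \<le> w ^ (p + Suc k) / fact (p + Suc k)"
      unfolding times_divide_eq_right by (rule divide_right_mono) simp
  qed
  finally have "w / z * Rk k z \<le> Rk k w" .
  moreover have "Rk k z < w / z * Rk k z" using mult_strict_right_mono[OF c Rk_pos[OF assms(1), of k]] by (simp only: mult_1_left)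
  ultimately show ?thesis by linarith
qed

lemma continuous_on_Rk: "continuous_on A (Rk k)"
  unfolding Rk_def[abs_def] by (intro continuous_intros) auto

lemma Rk_0: "Rk k 0 = 0"
  by (simp add: Rk_def power_0_left sum.atMost_shift)

text \<open>The value at 0 replaces the limit from the right in the description of the inverse function.\<close>

lemma inverse_at_one:
  fixes f :: "real \<Rightarrow> real"
  assumes cont: "continuous_on {0..} f" and f0: "f 0 = 0" and big: "0 < w" "1 \<le> f w"
    and mono: "\<And>z w. 0 < z \<Longrightarrow> z < w \<Longrightarrow> f z < f w"
  shows "0 < the_inv_into {0<..} f 1" and "0 < z \<Longrightarrow> z < the_inv_into {0<..} f 1 \<Longrightarrow> f z < 1"
proof -
  have "\<exists>u\<ge>0. u \<le> w \<and> f u = 1"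
    using IVT'[of f 0 1 w] big f0 continuous_on_subset[OF cont, of "{0..w}"] by auto
  then obtain u where u: "0 \<le> u" "f u = 1" by auto
  then have u0: "0 < u" using f0 by (cases "u = 0") auto
  have inj: "inj_on f {0<..}"
    by (rule linorder_inj_onI) (use mono in \<open>force+\<close>)
  have "the_inv_into {0<..} f 1 = u"
    using the_inv_into_f_f[OF inj, of u] u u0 by simp
  then show "0 < the_inv_into {0<..} f 1" "0 < z \<Longrightarrow> z < the_inv_into {0<..} f 1 \<Longrightarrow> f z < 1"
    using u u0 mono[of z u] by auto
qed

lemma Rk_ge_1: "1 \<le> Rk k (fact (Suc k))"
proof -
  have "(fact (Suc k) :: real) \<le> fact (Suc k) ^ Suc k" by (rule self_le_power[OF fact_ge_1]) simp
  then have "1 \<le> (fact (Suc k) :: real) ^ Suc k / fact (Suc k)" by (simp del: fact_Suc power_Suc)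
  then show ?thesis using Rk_ge[OF fact_ge_zero, of "Suc k" k] by linarith
qed

lemma Hk_one: "0 < Hk k 1" "0 < z \<Longrightarrow> z < Hk k 1 \<Longrightarrow> hk k z < 1"
proof -
  have *: "continuous_on {0..} (hk k)"
    unfolding hk_def[abs_def] by (intro continuous_intros continuous_on_Rk)
  have "1 \<le> hk k (fact (Suc k))"
    unfolding hk_def using mult_mono[of 1 "exp (fact (Suc k))" 1 "Rk k (fact (Suc k))"] Rk_ge_1[of k] by simp
  note 1 = inverse_at_one[OF * _ fact_gt_zero this]
  have 2: "hk k 0 = 0" by (simp add: hk_def Rk_0)
  have 3: "hk k z < hk k w" if "0 < z" "z < w" for z w
    unfolding hk_def using that Rk_strict_mono[of z w k] Rk_pos[of z k] by (intro mult_strict_mono) auto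
  show "0 < Hk k 1" "0 < z \<Longrightarrow> z < Hk k 1 \<Longrightarrow> hk k z < 1"
    unfolding Hk_def using 1[OF 2 3] by auto
qed

text \<open>The second formula extends \<open>z / sigma_star d z\<close> continuously to 0, where the quotient itself only has its
conventional value.\<close>

lemma sigma_star_props:
  assumes d: "0 < d"
  shows "0 < z \<Longrightarrow> 0 < sigma_star d z" and "0 \<le> z \<Longrightarrow> z / sigma_star d z = sqrt (z * (real d + z)) - z"
    and "0 < z \<Longrightarrow> z < w \<Longrightarrow> sigma_star d z \<le> sigma_star d w"
    and "0 < z \<Longrightarrow> z < w \<Longrightarrow> z / sigma_star d z \<le> w / sigma_star d w"
proof -
  show pos: "0 < sigma_star d z" if "0 < z" for z
    unfolding sigma_star_def using that d by (intro divide_pos_pos add_pos_nonneg) auto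
  show eq: "z / sigma_star d z = sqrt (z * (real d + z)) - z" if "0 \<le> z" for z
  proof (cases "z = 0")
    case False
    then have z: "0 < z" using that by simp
    have "(sqrt (z * (real d + z)) - z) * (z + sqrt (z * (real d + z))) = (sqrt (z * (real d + z)))\<^sup>2 - z\<^sup>2"
      by (simp add: algebra_simps power2_eq_square)
    also have "\<dots> = real d * z" using z by (simp add: power2_eq_square algebra_simps)
    finally have "(sqrt (z * (real d + z)) - z) * sigma_star d z = z"
      using d by (simp add: sigma_star_def)
    then show ?thesis using pos[OF z] by (simp add: field_simps)
  qed (simp add: sigma_star_def)
  show "sigma_star d z \<le> sigma_star d w" if "0 < z" "z < w"
    unfolding sigma_star_def using that d
    by (intro divide_right_mono add_mono real_sqrt_le_mono mult_mono) auto
  show "z / sigma_star d z \<le> w / sigma_star d w" if zw: "0 < z" "z < w"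
  proof -
    have "z * (z * (w * (real d + w))) \<le> w * (w * (z * (real d + z)))"
      using zw mult_right_mono[of z w "real d"] by (simp add: algebra_simps)
    then have "sqrt (z * z * (w * (real d + w))) \<le> sqrt (w * w * (z * (real d + z)))"
      by (intro real_sqrt_le_mono) (simp add: mult.assoc)
    then have "z * sqrt (w * (real d + w)) \<le> w * sqrt (z * (real d + z))"
      using zw by (simp add: real_sqrt_mult)
    then have "z * sigma_star d w \<le> w * sigma_star d z"
      using d by (simp add: sigma_star_def divide_right_mono algebra_simps)
    then show ?thesis using pos[of z] pos[of w] zw by (simp add: field_simps)
  qed
qed

lemma Gkd_one:
  assumes d: "0 < d"
  shows "0 < Gkd k d 1" "0 < z \<Longrightarrow> z < Gkd k d 1 \<Longrightarrow> gkd k d z < 1" "gkd k d 0 = 0"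
proof -
  note s = sigma_star_props[OF d]
  let ?f = "\<lambda>z. (1 + 2 * sigma_star d z) powr (real d / 2) * exp (z / sigma_star d z)"
  have g: "gkd k d z = ?f z * Rk k z" for z by (simp add: gkd_def)
  have s0: "0 \<le> sigma_star d z" if "0 \<le> z" for z using s(1)[of z] that by (cases "z = 0") (auto simp: sigma_star_def)
  have "continuous_on {0..} (\<lambda>z. (1 + 2 * sigma_star d z) powr (real d / 2) * exp (sqrt (z * (real d + z)) - z) * Rk k z)"
  proof (intro continuous_intros continuous_on_Rk)
    show "continuous_on {0..} (sigma_star d)"
      unfolding sigma_star_def[abs_def] using d by (intro continuous_intros) auto
    show "\<forall>z\<in>{0..}. 1 + 2 * sigma_star d z \<noteq> 0" using s0 by (smt (verit) atLeast_iff)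
  qed
  then have *: "continuous_on {0..} (gkd k d)"
    by (rule continuous_on_eq) (simp add: gkd_def s(2))
  have f1: "1 \<le> ?f z" if "0 < z" for z
  proof -
    have "1 * 1 \<le> ?f z"
      using s(1)[OF that] that by (intro mult_mono ge_one_powr_ge_zero) auto
    then show ?thesis by simp
  qed
  have "1 \<le> gkd k d (fact (Suc k))"
    unfolding g using mult_mono[of 1 "?f (fact (Suc k))" 1 "Rk k (fact (Suc k))"] Rk_ge_1[of k] f1[of "fact (Suc k)"] by simp
  note 1 = inverse_at_one[OF * _ fact_gt_zero this]
  show 2: "gkd k d 0 = 0" by (simp add: gkd_def Rk_0)
  have 3: "gkd k d z < gkd k d w" if zw: "0 < z" "z < w" for z w
  proof -
    have "?f z \<le> ?f w"
      using s(3)[OF zw] s(4)[OF zw] s(1)[of z] zw by (intro mult_mono powr_mono2) auto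
    then have "?f z * Rk k z \<le> ?f w * Rk k z" using Rk_pos[of z k] zw by (intro mult_right_mono) auto
    also have "\<dots> < ?f w * Rk k w"
      using Rk_strict_mono[OF zw, of k] f1[of w] zw by (intro mult_strict_left_mono) auto
    finally show ?thesis by (simp add: g)
  qed
  show "0 < Gkd k d 1" "0 < z \<Longrightarrow> z < Gkd k d 1 \<Longrightarrow> gkd k d z < 1"
    unfolding Gkd_def using 1[OF 2 3] by auto
qed

lemma less_Ckd:
  assumes d: "0 < d"
  shows "0 < Ckd k d" and "0 < z \<Longrightarrow> z < Ckd k d \<Longrightarrow> min (hk k z) (gkd k d z) < 1"
  using Hk_one[where k=k] Gkd_one[OF d, where k=k] by (auto simp: Ckd_def less_max_iff_disj min_less_iff_disj)

section \<open>The frame\<close>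

lemma infsum_eq_nn_integral:
  fixes f :: "'i \<Rightarrow> real"
  assumes f: "\<And>n. n \<in> I \<Longrightarrow> 0 \<le> f n" and fin: "(\<integral>\<^sup>+n. ennreal (f n) \<partial>count_space I) < \<infinity>"
  shows "f summable_on I" and "ennreal (infsum f I) = (\<integral>\<^sup>+n. ennreal (f n) \<partial>count_space I)"
proof -
  have "(\<integral>\<^sup>+n. ennreal (norm (f n)) \<partial>count_space I) = (\<integral>\<^sup>+n. ennreal (f n) \<partial>count_space I)"
    by (rule nn_integral_cong) (use f in auto)
  then have int: "integrable (count_space I) f" using fin by (intro integrableI_bounded) auto
  then have as: "Infinite_Set_Sum.abs_summable_on f I" by (simp add: Infinite_Set_Sum.abs_summable_on_def)
  then have "Infinite_Sum.abs_summable_on f I" by (simp only: abs_summable_equivalent)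
  then show "f summable_on I" by (rule abs_summable_summable)
  have "infsum f I = integral\<^sup>L (count_space I) f"
    using infsetsum_infsum[OF as] by (simp add: infsetsum_def)
  then show "ennreal (infsum f I) = (\<integral>\<^sup>+n. ennreal (f n) \<partial>count_space I)"
    using nn_integral_eq_integral[OF int] f by (simp add: AE_count_space)
qed

text \<open>Everything in the conclusion is expressed by the spectrum \<open>F\<close> of \<open>f\<close>: the smooth representative is \<open>synth F\<close>, its derivatives
are \<open>synth (dsym \<alpha> F)\<close>, and the frame coefficients are the weighted samples up to a sign.  Both parts of the
conclusion are therefore the same inequality.\<close>

lemma frame_of_synth_bounds:
  fixes k :: nat and S :: "(real^'n::finite) set" and w :: "'i \<Rightarrow> ('n \<Rightarrow> nat) \<Rightarrow> real" and x :: "'i \<Rightarrow> real^'n"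
  defines "Q \<equiv> \<lambda>F n. \<Sum>\<alpha> | mi_size \<alpha> \<le> k. w n \<alpha> * (cmod (synth (dsym \<alpha> F) (x n)))\<^sup>2"
  assumes S: "compact S" and AB: "0 < A" "0 < B" and w: "\<And>n \<alpha>. 0 \<le> w n \<alpha>"
    and Q: "\<And>F. spectrum_in S F \<Longrightarrow> Q F summable_on I \<and>
        A * (sqnorm (synth F)) \<le> infsum (Q F) I \<and> infsum (Q F) I \<le> B * (sqnorm (synth F))"
  shows "(\<forall>f\<in>bandlimited S.
       (\<lambda>n. \<Sum>\<alpha> | mi_size \<alpha> \<le> k. w n \<alpha> * (cmod (mi_deriv \<alpha> (smooth_rep f) (x n)))\<^sup>2) summable_on I \<and>
       A * (L2_norm f)\<^sup>2
         \<le> (\<Sum>\<^sub>\<infinity>n\<in>I. \<Sum>\<alpha> | mi_size \<alpha> \<le> k. w n \<alpha> * (cmod (mi_deriv \<alpha> (smooth_rep f) (x n)))\<^sup>2) \<and>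
       (\<Sum>\<^sub>\<infinity>n\<in>I. \<Sum>\<alpha> | mi_size \<alpha> \<le> k. w n \<alpha> * (cmod (mi_deriv \<alpha> (smooth_rep f) (x n)))\<^sup>2)
         \<le> B * (L2_norm f)\<^sup>2) \<and>
    L2_frame (bandlimited S) (I \<times> {\<alpha>. mi_size \<alpha> \<le> k})
      (\<lambda>(n, \<alpha>) y. of_real (sqrt (w n \<alpha>)) * mi_deriv \<alpha> (\<Phi> S) (y - x n)) A B"
proof -
  let ?\<phi> = "\<lambda>(n, \<alpha>) y. of_real (sqrt (w n \<alpha>)) * mi_deriv \<alpha> (\<Phi> S) (y - x n)"
  let ?J = "I \<times> {\<alpha>. mi_size \<alpha> \<le> k} :: ('i \<times> ('n \<Rightarrow> nat)) set"
  have main: "(\<lambda>n. \<Sum>\<alpha> | mi_size \<alpha> \<le> k. w n \<alpha> * (cmod (mi_deriv \<alpha> (smooth_rep f) (x n)))\<^sup>2) = Q F \<and>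
      (L2_norm f)\<^sup>2 = (sqnorm (synth F)) \<and>
      (\<lambda>j. (cmod (L2_inner f (?\<phi> j)))\<^sup>2) summable_on ?J \<and> (\<Sum>\<^sub>\<infinity>j\<in>?J. (cmod (L2_inner f (?\<phi> j)))\<^sup>2) = infsum (Q F) I"
    if f: "f \<in> bandlimited S" and F: "spectrum_in S F" and fF: "AE y in lborel. f y = synth F y" for f F
  proof (intro conjI)
    have fm [measurable]: "f \<in> borel_measurable borel" using f by (auto simp: bandlimited_def L2_def)
    have [measurable]: "synth F \<in> borel_measurable borel" by (rule synth_measurable[OF spectrum_inD(1)[OF F]])
    have "smooth_rep f = synth F" by (rule smooth_rep_eq[OF smooth_synth[OF F S] fF])
    then show "(\<lambda>n. \<Sum>\<alpha> | mi_size \<alpha> \<le> k. w n \<alpha> * (cmod (mi_deriv \<alpha> (smooth_rep f) (x n)))\<^sup>2) = Q F"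
      unfolding Q_def by (simp add: mi_deriv_synth[OF F S])
    have "(L2_norm f)\<^sup>2 = (sqnorm f)"
      unfolding L2_norm_def by (intro real_sqrt_pow2 integral_nonneg_AE) simp
    also have "\<dots> = (sqnorm (synth F))"
      by (rule integral_cong_AE) (use fF in \<open>auto elim: eventually_mono\<close>)
    finally show "(L2_norm f)\<^sup>2 = (sqnorm (synth F))" .
    have in': "(cmod (L2_inner f (?\<phi> (n, \<alpha>))))\<^sup>2 = w n \<alpha> * (cmod (synth (dsym \<alpha> F) (x n)))\<^sup>2" for n \<alpha>
      using shifted_kernel_bandlimited(2)[OF S F fm fF, of "sqrt (w n \<alpha>)" \<alpha> "x n"] w[of n \<alpha>] by simp
    have hs: "((\<lambda>\<alpha>. (cmod (L2_inner f (?\<phi> (n, \<alpha>))))\<^sup>2) has_sum Q F n) {\<alpha>. mi_size \<alpha> \<le> k}" for n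
      unfolding in' Q_def by (rule has_sum_finite) simp
    have hq: "(Q F has_sum infsum (Q F) I) I" using Q[OF F] by (simp add: has_sum_infsum)
    show sm: "(\<lambda>j. (cmod (L2_inner f (?\<phi> j)))\<^sup>2) summable_on ?J"
      by (rule summable_on_SigmaI[OF hs]) (use Q[OF F] in auto)
    have "((\<lambda>j. (cmod (L2_inner f (?\<phi> j)))\<^sup>2) has_sum infsum (Q F) I) ?J"
      by (rule has_sum_SigmaI[OF hs hq sm])
    then show "(\<Sum>\<^sub>\<infinity>j\<in>?J. (cmod (L2_inner f (?\<phi> j)))\<^sup>2) = infsum (Q F) I" by (rule infsumI)
  qed
  have mem: "?\<phi> j \<in> bandlimited S" for j
    using shifted_kernel_bandlimited(1)[OF S] by (cases j) simp
  show ?thesis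
    unfolding L2_frame_def
  proof (intro conjI ballI AB mem)
    fix f assume f: "f \<in> bandlimited S"
    obtain F where F: "spectrum_in S F" "AE y in lborel. f y = synth F y"
      using bandlimited_synth[OF f S] by blast
    note m = main[OF f F] and q = Q[OF F(1)]
    show "(\<lambda>n. \<Sum>\<alpha> | mi_size \<alpha> \<le> k. w n \<alpha> * (cmod (mi_deriv \<alpha> (smooth_rep f) (x n)))\<^sup>2) summable_on I"
      "A * (L2_norm f)\<^sup>2 \<le> (\<Sum>\<^sub>\<infinity>n\<in>I. \<Sum>\<alpha> | mi_size \<alpha> \<le> k. w n \<alpha> * (cmod (mi_deriv \<alpha> (smooth_rep f) (x n)))\<^sup>2)"
      "(\<Sum>\<^sub>\<infinity>n\<in>I. \<Sum>\<alpha> | mi_size \<alpha> \<le> k. w n \<alpha> * (cmod (mi_deriv \<alpha> (smooth_rep f) (x n)))\<^sup>2) \<le> B * (L2_norm f)\<^sup>2"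
      "(\<lambda>j. (cmod (L2_inner f (?\<phi> j)))\<^sup>2) summable_on ?J"
      "A * (L2_norm f)\<^sup>2 \<le> (\<Sum>\<^sub>\<infinity>j\<in>?J. (cmod (L2_inner f (?\<phi> j)))\<^sup>2)"
      "(\<Sum>\<^sub>\<infinity>j\<in>?J. (cmod (L2_inner f (?\<phi> j)))\<^sup>2) \<le> B * (L2_norm f)\<^sup>2"
      using m q by (simp_all only:)
  qed
qed

lemma synth_zero_of_null:
  fixes F :: "real^'n::finite \<Rightarrow> complex"
  assumes F: "spectrum_in S F" and S: "S \<subseteq> {0}"
  shows "synth F = (\<lambda>_. 0)"
proof
  fix x
  note [measurable] = spectrum_inD(1)[OF F]
  have "AE \<omega> in lborel. \<omega> \<notin> {0::real^'n}" by (intro AE_not_in countable_imp_null_set_lborel) simp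
  then have "AE \<omega> in lborel. F \<omega> * iexp (\<omega> \<bullet> x) = 0"
    by eventually_elim (use spectrum_inD(3)[OF F] S in auto)
  then have "(LBINT \<omega>. F \<omega> * iexp (\<omega> \<bullet> x)) = 0" by (rule integral_eq_zero_AE)
  then show "synth F x = 0" by (simp add: synth_def)
qed

lemma band_radius_ge:
  assumes S: "compact S"
  shows "\<omega> \<in> S \<Longrightarrow> norm \<omega> \<le> band_radius S" and "0 \<le> band_radius S"
proof -
  have b: "bdd_above (norm ` S)"
    using compact_imp_bounded[OF S] by (simp add: bounded_norm_comp bdd_above_norm[symmetric])
  show *: "\<omega> \<in> S \<Longrightarrow> norm \<omega> \<le> band_radius S" for \<omega>
    using cSUP_upper[OF _ b] by (auto simp: band_radius_def)
  show "0 \<le> band_radius S"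
  proof (cases "S = {}")
    case False
    then obtain \<omega> where "\<omega> \<in> S" by blast
    then show ?thesis using *[of \<omega>] norm_ge_zero[of \<omega>] by linarith
  qed (simp add: band_radius_def)
qed

theorem theorem3p1:
  fixes k :: nat
    and \<Omega> :: "(real^'n::finite) set"
    and N :: "real^'n \<Rightarrow> real"
    and I :: "'i set"
    and x :: "'i \<Rightarrow> real^'n"
  defines "\<mu> \<equiv> weight N x I"
    and "\<delta> \<equiv> sampling_density N x I"
    and "b \<equiv> b_const N"
    and "m \<equiv> band_radius \<Omega>"
    and "d \<equiv> CARD('n)"
  assumes "compact \<Omega>"
    and "is_norm N"
    and "countable I"
    and tiling: "AE y in lborel. \<exists>!n. n \<in> I \<and> y \<in> voronoi N x I n"
    and "\<delta> < ennreal (Ckd k d) / ennreal (m * b)"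
  shows "\<exists>A B. 0 < A \<and> 0 < B \<and>
    A \<ge> exp (- real d) *
      (1 - min (hk k (m * b * enn2real \<delta>)) (gkd k d (m * b * enn2real \<delta>)))\<^sup>2 \<and>
    B \<le> exp (2 * (m * b * enn2real \<delta>) + (m * b * enn2real \<delta>)\<^sup>2) \<and>
    (\<forall>f\<in>bandlimited \<Omega>.
       (\<lambda>n. \<Sum>\<alpha> | mi_size \<alpha> \<le> k. \<mu> n \<alpha> * (cmod (mi_deriv \<alpha> (smooth_rep f) (x n)))\<^sup>2) summable_on I \<and>
       A * (L2_norm f)\<^sup>2
         \<le> (\<Sum>\<^sub>\<infinity>n\<in>I. \<Sum>\<alpha> | mi_size \<alpha> \<le> k. \<mu> n \<alpha> * (cmod (mi_deriv \<alpha> (smooth_rep f) (x n)))\<^sup>2) \<and>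
       (\<Sum>\<^sub>\<infinity>n\<in>I. \<Sum>\<alpha> | mi_size \<alpha> \<le> k. \<mu> n \<alpha> * (cmod (mi_deriv \<alpha> (smooth_rep f) (x n)))\<^sup>2)
         \<le> B * (L2_norm f)\<^sup>2) \<and>
    L2_frame (bandlimited \<Omega>) (I \<times> {\<alpha>. mi_size \<alpha> \<le> k})
      (\<lambda>(n, \<alpha>) y. of_real (sqrt (\<mu> n \<alpha>)) * mi_deriv \<alpha> (\<Phi> \<Omega>) (y - x n)) A B"
proof -
  let ?D = "enn2real \<delta>"
  define z where "z = m * b * ?D"
  define e where "e = min (hk k z) (gkd k d z)"
  define A where "A = exp (- real d) * (1 - e)\<^sup>2"
  define B where "B = exp (2 * z + z\<^sup>2)"
  have d: "0 < d" by (simp add: d_def)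
  have b: "0 < b" unfolding b_def by (rule b_const_props[OF \<open>is_norm N\<close>])
  note m = band_radius_ge[OF \<open>compact \<Omega>\<close>, folded m_def]
  have \<delta>: "\<delta> = ennreal ?D"
    using assms(10) by (metis ennreal_enn2real less_top_ennreal order.strict_trans2 top_greatest)
  let ?Q = "\<lambda>F n. \<Sum>\<alpha> | mi_size \<alpha> \<le> k. \<mu> n \<alpha> * (cmod (synth (dsym \<alpha> F) (x n)))\<^sup>2"
  have main: "e < 1 \<and> (\<forall>F. spectrum_in \<Omega> F \<longrightarrow> ?Q F summable_on I \<and>
        A * (sqnorm (synth F)) \<le> infsum (?Q F) I \<and> infsum (?Q F) I \<le> B * (sqnorm (synth F)))"
  proof (cases "m = 0")
    case True
    \<comment> \<open>The band is a null set, so all bandlimited functions vanish almost everywhere.\<close>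
    then have "\<Omega> \<subseteq> {0}" using m(1) by fastforce
    then have "synth F = (\<lambda>_. 0)" "synth (dsym \<alpha> F) = (\<lambda>_. 0)" if "spectrum_in \<Omega> F" for F \<alpha>
      using that spectrum_in_symb[OF that \<open>compact \<Omega>\<close>] by (blast intro: synth_zero_of_null)+
    moreover have "e = 0" by (simp add: e_def z_def True hk_def Rk_0 Gkd_one(3)[OF d])
    ultimately show ?thesis by simp
  next
    case False
    then have m0: "0 < m" using m(2) by simp
    interpret bandlimited_sampling N x I ?D \<Omega> m
      using assms(7,8,9) \<delta> m(1) m0 \<open>compact \<Omega>\<close> by unfold_locales (simp_all add: \<delta>_def)
    have z: "zeta = z" by (simp add: zeta_def z_def b_def)
    have zC: "z < Ckd k d"
    proof -
      have mb: "0 < m * b" using m0 b by simp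
      have "ennreal ?D < ennreal (Ckd k d / (m * b))"
        using assms(10) \<delta> mb less_Ckd(1)[OF d, of k] by (simp add: divide_ennreal)
      then have "?D < Ckd k d / (m * b)" by (simp add: ennreal_less_iff)
      then show ?thesis using mb by (simp add: z_def field_simps)
    qed
    have z0: "0 < z" using zeta_eq(2) z by simp
    have e1: "e < 1" unfolding e_def by (rule less_Ckd(2)[OF d z0 zC])
    have R: "0 < Rk k z" by (rule Rk_pos[OF z0])
    have \<sigma>: "0 < sigma_star d z" by (rule sigma_star_props(1)[OF d z0])
    obtain M where M: "sampling_const M" "0 < M" "M * Rk k z = e"
    proof (cases "hk k z \<le> gkd k d z")
      case True
      show thesis
        by (rule that[of "exp z"]) (use sampling_const_exp True in \<open>simp_all add: z e_def hk_def\<close>)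
    next
      case False
      let ?M = "(1 + 2 * sigma_star d z) powr (real d / 2) * exp (z / sigma_star d z)"
      have "sampling_const ?M" using sampling_const_average[OF \<sigma>] by (simp add: z d_def)
      moreover have "?M * Rk k z = e" using False by (simp add: e_def gkd_def)
      ultimately show thesis using \<sigma> by (intro that[of ?M]) auto
    qed
    have e0: "0 < M * Rk k zeta" "M * Rk k zeta < 1" "M * Rk k zeta = e"
      using M mult_pos_pos[OF M(2) R] e1 by (simp_all add: z)
    have "?Q F summable_on I \<and> A * (sqnorm (synth F)) \<le> infsum (?Q F) I \<and> infsum (?Q F) I \<le> B * (sqnorm (synth F))"
      if F: "spectrum_in \<Omega> F" for F
    proof -
      have Q: "?Q F = sample_sum k F" by (simp add: sample_sum_def \<mu>_def fun_eq_iff)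
      have f0: "0 \<le> sample_sum k F n" for n unfolding sample_sum_def by (intro sum_nonneg mult_nonneg_nonneg weight_nonneg) simp
      have up: "(\<integral>\<^sup>+n. ennreal (sample_sum k F n) \<partial>count_space I) \<le> ennreal (B * energy F)"
        using sample_sum_upper[OF F, of k] by (simp add: B_def z)
      then have fin: "(\<integral>\<^sup>+n. ennreal (sample_sum k F n) \<partial>count_space I) < \<infinity>"
        by (rule order.strict_trans1) simp
      note inf = infsum_eq_nn_integral[OF f0 fin]
      have low: "ennreal (A * energy F) \<le> (\<integral>\<^sup>+n. ennreal (sample_sum k F n) \<partial>count_space I)"
        using sample_sum_lower[OF F M(1) e0(1,2)] by (simp add: A_def e0(3) d_def)
      have "0 \<le> infsum (sample_sum k F) I" by (rule infsum_nonneg) (rule f0)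
      moreover have "0 \<le> B * energy F" using energy_nonneg by (simp add: B_def)
      ultimately show ?thesis
        unfolding Q energy_def[symmetric] using inf low up by (auto simp: ennreal_le_iff simp flip: inf(2))
    qed
    then show ?thesis using e1 by blast
  qed
  have AB: "0 < A" "0 < B" using main by (simp_all add: A_def B_def)
  have bounds: "exp (- real d) * (1 - e)\<^sup>2 \<le> A" "B \<le> exp (2 * z + z\<^sup>2)" by (simp_all add: A_def B_def)
  show ?thesis
    unfolding z_def[symmetric] e_def[symmetric]
    by (rule exI[of _ A], rule exI[of _ B], rule conjI[OF AB(1)], rule conjI[OF AB(2)],
        rule conjI[OF bounds(1)], rule conjI[OF bounds(2)],
        rule frame_of_synth_bounds[OF \<open>compact \<Omega>\<close> AB])
      (use main in \<open>auto simp: \<mu>_def weight_nonneg\<close>)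
qed

end
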